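(* Let $(L,R)$ be any algebraic weak factorisation system on $\mathbf{Top}$ and let $F\colon\mathcal{J}\to L\text{-}\mathrm{Map}$ be a functor over $\mathbf{Top}^{\mathbf 2}$. Then there is a unique functor $F'\colon\mathbf{CellCx}\to L\text{-}\mathrm{Map}$ over $\mathbf{Top}^{\mathbf 2}$ which satisfies $F=F'\circ\eta$ and preserves composition, i.e. sends the composite $B*A$ of cell complexes to the composite left map of $F'A$ followed by $F'B$. Here $\eta\colon\mathcal{J}\to\mathbf{CellCx}$ sends each element of $\mathcal{J}$ to its canonical single-cell complex.
   Context: Algebraic weak factorisation systems. For a category $\mathcal{C}$, $\mathcal{C}^{\mathbf 2}$ is its arrow category; morphisms are commutative squares $(a,b)$ (domain component $a$, codomain component $b$). An awfs $(L,R)$ on $\mathcal{C}$ consists of a comonad $(L,\vec\epsilon,\vec\delta)$ and a monad $(R,\vec\eta,\vec\mu)$ on $\mathcal{C}^{\mathbf 2}$ whose underlying copointed and pointed endofunctors form a functorial factorisation: each $f\colon A\to B$ factors as $A\xrightarrow{Lf}Mf\xrightarrow{Rf}B$ with $\vec\epsilon_f=(1_A,Rf)$, $\vec\eta_f=(Lf,1_B)$, where $M=\mathrm{cod}\circ L=\mathrm{dom}\circ R$. Then $\vec\delta_f=(1,\delta_f)$, $\vec\mu_f=(\mu_f,1)$; it is required that the transformation $LR\to RL$ with components $(\delta_f,\mu_f)$ be a distributive law of the comonad over the monad. $L\text{-}\mathrm{Map}$ is the category of coalgebras of $L$ (left maps), with forgetful functor to $\mathcal{C}^{\mathbf 2}$;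 a coalgebra is written $(f,\alpha)$ with $f\colon A\to B$ and structure map $\alpha\colon B\to Mf$ (the coalgebra structure being $(1_A,\alpha)\colon f\to Lf$). For left maps $(f,\alpha)$, $(g,\beta)$ with $f\colon A\to B$, $g\colon B\to C$, the composite left map is $(gf,\beta\bullet\alpha)$ with $\beta\bullet\alpha=\mu_{gf}\circ M(M(1,g)\circ\alpha,1)\circ\beta$. Cell complexes. $\mathcal{J}$ is the set of inclusions $S^{n-1}\hookrightarrow D^n$, $n\ge 0$ (with $S^{-1}=\emptyset$, $S^0$ the endpoints of $D^1$), regarded as a discrete category over $\mathbf{Top}^{\mathbf 2}$; $\kappa\in\mathcal{J}$ is written $\partial\kappa\to\overline\kappa$. A stratum $(X,S)$ is a space $X$ (its boundary), a set $S$ of cells, and for each $s\in S$ an element $\kappa_s\in\mathcal{J}$ and a continuous map $b_s\colon\partial\kappa_s\to X$. Its body $\overline{(X,S)}$ is the pushout of $\coprod_s\overline{\kappa_s}\leftarrow\coprod_s\partial\kappa_s\to X$, and $U(X,S)$ is the map $X\to\overline{(X,S)}$. A morphism $(f,p)\colon(X,S)\to(Y,T)$ of strata is a continuous $f\colon X\to Y$ and a function $p\colon S\to T$ with $\kappa_s=\kappa_{p(s)}$ and $f\circ b_s=b_{p(s)}$; it induces $\overline{(f,p)}$ on bodies. A relative cell complex is a sequence of strata $(X_n,S_n)_{n\ge0}$ which is connected ($X_{n+1}=\overline{(X_n,S_n)}$) and proper (for no $s\in S_n$ does $b_s$ factor through $X_m\to X_n$ for some $m<n$). Its boundary $\partial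 A$ is $X_0$, its body $\overline A$ is the colimit of $X_0\to X_1\to\cdots$, and $UA$ is the transfinite composite $\partial A\to\overline A$. A morphism is a sequence of strata morphisms $(f_n,p_n)$ with $f_{n+1}=\overline{(f_n,p_n)}$; $U$ sends it to the square formed by $f_0$ and the induced map on bodies. This defines $\mathbf{CellCx}$ and the forgetful functor $U\colon\mathbf{CellCx}\to\mathbf{Top}^{\mathbf 2}$. The functor $\eta$ sends $\kappa\in\mathcal{J}$ to the cell complex whose first stratum is $(\partial\kappa,\{*\})$ with $\kappa_*=\kappa$, $b_*=1_{\partial\kappa}$, and whose other strata have no cells. Composition in $\mathbf{CellCx}$. Let $A=(X_n,S_n)_n$ be a cell complex and $(Y,T)$ a stratum with $Y=\overline A$. For $t\in T$ there is a smallest $n_t$ such that $b_t$ factors through $X_{n_t}\to Y$; put $T_n=\{t: n_t=n\}$. The composite $(Y,T)*A$ is $(Z_n,U_n)_n$ with $Z_0=X_0$, $Z_{n+1}=\overline{(Z_n,U_n)}$, $U_n=S_n\sqcup T_n$ and the evident attaching maps; its underlying map is $U(Y,T)\circ UA$, and there is a canonical morphism $A\to(Y,T)*A$ over $(1,U(Y,T))$. For cell complexes $A,B$ with $\overline A=\partial B$, composing the strata of $B$ onto $A$ one by one gives a sequence $A=A_0\to A_1\to\cdots$, and $B*A$ is its colimit; $U(B*A)=UB\circ UA$. As usual, colimits such as bodies are identified along canonical isomorphisms. *)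

theory Defs
  imports "HOL-Analysis.Analysis"
begin

section \<open>Categories\<close>

record ('o, 'a) category =
  Obj :: "'o set"
  Arr :: "'a set"
  Dom :: "'a \<Rightarrow> 'o"
  Cod :: "'a \<Rightarrow> 'o"
  Id :: "'o \<Rightarrow> 'a"
  Comp :: "'a \<Rightarrow> 'a \<Rightarrow> 'a"

definition Hom :: "('o, 'a) category \<Rightarrow> 'o \<Rightarrow> 'o \<Rightarrow> 'a set" where
  "Hom C X Y = {f \<in> Arr C. Dom C f = X \<and> Cod C f = Y}"

definition is_category :: "('o, 'a) category \<Rightarrow> bool" where
  "is_category C \<longleftrightarrow>
     (\<forall>f\<in>Arr C. Dom C f \<in> Obj C \<and> Cod C f \<in> Obj C) \<and>
     (\<forall>X\<in>Obj C. Id C X \<in> Hom C X X) \<and>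
     (\<forall>f\<in>Arr C. \<forall>g\<in>Arr C. Dom C g = Cod C f \<longrightarrow> Comp C g f \<in> Hom C (Dom C f) (Cod C g)) \<and>
     (\<forall>f\<in>Arr C. Comp C f (Id C (Dom C f)) = f \<and> Comp C (Id C (Cod C f)) f = f) \<and>
     (\<forall>f\<in>Arr C. \<forall>g\<in>Arr C. \<forall>h\<in>Arr C. Dom C g = Cod C f \<longrightarrow> Dom C h = Cod C g \<longrightarrow>
        Comp C h (Comp C g f) = Comp C (Comp C h g) f)"

record ('o1, 'a1, 'o2, 'a2) cat_functor =
  FObj :: "'o1 \<Rightarrow> 'o2"
  FArr :: "'a1 \<Rightarrow> 'a2"

text \<open>Both components are extensional, so that equality of functors is plain equality of records.\<close>

definition is_functor ::
    "('o1, 'a1) category \<Rightarrow> ('o2, 'a2) category \<Rightarrow> ('o1, 'a1, 'o2, 'a2) cat_functor \<Rightarrow> bool" where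
  "is_functor C D F \<longleftrightarrow>
     is_category C \<and> is_category D \<and>
     FObj F \<in> Obj C \<rightarrow>\<^sub>E Obj D \<and>
     FArr F \<in> Arr C \<rightarrow>\<^sub>E Arr D \<and>
     (\<forall>f\<in>Arr C. Dom D (FArr F f) = FObj F (Dom C f) \<and> Cod D (FArr F f) = FObj F (Cod C f)) \<and>
     (\<forall>X\<in>Obj C. FArr F (Id C X) = Id D (FObj F X)) \<and>
     (\<forall>f\<in>Arr C. \<forall>g\<in>Arr C. Dom C g = Cod C f \<longrightarrow>
        FArr F (Comp C g f) = Comp D (FArr F g) (FArr F f))"

definition id_functor :: "('o, 'a) category \<Rightarrow> ('o, 'a, 'o, 'a) cat_functor" where
  "id_functor C = \<lparr>FObj = restrict (\<lambda>X. X) (Obj C), FArr = restrict (\<lambda>f. f) (Arr C)\<rparr>"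

definition comp_functor ::
    "('o1, 'a1) category \<Rightarrow> ('o2, 'a2, 'o3, 'a3) cat_functor \<Rightarrow> ('o1, 'a1, 'o2, 'a2) cat_functor
      \<Rightarrow> ('o1, 'a1, 'o3, 'a3) cat_functor" where
  "comp_functor C G F =
     \<lparr>FObj = restrict (\<lambda>X. FObj G (FObj F X)) (Obj C),
      FArr = restrict (\<lambda>f. FArr G (FArr F f)) (Arr C)\<rparr>"

definition nat_trans ::
    "('o1, 'a1) category \<Rightarrow> ('o2, 'a2) category \<Rightarrow> ('o1, 'a1, 'o2, 'a2) cat_functor
      \<Rightarrow> ('o1, 'a1, 'o2, 'a2) cat_functor \<Rightarrow> ('o1 \<Rightarrow> 'a2) \<Rightarrow> bool" where
  "nat_trans C D F G t \<longleftrightarrow>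
     (\<forall>X\<in>Obj C. t X \<in> Hom D (FObj F X) (FObj G X)) \<and>
     (\<forall>f\<in>Arr C. Comp D (t (Cod C f)) (FArr F f) = Comp D (FArr G f) (t (Dom C f)))"

definition discrete_cat :: "'o set \<Rightarrow> ('o, 'o) category" where
  "discrete_cat J =
     \<lparr>Obj = J, Arr = J, Dom = (\<lambda>x. x), Cod = (\<lambda>x. x), Id = (\<lambda>x. x), Comp = (\<lambda>y x. x)\<rparr>"

record 'a square =
  SqSrc :: 'a
  SqTgt :: 'a
  SqDom :: 'a
  SqCod :: 'a

definition arrow_cat :: "('o, 'a) category \<Rightarrow> ('a, 'a square) category" where
  "arrow_cat C =
     \<lparr>Obj = Arr C,
      Arr = {s. SqSrc s \<in> Arr C \<and> SqTgt s \<in> Arr C \<and>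
                SqDom s \<in> Hom C (Dom C (SqSrc s)) (Dom C (SqTgt s)) \<and>
                SqCod s \<in> Hom C (Cod C (SqSrc s)) (Cod C (SqTgt s)) \<and>
                Comp C (SqTgt s) (SqDom s) = Comp C (SqCod s) (SqSrc s)},
      Dom = SqSrc,
      Cod = SqTgt,
      Id = (\<lambda>f. \<lparr>SqSrc = f, SqTgt = f, SqDom = Id C (Dom C f), SqCod = Id C (Cod C f)\<rparr>),
      Comp = (\<lambda>t s. \<lparr>SqSrc = SqSrc s, SqTgt = SqTgt t,
                      SqDom = Comp C (SqDom t) (SqDom s), SqCod = Comp C (SqCod t) (SqCod s)\<rparr>)\<rparr>"


subsection \<open>Colimits\<close>

definition is_coproduct ::
    "('o, 'a) category \<Rightarrow> 'i set \<Rightarrow> ('i \<Rightarrow> 'o) \<Rightarrow> 'o \<Rightarrow> ('i \<Rightarrow> 'a) \<Rightarrow> bool" where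
  "is_coproduct C I X S i \<longleftrightarrow>
     S \<in> Obj C \<and> (\<forall>k\<in>I. i k \<in> Hom C (X k) S) \<and>
     (\<forall>Z\<in>Obj C. \<forall>z. (\<forall>k\<in>I. z k \<in> Hom C (X k) Z) \<longrightarrow>
        (\<exists>!h. h \<in> Hom C S Z \<and> (\<forall>k\<in>I. Comp C h (i k) = z k)))"

text \<open>\<open>u\<close> and \<open>v\<close> form a pushout cocone of the span \<open>B \<leftarrow>f\<midarrow> A \<midarrow>g\<rightarrow> X\<close>:
  \<open>u\<close> starts at \<open>B\<close> and \<open>v\<close> at \<open>X\<close>.\<close>

definition is_pushout :: "('o, 'a) category \<Rightarrow> 'a \<Rightarrow> 'a \<Rightarrow> 'a \<Rightarrow> 'a \<Rightarrow> bool" where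
  "is_pushout C f g u v \<longleftrightarrow>
     f \<in> Arr C \<and> g \<in> Arr C \<and> Dom C f = Dom C g \<and>
     u \<in> Arr C \<and> v \<in> Arr C \<and> Dom C u = Cod C f \<and> Dom C v = Cod C g \<and> Cod C u = Cod C v \<and>
     Comp C u f = Comp C v g \<and>
     (\<forall>Z\<in>Obj C. \<forall>y\<in>Hom C (Cod C f) Z. \<forall>z\<in>Hom C (Cod C g) Z. Comp C y f = Comp C z g \<longrightarrow>
        (\<exists>!h. h \<in> Hom C (Cod C u) Z \<and> Comp C h u = y \<and> Comp C h v = z))"

definition is_seq_colimit ::
    "('o, 'a) category \<Rightarrow> (nat \<Rightarrow> 'o) \<Rightarrow> (nat \<Rightarrow> 'a) \<Rightarrow> 'o \<Rightarrow> (nat \<Rightarrow> 'a) \<Rightarrow> bool" where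
  "is_seq_colimit C X d K c \<longleftrightarrow>
     K \<in> Obj C \<and>
     (\<forall>n. d n \<in> Hom C (X n) (X (Suc n))) \<and>
     (\<forall>n. c n \<in> Hom C (X n) K \<and> Comp C (c (Suc n)) (d n) = c n) \<and>
     (\<forall>Z\<in>Obj C. \<forall>z. (\<forall>n. z n \<in> Hom C (X n) Z \<and> Comp C (z (Suc n)) (d n) = z n) \<longrightarrow>
        (\<exists>!h. h \<in> Hom C K Z \<and> (\<forall>n. Comp C h (c n) = z n)))"

text \<open>The composite \<open>X m \<rightarrow> X (m + k)\<close> of \<open>k\<close> successive maps of the sequence.\<close>

primrec seq_map ::
    "('o, 'a) category \<Rightarrow> (nat \<Rightarrow> 'o) \<Rightarrow> (nat \<Rightarrow> 'a) \<Rightarrow> nat \<Rightarrow> nat \<Rightarrow> 'a" where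
  "seq_map C X d m 0 = Id C (X m)"
| "seq_map C X d m (Suc k) = Comp C (d (m + k)) (seq_map C X d m k)"

definition factors_through :: "('o, 'a) category \<Rightarrow> 'a \<Rightarrow> 'a \<Rightarrow> bool" where
  "factors_through C f g \<longleftrightarrow> (\<exists>h\<in>Hom C (Dom C f) (Dom C g). f = Comp C g h)"


section \<open>Algebraic weak factorisation systems\<close>

definition is_comonad ::
    "('o, 'a) category \<Rightarrow> ('o, 'a, 'o, 'a) cat_functor \<Rightarrow> ('o \<Rightarrow> 'a) \<Rightarrow> ('o \<Rightarrow> 'a) \<Rightarrow> bool" where
  "is_comonad C L eps delta \<longleftrightarrow>
     is_functor C C L \<and>
     nat_trans C C L (id_functor C) eps \<and>
     nat_trans C C L (comp_functor C L L) delta \<and>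
     (\<forall>X\<in>Obj C.
        Comp C (eps (FObj L X)) (delta X) = Id C (FObj L X) \<and>
        Comp C (FArr L (eps X)) (delta X) = Id C (FObj L X) \<and>
        Comp C (delta (FObj L X)) (delta X) = Comp C (FArr L (delta X)) (delta X))"

definition is_monad ::
    "('o, 'a) category \<Rightarrow> ('o, 'a, 'o, 'a) cat_functor \<Rightarrow> ('o \<Rightarrow> 'a) \<Rightarrow> ('o \<Rightarrow> 'a) \<Rightarrow> bool" where
  "is_monad C R eta mu \<longleftrightarrow>
     is_functor C C R \<and>
     nat_trans C C (id_functor C) R eta \<and>
     nat_trans C C (comp_functor C R R) R mu \<and>
     (\<forall>X\<in>Obj C.
        Comp C (mu X) (eta (FObj R X)) = Id C (FObj R X) \<and>
        Comp C (mu X) (FArr R (eta X)) = Id C (FObj R X) \<and>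
        Comp C (mu X) (mu (FObj R X)) = Comp C (mu X) (FArr R (mu X)))"

text \<open>A distributive law \<open>lam : L R \<rightarrow> R L\<close> of a comonad over a monad.\<close>

definition is_distributive_law ::
    "('o, 'a) category \<Rightarrow> ('o, 'a, 'o, 'a) cat_functor \<Rightarrow> ('o \<Rightarrow> 'a) \<Rightarrow> ('o \<Rightarrow> 'a)
      \<Rightarrow> ('o, 'a, 'o, 'a) cat_functor \<Rightarrow> ('o \<Rightarrow> 'a) \<Rightarrow> ('o \<Rightarrow> 'a) \<Rightarrow> ('o \<Rightarrow> 'a) \<Rightarrow> bool" where
  "is_distributive_law C L eps delta R eta mu lam \<longleftrightarrow>
     nat_trans C C (comp_functor C L R) (comp_functor C R L) lam \<and>
     (\<forall>X\<in>Obj C.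
        Comp C (lam X) (FArr L (eta X)) = eta (FObj L X) \<and>
        Comp C (FArr R (eps X)) (lam X) = eps (FObj R X) \<and>
        Comp C (lam X) (FArr L (mu X)) =
          Comp C (mu (FObj L X)) (Comp C (FArr R (lam X)) (lam (FObj R X))) \<and>
        Comp C (FArr R (delta X)) (lam X) =
          Comp C (lam (FObj L X)) (Comp C (FArr L (lam X)) (delta (FObj R X))))"

record 'a awfs =
  LF :: "('a, 'a square, 'a, 'a square) cat_functor"
  LCounit :: "'a \<Rightarrow> 'a square"
  LComult :: "'a \<Rightarrow> 'a square"
  RF :: "('a, 'a square, 'a, 'a square) cat_functor"
  RUnit :: "'a \<Rightarrow> 'a square"
  RMult :: "'a \<Rightarrow> 'a square"

definition is_awfs :: "('o, 'a) category \<Rightarrow> 'a awfs \<Rightarrow> bool" where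
  "is_awfs C W \<longleftrightarrow>
     is_category C \<and>
     is_comonad (arrow_cat C) (LF W) (LCounit W) (LComult W) \<and>
     is_monad (arrow_cat C) (RF W) (RUnit W) (RMult W) \<and>
     (\<forall>f\<in>Arr C.
        Cod C (FObj (LF W) f) = Dom C (FObj (RF W) f) \<and>
        Comp C (FObj (RF W) f) (FObj (LF W) f) = f \<and>
        LCounit W f = \<lparr>SqSrc = FObj (LF W) f, SqTgt = f,
                       SqDom = Id C (Dom C f), SqCod = FObj (RF W) f\<rparr> \<and>
        RUnit W f = \<lparr>SqSrc = f, SqTgt = FObj (RF W) f,
                     SqDom = FObj (LF W) f, SqCod = Id C (Cod C f)\<rparr>) \<and>
     (\<forall>s\<in>Arr (arrow_cat C). SqCod (FArr (LF W) s) = SqDom (FArr (RF W) s)) \<and>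
     is_distributive_law (arrow_cat C) (LF W) (LCounit W) (LComult W) (RF W) (RUnit W) (RMult W)
       (\<lambda>f. \<lparr>SqSrc = FObj (LF W) (FObj (RF W) f), SqTgt = FObj (RF W) (FObj (LF W) f),
              SqDom = SqCod (LComult W f), SqCod = SqDom (RMult W f)\<rparr>)"

text \<open>\<open>M(a, b) : Mf \<rightarrow> Mg\<close> for a square \<open>(a, b) : f \<rightarrow> g\<close>.\<close>

definition M_arr :: "'a awfs \<Rightarrow> 'a square \<Rightarrow> 'a" where
  "M_arr W s = SqCod (FArr (LF W) s)"

definition coalgebras ::
    "('o, 'a) category \<Rightarrow> ('o, 'a, 'o, 'a) cat_functor \<Rightarrow> ('o \<Rightarrow> 'a) \<Rightarrow> ('o \<Rightarrow> 'a) \<Rightarrow> ('o \<times> 'a) set" where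
  "coalgebras C L eps delta =
     {(X, a). X \<in> Obj C \<and> a \<in> Hom C X (FObj L X) \<and>
        Comp C (eps X) a = Id C X \<and> Comp C (delta X) a = Comp C (FArr L a) a}"

definition coalg_cat ::
    "('o, 'a) category \<Rightarrow> ('o, 'a, 'o, 'a) cat_functor \<Rightarrow> ('o \<Rightarrow> 'a) \<Rightarrow> ('o \<Rightarrow> 'a)
      \<Rightarrow> ('o \<times> 'a, ('o \<times> 'a) \<times> ('o \<times> 'a) \<times> 'a) category" where
  "coalg_cat C L eps delta =
     \<lparr>Obj = coalgebras C L eps delta,
      Arr = {(P, Q, h). P \<in> coalgebras C L eps delta \<and> Q \<in> coalgebras C L eps delta \<and>
               h \<in> Hom C (fst P) (fst Q) \<and> Comp C (FArr L h) (snd P) = Comp C (snd Q) h},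
      Dom = (\<lambda>(P, Q, h). P),
      Cod = (\<lambda>(P, Q, h). Q),
      Id = (\<lambda>P. (P, P, Id C (fst P))),
      Comp = (\<lambda>(P', Q', h') (P, Q, h). (P, Q', Comp C h' h))\<rparr>"

type_synonym 'a lmap = "'a \<times> 'a square"
type_synonym 'a lmap_arr = "'a lmap \<times> 'a lmap \<times> 'a square"

text \<open>A left map \<open>(f, \<alpha>)\<close> is represented with its full structure square \<open>(1, \<alpha>) : f \<rightarrow> Lf\<close>.\<close>

definition LMap :: "('o, 'a) category \<Rightarrow> 'a awfs \<Rightarrow> ('a lmap, 'a lmap_arr) category" where
  "LMap C W = coalg_cat (arrow_cat C) (LF W) (LCounit W) (LComult W)"

definition LMap_forget ::
    "('o, 'a) category \<Rightarrow> 'a awfs \<Rightarrow> ('a lmap, 'a lmap_arr, 'a, 'a square) cat_functor" where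
  "LMap_forget C W =
     \<lparr>FObj = restrict fst (Obj (LMap C W)), FArr = restrict (\<lambda>(P, Q, h). h) (Arr (LMap C W))\<rparr>"

text \<open>\<open>LMap_comp C W (f, \<alpha>) (g, \<beta>)\<close> is \<open>(gf, \<beta> \<bullet> \<alpha>)\<close>, the left map \<open>(f, \<alpha>)\<close> followed by \<open>(g, \<beta>)\<close>, with
  \<open>\<beta> \<bullet> \<alpha> = \<mu>\<^bsub>gf\<^esub> \<circ> M(M(1, g) \<circ> \<alpha>, 1) \<circ> \<beta>\<close>.\<close>

definition LMap_comp :: "('o, 'a) category \<Rightarrow> 'a awfs \<Rightarrow> 'a lmap \<Rightarrow> 'a lmap \<Rightarrow> 'a lmap" where
  "LMap_comp C W F G =
     (let f = fst F; \<alpha> = SqCod (snd F); g = fst G; \<beta> = SqCod (snd G);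
          gf = Comp C g f;
          m = M_arr W \<lparr>SqSrc = f, SqTgt = gf, SqDom = Id C (Dom C f), SqCod = g\<rparr>;
          n = M_arr W \<lparr>SqSrc = g, SqTgt = FObj (RF W) gf,
                       SqDom = Comp C m \<alpha>, SqCod = Id C (Cod C g)\<rparr>
      in (gf, \<lparr>SqSrc = gf, SqTgt = FObj (LF W) gf, SqDom = Id C (Dom C f),
               SqCod = Comp C (SqDom (RMult W gf)) (Comp C n \<beta>)\<rparr>))"


section \<open>Topological spaces and the inclusions of spheres into discs\<close>

text \<open>A universe on a type: \<open>small\<close> singles out the subsets that may carry spaces and index cells,
  and \<open>embed\<close> provides a small copy of the type in which the discs live.  The closure conditions
  are those of a Grothendieck universe that are needed for small colimits of spaces.  Closure under
  powersets is not required, so that besides honest universes (\<open>small\<close> meaning "of cardinality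
  below a strongly inaccessible cardinal") every type containing a copy of
  \<^typ>\<open>nat \<Rightarrow> real\<close>, with all its subsets small, is an instance.\<close>

record 'u universe =
  small :: "'u set \<Rightarrow> bool"
  embed :: "(nat \<Rightarrow> real) \<Rightarrow> 'u"

definition is_universe :: "'u universe \<Rightarrow> bool" where
  "is_universe U \<longleftrightarrow>
     (\<forall>A B. small U B \<longrightarrow> A \<subseteq> B \<longrightarrow> small U A) \<and>
     (\<forall>A. \<forall>h :: 'u \<Rightarrow> 'u. small U A \<longrightarrow> small U (h ` A)) \<and>
     (\<forall>A. \<forall>B :: 'u \<Rightarrow> 'u set. small U A \<longrightarrow> (\<forall>i\<in>A. small U (B i)) \<longrightarrow> small U (\<Union>i\<in>A. B i)) \<and>
     inj (embed U) \<and> small U (range (embed U))"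

record 'u top_arr =
  TDom :: "'u topology"
  TCod :: "'u topology"
  TFun :: "'u \<Rightarrow> 'u"

definition Top :: "'u universe \<Rightarrow> ('u topology, 'u top_arr) category" where
  "Top U =
     \<lparr>Obj = {X. small U (topspace X)},
      Arr = {f. small U (topspace (TDom f)) \<and> small U (topspace (TCod f)) \<and>
                continuous_map (TDom f) (TCod f) (TFun f) \<and> TFun f \<in> extensional (topspace (TDom f))},
      Dom = TDom,
      Cod = TCod,
      Id = (\<lambda>X. \<lparr>TDom = X, TCod = X, TFun = restrict (\<lambda>x. x) (topspace X)\<rparr>),
      Comp = (\<lambda>g f. \<lparr>TDom = TDom f, TCod = TCod g,
                      TFun = compose (topspace (TDom f)) (TFun g) (TFun f)\<rparr>)\<rparr>"

text \<open>The homeomorphic copy of a space inside the universe, along \<open>embed\<close>.\<close>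

definition transport :: "'u universe \<Rightarrow> (nat \<Rightarrow> real) topology \<Rightarrow> 'u topology" where
  "transport U X = pullback_topology (embed U ` topspace X) (inv (embed U)) X"

definition disc :: "'u universe \<Rightarrow> nat \<Rightarrow> 'u topology" where
  "disc U n = transport U (subtopology (Euclidean_space n) {x. (\<Sum>i<n. (x i)\<^sup>2) \<le> 1})"

text \<open>The boundary sphere of dimension \<open>n - 1\<close> of the \<open>n\<close>-disc; empty for \<open>n = 0\<close>.\<close>

definition bd_sphere :: "'u universe \<Rightarrow> nat \<Rightarrow> 'u topology" where
  "bd_sphere U n = transport U (subtopology (Euclidean_space n) {x. (\<Sum>i<n. (x i)\<^sup>2) = 1})"

definition cell_incl :: "'u universe \<Rightarrow> nat \<Rightarrow> 'u top_arr" where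
  "cell_incl U n =
     \<lparr>TDom = bd_sphere U n, TCod = disc U n, TFun = restrict (\<lambda>x. x) (topspace (bd_sphere U n))\<rparr>"

text \<open>The set \<open>\<J>\<close> of these inclusions is indexed by the dimension \<open>n\<close>; distinct \<open>n\<close> give distinct
  inclusions.\<close>

definition J_cat :: "(nat, nat) category" where
  "J_cat = discrete_cat UNIV"

definition J_incl :: "'u universe \<Rightarrow> (nat, nat, 'u top_arr, 'u top_arr square) cat_functor" where
  "J_incl U = \<lparr>FObj = cell_incl U, FArr = (\<lambda>n. Id (arrow_cat (Top U)) (cell_incl U n))\<rparr>"


section \<open>Strata\<close>

text \<open>\<open>kind s\<close> is the dimension of the cell \<open>s\<close>, standing for \<open>\<kappa>\<^sub>s\<close>.\<close>

record 'u stratum =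
  bdry :: "'u topology"
  cells :: "'u set"
  kind :: "'u \<Rightarrow> nat"
  att :: "'u \<Rightarrow> 'u top_arr"

definition is_stratum :: "'u universe \<Rightarrow> 'u stratum \<Rightarrow> bool" where
  "is_stratum U P \<longleftrightarrow>
     bdry P \<in> Obj (Top U) \<and> small U (cells P) \<and>
     kind P \<in> extensional (cells P) \<and>
     att P \<in> (\<Pi>\<^sub>E s\<in>cells P. Hom (Top U) (bd_sphere U (kind P s)) (bdry P))"

text \<open>\<open>u : X \<rightarrow> Y\<close> and the characteristic maps \<open>c s : disc (kind s) \<rightarrow> Y\<close> exhibit \<open>Y\<close> as the body of
  the stratum: \<open>Y\<close> is a pushout of the coproducts of all discs and of all boundary spheres.\<close>

definition is_body ::
    "'u universe \<Rightarrow> 'u stratum \<Rightarrow> 'u top_arr \<Rightarrow> ('u \<Rightarrow> 'u top_arr) \<Rightarrow> bool" where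
  "is_body U P u c \<longleftrightarrow>
     c \<in> extensional (cells P) \<and>
     (\<exists>S i D j k b d.
        is_coproduct (Top U) (cells P) (\<lambda>s. bd_sphere U (kind P s)) S i \<and>
        is_coproduct (Top U) (cells P) (\<lambda>s. disc U (kind P s)) D j \<and>
        k \<in> Hom (Top U) S D \<and>
        (\<forall>s\<in>cells P. Comp (Top U) k (i s) = Comp (Top U) (j s) (cell_incl U (kind P s))) \<and>
        b \<in> Hom (Top U) S (bdry P) \<and>
        (\<forall>s\<in>cells P. Comp (Top U) b (i s) = att P s) \<and>
        is_pushout (Top U) k b d u \<and>
        (\<forall>s\<in>cells P. c s = Comp (Top U) d (j s)))"

definition is_stratum_map ::
    "'u universe \<Rightarrow> 'u stratum \<Rightarrow> 'u stratum \<Rightarrow> 'u top_arr \<Rightarrow> ('u \<Rightarrow> 'u) \<Rightarrow> bool" where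
  "is_stratum_map U P Q f p \<longleftrightarrow>
     f \<in> Hom (Top U) (bdry P) (bdry Q) \<and> p \<in> cells P \<rightarrow>\<^sub>E cells Q \<and>
     (\<forall>s\<in>cells P. kind P s = kind Q (p s) \<and> Comp (Top U) f (att P s) = att Q (p s))"

text \<open>The map induced by \<open>(f, p)\<close> between bodies \<open>(u, c)\<close> and \<open>(u', c')\<close>.\<close>

definition stratum_body_map ::
    "'u universe \<Rightarrow> 'u stratum \<Rightarrow> 'u top_arr \<Rightarrow> ('u \<Rightarrow> 'u top_arr) \<Rightarrow> 'u top_arr \<Rightarrow> ('u \<Rightarrow> 'u top_arr)
      \<Rightarrow> 'u top_arr \<Rightarrow> ('u \<Rightarrow> 'u) \<Rightarrow> 'u top_arr" where
  "stratum_body_map U P u c u' c' f p =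
     (THE h. h \<in> Hom (Top U) (TCod u) (TCod u') \<and>
             Comp (Top U) h u = Comp (Top U) u' f \<and>
             (\<forall>s\<in>cells P. Comp (Top U) h (c s) = c' (p s)))"


section \<open>Relative cell complexes\<close>

text \<open>Bodies are determined only up to canonical isomorphism.  Rather than fixing a choice of
  colimits, a cell complex carries the ones it uses: the pushout cocones \<open>(incl n, chr n)\<close> exhibiting
  the next space as body of the \<open>n\<close>-th stratum, and the colimit cocone \<open>leg\<close> of the sequence of
  spaces.  Two complexes differing only in these data are canonically isomorphic, and with them
  \<open>U \<circ> \<eta>\<close> is strictly the inclusion of \<open>\<J>\<close> and \<open>U(B * A) = UB \<circ> UA\<close> holds on the nose.\<close>

record 'u cell_complex =
  strat :: "nat \<Rightarrow> 'u stratum"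
  incl :: "nat \<Rightarrow> 'u top_arr"
  chr :: "nat \<Rightarrow> 'u \<Rightarrow> 'u top_arr"
  leg :: "nat \<Rightarrow> 'u top_arr"

definition cx_space :: "'u cell_complex \<Rightarrow> nat \<Rightarrow> 'u topology" where
  "cx_space A n = bdry (strat A n)"

definition cx_boundary :: "'u cell_complex \<Rightarrow> 'u topology" where
  "cx_boundary A = cx_space A 0"

definition cx_body :: "'u cell_complex \<Rightarrow> 'u topology" where
  "cx_body A = TCod (leg A 0)"

definition is_cell_complex :: "'u universe \<Rightarrow> 'u cell_complex \<Rightarrow> bool" where
  "is_cell_complex U A \<longleftrightarrow>
     (\<forall>n. is_stratum U (strat A n) \<and> is_body U (strat A n) (incl A n) (chr A n) \<and>
          TCod (incl A n) = cx_space A (Suc n)) \<and>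
     is_seq_colimit (Top U) (cx_space A) (incl A) (cx_body A) (leg A) \<and>
     (\<forall>n. \<forall>s\<in>cells (strat A n). \<forall>m<n.
        \<not> factors_through (Top U) (att (strat A n) s) (seq_map (Top U) (cx_space A) (incl A) m (n - m)))"

record 'u cx_arr =
  CxSrc :: "'u cell_complex"
  CxTgt :: "'u cell_complex"
  CxMap :: "nat \<Rightarrow> 'u top_arr"
  CxCell :: "nat \<Rightarrow> 'u \<Rightarrow> 'u"

definition CellCx :: "'u universe \<Rightarrow> ('u cell_complex, 'u cx_arr) category" where
  "CellCx U =
     \<lparr>Obj = {A. is_cell_complex U A},
      Arr = {\<phi>. is_cell_complex U (CxSrc \<phi>) \<and> is_cell_complex U (CxTgt \<phi>) \<and>
                (\<forall>n. is_stratum_map U (strat (CxSrc \<phi>) n) (strat (CxTgt \<phi>) n) (CxMap \<phi> n) (CxCell \<phi> n) \<and>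
                     CxMap \<phi> (Suc n) =
                       stratum_body_map U (strat (CxSrc \<phi>) n)
                         (incl (CxSrc \<phi>) n) (chr (CxSrc \<phi>) n) (incl (CxTgt \<phi>) n) (chr (CxTgt \<phi>) n)
                         (CxMap \<phi> n) (CxCell \<phi> n))},
      Dom = CxSrc,
      Cod = CxTgt,
      Id = (\<lambda>A. \<lparr>CxSrc = A, CxTgt = A, CxMap = (\<lambda>n. Id (Top U) (cx_space A n)),
                 CxCell = (\<lambda>n. restrict (\<lambda>s. s) (cells (strat A n)))\<rparr>),
      Comp = (\<lambda>\<psi> \<phi>. \<lparr>CxSrc = CxSrc \<phi>, CxTgt = CxTgt \<psi>,
                      CxMap = (\<lambda>n. Comp (Top U) (CxMap \<psi> n) (CxMap \<phi> n)),
                      CxCell = (\<lambda>n. compose (cells (strat (CxSrc \<phi>) n)) (CxCell \<psi> n) (CxCell \<phi> n))\<rparr>)\<rparr>"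

definition cx_body_map :: "'u universe \<Rightarrow> 'u cx_arr \<Rightarrow> 'u top_arr" where
  "cx_body_map U \<phi> =
     (THE h. h \<in> Hom (Top U) (cx_body (CxSrc \<phi>)) (cx_body (CxTgt \<phi>)) \<and>
             (\<forall>n. Comp (Top U) h (leg (CxSrc \<phi>) n) = Comp (Top U) (leg (CxTgt \<phi>) n) (CxMap \<phi> n)))"

definition CellCx_forget ::
    "'u universe \<Rightarrow> ('u cell_complex, 'u cx_arr, 'u top_arr, 'u top_arr square) cat_functor" where
  "CellCx_forget U =
     \<lparr>FObj = restrict (\<lambda>A. leg A 0) (Obj (CellCx U)),
      FArr = restrict (\<lambda>\<phi>. \<lparr>SqSrc = leg (CxSrc \<phi>) 0, SqTgt = leg (CxTgt \<phi>) 0,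
                            SqDom = CxMap \<phi> 0, SqCod = cx_body_map U \<phi>\<rparr>) (Arr (CellCx U))\<rparr>"

text \<open>The only cell of \<open>eta_obj U n\<close> is labelled by the arbitrary element \<open>embed U (\<lambda>_. 0)\<close>.\<close>

definition eta_obj :: "'u universe \<Rightarrow> nat \<Rightarrow> 'u cell_complex" where
  "eta_obj U n =
     (let star = embed U (\<lambda>_. 0) in
      \<lparr>strat = (\<lambda>k. if k = 0
                  then \<lparr>bdry = bd_sphere U n, cells = {star},
                        kind = restrict (\<lambda>_. n) {star},
                        att = restrict (\<lambda>_. Id (Top U) (bd_sphere U n)) {star}\<rparr>
                  else \<lparr>bdry = disc U n, cells = {}, kind = restrict (\<lambda>_. n) {},
                        att = restrict (\<lambda>_. cell_incl U n) {}\<rparr>),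
       incl = (\<lambda>k. if k = 0 then cell_incl U n else Id (Top U) (disc U n)),
       chr = (\<lambda>k. restrict (\<lambda>_. Id (Top U) (disc U n)) (if k = 0 then {star} else {})),
       leg = (\<lambda>k. if k = 0 then cell_incl U n else Id (Top U) (disc U n))\<rparr>)"

definition eta :: "'u universe \<Rightarrow> (nat, nat, 'u cell_complex, 'u cx_arr) cat_functor" where
  "eta U = \<lparr>FObj = eta_obj U, FArr = (\<lambda>n. Id (CellCx U) (eta_obj U n))\<rparr>"


section \<open>Composition of cell complexes\<close>

text \<open>The cells \<open>t\<close> of a stratum over the body of \<open>A\<close> with \<open>n\<^sub>t = n\<close>.\<close>

definition level_cells :: "'u universe \<Rightarrow> 'u cell_complex \<Rightarrow> 'u stratum \<Rightarrow> nat \<Rightarrow> 'u set" where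
  "level_cells U A P n =
     {t \<in> cells P. (\<exists>m. factors_through (Top U) (att P t) (leg A m)) \<and>
                   (LEAST m. factors_through (Top U) (att P t) (leg A m)) = n}"

text \<open>\<open>C\<close> is the composite \<open>P * A\<close> of the complex \<open>A\<close> with the stratum \<open>P\<close> over its body, where
  \<open>(u, c)\<close> exhibits the body of \<open>P\<close>; \<open>a : A \<rightarrow> C\<close> is the canonical morphism over \<open>(1, u)\<close>.
  The \<open>n\<close>-th cells of \<open>C\<close> are the disjoint union of those of \<open>A\<close> (embedded by \<open>a\<close>) and of
  \<open>T\<^sub>n = level_cells U A P n\<close> (embedded by \<open>j n\<close>).  The body of \<open>C\<close> is that of \<open>P\<close>; the
  condition on \<open>leg C (Suc n)\<close> says that this identification is the canonical one.\<close>

definition is_stratum_composite ::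
    "'u universe \<Rightarrow> 'u cell_complex \<Rightarrow> 'u stratum \<Rightarrow> 'u top_arr \<Rightarrow> ('u \<Rightarrow> 'u top_arr)
      \<Rightarrow> 'u cell_complex \<Rightarrow> 'u cx_arr \<Rightarrow> bool" where
  "is_stratum_composite U A P u c C a \<longleftrightarrow>
     is_stratum U P \<and> is_body U P u c \<and> bdry P = cx_body A \<and>
     a \<in> Hom (CellCx U) A C \<and>
     FArr (CellCx_forget U) a =
       \<lparr>SqSrc = leg A 0, SqTgt = leg C 0, SqDom = Id (Top U) (cx_boundary A), SqCod = u\<rparr> \<and>
     (\<exists>j. \<forall>n.
        inj_on (CxCell a n) (cells (strat A n)) \<and> inj_on (j n) (level_cells U A P n) \<and>
        CxCell a n ` cells (strat A n) \<inter> j n ` level_cells U A P n = {} \<and>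
        cells (strat C n) = CxCell a n ` cells (strat A n) \<union> j n ` level_cells U A P n \<and>
        (\<forall>t\<in>level_cells U A P n.
           kind (strat C n) (j n t) = kind P t \<and>
           (\<exists>g\<in>Hom (Top U) (bd_sphere U (kind P t)) (cx_space A n).
              Comp (Top U) (leg A n) g = att P t \<and>
              att (strat C n) (j n t) = Comp (Top U) (CxMap a n) g) \<and>
           Comp (Top U) (leg C (Suc n)) (chr C n (j n t)) = c t))"

text \<open>\<open>C\<close> is the composite \<open>B * A\<close>: the colimit in \<open>CellCx\<close> of the sequence
  \<open>A = A\<^sub>0 \<rightarrow> A\<^sub>1 \<rightarrow> \<dots>\<close> obtained by composing the strata of \<open>B\<close> onto \<open>A\<close> one by one.  The body of
  \<open>A\<^sub>m\<close> is the \<open>m\<close>-th space of \<open>B\<close>, and the body of \<open>C\<close> is the body of \<open>B\<close>.\<close>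

definition is_composite ::
    "'u universe \<Rightarrow> 'u cell_complex \<Rightarrow> 'u cell_complex \<Rightarrow> 'u cell_complex \<Rightarrow> bool" where
  "is_composite U B A C \<longleftrightarrow>
     A \<in> Obj (CellCx U) \<and> B \<in> Obj (CellCx U) \<and> cx_body A = cx_boundary B \<and>
     (\<exists>As as ks.
        As 0 = A \<and>
        (\<forall>m. is_stratum_composite U (As m) (strat B m) (incl B m) (chr B m) (As (Suc m)) (as m)) \<and>
        is_seq_colimit (CellCx U) As as C ks \<and>
        (\<forall>m. FArr (CellCx_forget U) (ks m) =
           \<lparr>SqSrc = leg (As m) 0, SqTgt = leg C 0,
            SqDom = Id (Top U) (cx_boundary A), SqCod = leg B m\<rparr>))"

definition preserves_composition ::
    "'u universe \<Rightarrow> 'u top_arr awfs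
      \<Rightarrow> ('u cell_complex, 'u cx_arr, 'u top_arr lmap, 'u top_arr lmap_arr) cat_functor \<Rightarrow> bool" where
  "preserves_composition U W F \<longleftrightarrow>
     (\<forall>A B C. is_composite U B A C \<longrightarrow> FObj F C = LMap_comp (Top U) W (FObj F A) (FObj F B))"

text \<open>\<open>F : C \<rightarrow> D\<close> is a functor over \<open>E\<close> with respect to \<open>V : C \<rightarrow> E\<close> and \<open>V' : D \<rightarrow> E\<close>.\<close>

definition is_functor_over ::
    "('o1, 'a1) category \<Rightarrow> ('o1, 'a1, 'o3, 'a3) cat_functor
      \<Rightarrow> ('o2, 'a2) category \<Rightarrow> ('o2, 'a2, 'o3, 'a3) cat_functor
      \<Rightarrow> ('o1, 'a1, 'o2, 'a2) cat_functor \<Rightarrow> bool" where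
  "is_functor_over C V D V' F \<longleftrightarrow> is_functor C D F \<and> comp_functor C V' F = V"

end

theory Submission
  imports Defs
begin

text \<open>
  Let \<open>(k, \<phi>)\<close> be a left map.  A square \<open>(x, y)\<close> from \<open>k\<close> to a free right map \<open>R f\<close> has the filler
  \<open>\<mu>\<^sub>f \<circ> M(x, y) \<circ> \<phi>\<close>, called \<open>lift\<close> below.  Once the inclusions of spheres into discs are left maps,
  a square from the map underlying a cell complex \<open>A\<close> to \<open>R f\<close> can therefore be filled one cell at a
  time.  A map \<open>z\<close> from the body of \<open>A\<close> to \<open>M f\<close> is called cellular if it arises like this: on each
  cell it is the chosen lift of the square that consists of its restriction to the boundary of the
  cell and of its composite with \<open>R f\<close>.  The universal properties of the bodies yield that every
  square has a cellular filler (\<open>cellular_exists\<close>), and that a cellular map is determined by its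
  restriction to the boundary of \<open>A\<close> together with its composite with \<open>R f\<close> (\<open>cellular_eqI\<close>).

  The left map structure on \<open>f\<close>, the map underlying \<open>A\<close>, is the cellular filler of the square
  \<open>(L f, 1)\<close> from \<open>f\<close> to \<open>R f\<close>.  All its properties are equations between cellular maps that solve the
  same lifting problem, because cellular maps are stable under precomposition with maps of complexes
  and under composition with \<open>M(a, b)\<close>, with the extensions \<open>\<mu> \<circ> M(h, b)\<close> to free algebras, and with the
  comultiplication \<open>\<delta>\<close>; the last case is the distributive law.  This gives coassociativity
  (\<open>left_map_cx_struct\<close>), functoriality (\<open>cx_struct_natural\<close>) and compatibility with composition:
  the structure of a composite left map is itself a lift, and the structure of \<open>B * A\<close> is
  cellular over \<open>B\<close> (\<open>composite_cellular\<close>), since every cell of \<open>B\<close> is a cell of \<open>B * A\<close>, although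
  possibly in another stratum.

  For uniqueness, consider any functor with the required properties.  The first \<open>n + 1\<close> strata of a
  cell complex form the composite of the first \<open>n\<close> strata with the complex whose only stratum is the
  \<open>n\<close>-th one (\<open>trunc_Suc_composite\<close>, where properness enters), and every cell of that stratum is the
  image of the cell of some \<open>\<eta> \<kappa>\<close>.  Preservation of composites and naturality then force the
  structures given by the functor to be cellular (\<open>cellular_H_struct\<close>), so they are the ones
  constructed above.
\<close>

section \<open>Categories and squares\<close>

locale cat =
  fixes C :: "('o, 'a) category"
  assumes cat: "is_category C"
begin

abbreviation comp (infixr "\<cdot>" 75) where "g \<cdot> f \<equiv> Comp C g f"

abbreviation id\<^sub>C where "id\<^sub>C \<equiv> Id C"

lemma Hom_iff: "f \<in> Hom C X Y \<longleftrightarrow> f \<in> Arr C \<and> Dom C f = X \<and> Cod C f = Y"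
  by (simp add: Hom_def)

lemma obj [simp, intro]: "f \<in> Arr C \<Longrightarrow> Dom C f \<in> Obj C" "f \<in> Arr C \<Longrightarrow> Cod C f \<in> Obj C"
  using cat by (auto simp: is_category_def)

lemma id_simps [simp]:
  "X \<in> Obj C \<Longrightarrow> id\<^sub>C X \<in> Arr C"
  "X \<in> Obj C \<Longrightarrow> Dom C (id\<^sub>C X) = X"
  "X \<in> Obj C \<Longrightarrow> Cod C (id\<^sub>C X) = X"
  using cat by (auto simp: is_category_def Hom_def)

lemma comp_simps [simp]:
  assumes "f \<in> Arr C" "g \<in> Arr C" "Dom C g = Cod C f"
  shows "g \<cdot> f \<in> Arr C" "Dom C (g \<cdot> f) = Dom C f" "Cod C (g \<cdot> f) = Cod C g"
  using cat assms by (auto simp: is_category_def Hom_def)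

lemma unit_simps [simp]:
  "f \<in> Arr C \<Longrightarrow> X = Dom C f \<Longrightarrow> f \<cdot> id\<^sub>C X = f"
  "f \<in> Arr C \<Longrightarrow> X = Cod C f \<Longrightarrow> id\<^sub>C X \<cdot> f = f"
  using cat by (auto simp: is_category_def Hom_def)

lemma assoc [simp]:
  assumes "f \<in> Arr C" "g \<in> Arr C" "h \<in> Arr C" "Dom C g = Cod C f" "Dom C h = Cod C g"
  shows "(h \<cdot> g) \<cdot> f = h \<cdot> g \<cdot> f"
  using cat assms by (auto simp: is_category_def Hom_def)

lemma comp_hom [intro]: "f \<in> Hom C X Y \<Longrightarrow> g \<in> Hom C Y Z \<Longrightarrow> g \<cdot> f \<in> Hom C X Z"
  by (simp add: Hom_iff)

text \<open>Composites are kept bracketed to the right, so an equation between composites of two arrows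
  is applied inside a longer composite in this form.\<close>

lemma comp_cong:
  assumes "g \<cdot> f = k \<cdot> h" "x \<in> Arr C" "f \<in> Arr C" "g \<in> Arr C" "h \<in> Arr C" "k \<in> Arr C"
    "Dom C g = Cod C f" "Dom C k = Cod C h" "Dom C f = Cod C x" "Dom C h = Cod C x"
  shows "g \<cdot> f \<cdot> x = k \<cdot> h \<cdot> x"
  using assms by (metis assoc)

lemma comp_cong1:
  assumes "g \<cdot> f = k" "x \<in> Arr C" "f \<in> Arr C" "g \<in> Arr C"
    "Dom C g = Cod C f" "Dom C f = Cod C x"
  shows "g \<cdot> f \<cdot> x = k \<cdot> x"
  using assms by (metis assoc)

abbreviation sq :: "'a \<Rightarrow> 'a \<Rightarrow> 'a \<Rightarrow> 'a \<Rightarrow> 'a square" where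
  "sq f g a b \<equiv> \<lparr>SqSrc = f, SqTgt = g, SqDom = a, SqCod = b\<rparr>"

definition square :: "'a \<Rightarrow> 'a \<Rightarrow> 'a \<Rightarrow> 'a \<Rightarrow> bool" where
  "square f g a b \<longleftrightarrow> f \<in> Arr C \<and> g \<in> Arr C \<and> a \<in> Arr C \<and> b \<in> Arr C \<and>
     Dom C a = Dom C f \<and> Cod C a = Dom C g \<and> Dom C b = Cod C f \<and> Cod C b = Cod C g \<and> g \<cdot> a = b \<cdot> f"

lemma sq_in_arrow_cat: "sq f g a b \<in> Arr (arrow_cat C) \<longleftrightarrow> square f g a b"
  by (auto simp: arrow_cat_def square_def Hom_def)

lemma square_simps:
  assumes "square f g a b"
  shows "f \<in> Arr C" "g \<in> Arr C" "a \<in> Arr C" "b \<in> Arr C"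
    "Dom C a = Dom C f" "Cod C a = Dom C g" "Dom C b = Cod C f" "Cod C b = Cod C g"
  using assms by (auto simp: square_def)

lemma square_comm: "square f g a b \<Longrightarrow> g \<cdot> a = b \<cdot> f"
  by (simp add: square_def)

lemma square_id_comm: "square f g (id\<^sub>C (Dom C f)) u \<Longrightarrow> g = u \<cdot> f"
  by (auto simp: square_def)

lemma square_comp:
  assumes "square f g a b" "square g h a' b'"
  shows "square f h (a' \<cdot> a) (b' \<cdot> b)"
proof -
  note [simp] = square_simps[OF assms(1)] square_simps[OF assms(2)]
  have "h \<cdot> a' \<cdot> a = b' \<cdot> g \<cdot> a"
    by (intro comp_cong) (auto simp: square_comm[OF assms(2)])
  also have "\<dots> = b' \<cdot> b \<cdot> f" by (simp add: square_comm[OF assms(1)])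
  finally show ?thesis by (simp add: square_def)
qed

lemma arrow_cat_simps [simp]:
  "Obj (arrow_cat C) = Arr C" "Dom (arrow_cat C) = SqSrc" "Cod (arrow_cat C) = SqTgt"
  "Comp (arrow_cat C) (sq g h a' b') (sq f g' a b) = sq f h (a' \<cdot> a) (b' \<cdot> b)"
  "Id (arrow_cat C) f = sq f f (id\<^sub>C (Dom C f)) (id\<^sub>C (Cod C f))"
  by (simp_all add: arrow_cat_def)

lemma arrow_cat_comp:
  "Comp (arrow_cat C) t s = sq (SqSrc s) (SqTgt t) (SqDom t \<cdot> SqDom s) (SqCod t \<cdot> SqCod s)"
  by (simp add: arrow_cat_def)

lemma Hom_arrow_cat:
  "s \<in> Hom (arrow_cat C) f g \<longleftrightarrow> s = sq f g (SqDom s) (SqCod s) \<and> square f g (SqDom s) (SqCod s)"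
  by (cases s) (auto simp: Hom_def sq_in_arrow_cat)

subsection \<open>Colimits\<close>

lemma Hom_objs: "f \<in> Hom C X Y \<Longrightarrow> X \<in> Obj C" "f \<in> Hom C X Y \<Longrightarrow> Y \<in> Obj C"
  by (auto simp: Hom_def)

lemma unit_hom: "f \<in> Hom C X Y \<Longrightarrow> f \<cdot> id\<^sub>C X = f" "f \<in> Hom C X Y \<Longrightarrow> id\<^sub>C Y \<cdot> f = f"
  by (auto simp: Hom_def)

text \<open>A cocone on an eventually constant sequence is determined by its leg at stage \<open>N\<close>: later legs
  agree with it, and earlier ones are recovered by descending along the sequence.\<close>

lemma seq_colimit_eventually_const:
  assumes d: "\<And>n. d n \<in> Hom C (X n) (X (Suc n))"
    and const: "\<And>n. n \<ge> N \<Longrightarrow> X n = K \<and> d n = id\<^sub>C K \<and> c n = id\<^sub>C K"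
    and c: "\<And>n. c n \<in> Hom C (X n) K" "\<And>n. c (Suc n) \<cdot> d n = c n"
  shows "is_seq_colimit C X d K c"
  unfolding is_seq_colimit_def
proof (intro conjI allI ballI impI)
  have K: "K \<in> Obj C" using Hom_objs[OF c(1)] by blast
  then show "K \<in> Obj C" .
  fix Z z assume Z: "Z \<in> Obj C"
    and "\<forall>n. z n \<in> Hom C (X n) Z \<and> z (Suc n) \<cdot> d n = z n"
  then have z: "\<And>n. z n \<in> Hom C (X n) Z" "\<And>n. z (Suc n) \<cdot> d n = z n" by auto
  have up: "z n = z N" if "n \<ge> N" for n
    using that
  proof (induction n rule: dec_induct)
    case (step n)
    then show ?case using z(2)[of n] z(1)[of "Suc n"] const[of n] const[of "Suc n"]
      by (simp add: Hom_iff)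
  qed simp
  have down: "z N \<cdot> c n = z n" if "n \<le> N" for n
    using that
  proof (induction n rule: inc_induct)
    case base
    then show ?case using z(1)[of N] const[of N] by (simp add: Hom_iff)
  next
    case (step n)
    have "z N \<cdot> c n = (z N \<cdot> c (Suc n)) \<cdot> d n"
      using z(1)[of N] c d[of n] const[of N] by (simp add: Hom_iff)
    then show ?case using step z by simp
  qed
  have zc: "z N \<cdot> c n = z n" for n
    using up[of n] down[of n] const[of n] const[of N] z(1)[of N]
    by (cases "n \<le> N") (auto simp: Hom_iff)
  show "\<exists>!h. h \<in> Hom C K Z \<and> (\<forall>n. h \<cdot> c n = z n)"
  proof (intro ex1I conjI allI)
    show "z N \<in> Hom C K Z" using z(1)[of N] const[of N] by simp
    show "z N \<cdot> c n = z n" for n by (rule zc)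
    fix h assume h: "h \<in> Hom C K Z \<and> (\<forall>n. h \<cdot> c n = z n)"
    then have "h \<cdot> c N = z N" by blast
    then show "h = z N" using h const[of N] by (simp add: Hom_iff)
  qed
qed (use d c in blast)+

lemma seq_colimit_simps:
  assumes "is_seq_colimit C X d K c"
  shows "K \<in> Obj C" "d n \<in> Hom C (X n) (X (Suc n))" "c n \<in> Hom C (X n) K" "c (Suc n) \<cdot> d n = c n"
  using assms by (auto simp: is_seq_colimit_def)

lemma seq_colimit_universal:
  assumes "is_seq_colimit C X d K c" "Z \<in> Obj C"
    and "\<And>n. z n \<in> Hom C (X n) Z" "\<And>n. z (Suc n) \<cdot> d n = z n"
  shows "\<exists>!h. h \<in> Hom C K Z \<and> (\<forall>n. h \<cdot> c n = z n)"
proof -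
  have "\<forall>Z\<in>Obj C. \<forall>z. (\<forall>n. z n \<in> Hom C (X n) Z \<and> z (Suc n) \<cdot> d n = z n) \<longrightarrow>
      (\<exists>!h. h \<in> Hom C K Z \<and> (\<forall>n. h \<cdot> c n = z n))"
    using assms(1) unfolding is_seq_colimit_def by (elim conjE)
  from this[rule_format, of Z z] show ?thesis using assms(2-) by simp
qed

lemma seq_colimit_eqI:
  assumes col: "is_seq_colimit C X d K c"
    and p: "p \<in> Hom C K Z" and q: "q \<in> Hom C K Z" and eq: "\<And>n. p \<cdot> c n = q \<cdot> c n"
  shows "p = q"
proof -
  note s = seq_colimit_simps[OF col]
  have "\<exists>!h. h \<in> Hom C K Z \<and> (\<forall>n. h \<cdot> c n = p \<cdot> c n)"
    using s p by (intro seq_colimit_universal[OF col Hom_objs(2)[OF p]]) (simp_all add: Hom_iff)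
  then show ?thesis using p q eq by metis
qed

lemma seq_colimit_factor:
  assumes "is_seq_colimit C X d K c" "Z \<in> Obj C"
    and "\<And>n. z n \<in> Hom C (X n) Z" "\<And>n. z (Suc n) \<cdot> d n = z n"
  obtains h where "h \<in> Hom C K Z" "\<And>n. h \<cdot> c n = z n"
  using seq_colimit_universal[OF assms] by blast

lemma seq_map_hom:
  assumes d: "\<And>n. d n \<in> Hom C (X n) (X (Suc n))"
  shows "seq_map C X d m k \<in> Hom C (X m) (X (m + k))"
proof (induction k)
  case 0
  then show ?case using Hom_objs(1)[OF d[of m]] by (simp add: Hom_iff)
next
  case (Suc k)
  then show ?case using d[of "m + k"] by (auto simp: Hom_iff)
qed

text \<open>The composite of successive maps unfolds at its last map by definition, whereas cocones need it
  unfolded at its first map.\<close>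

lemma seq_map_Suc_shift:
  assumes d: "\<And>n. d n \<in> Hom C (X n) (X (Suc n))"
  shows "seq_map C X d (Suc m) k \<cdot> d m = seq_map C X d m (Suc k)"
proof (induction k)
  case 0
  then show ?case using d[of m] Hom_objs[OF d[of m]] by (simp add: Hom_iff)
next
  case (Suc k)
  have "seq_map C X d (Suc m) (Suc k) \<cdot> d m = d (Suc (m + k)) \<cdot> seq_map C X d (Suc m) k \<cdot> d m"
    using d[of "Suc (m + k)"] d[of m] seq_map_hom[of d X, OF d, of "Suc m" k] by (auto simp: Hom_iff)
  then show ?case by (simp only: Suc) simp
qed

lemma coproduct_universal:
  assumes "is_coproduct C I X S i" "Z \<in> Obj C" "\<And>k. k \<in> I \<Longrightarrow> z k \<in> Hom C (X k) Z"
  shows "\<exists>!h. h \<in> Hom C S Z \<and> (\<forall>k\<in>I. h \<cdot> i k = z k)"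
proof -
  have "\<forall>Z\<in>Obj C. \<forall>z. (\<forall>k\<in>I. z k \<in> Hom C (X k) Z) \<longrightarrow>
      (\<exists>!h. h \<in> Hom C S Z \<and> (\<forall>k\<in>I. h \<cdot> i k = z k))"
    using assms(1) unfolding is_coproduct_def by (elim conjE)
  from this[rule_format, of Z z] show ?thesis using assms(2-) by simp
qed

lemma coproduct_eqI:
  assumes cop: "is_coproduct C I X S i" and p: "p \<in> Hom C S Z" and q: "q \<in> Hom C S Z"
    and eq: "\<And>k. k \<in> I \<Longrightarrow> p \<cdot> i k = q \<cdot> i k"
  shows "p = q"
proof -
  have i: "\<forall>k\<in>I. i k \<in> Hom C (X k) S" using cop by (simp add: is_coproduct_def)
  have "\<exists>!h. h \<in> Hom C S Z \<and> (\<forall>k\<in>I. h \<cdot> i k = p \<cdot> i k)"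
    using i p by (intro coproduct_universal[OF cop Hom_objs(2)[OF p]]) (simp add: Hom_iff)
  then show ?thesis using p q eq by metis
qed

lemma coproduct_factor:
  assumes "is_coproduct C I X S i" "Z \<in> Obj C" "\<And>k. k \<in> I \<Longrightarrow> z k \<in> Hom C (X k) Z"
  obtains h where "h \<in> Hom C S Z" "\<And>k. k \<in> I \<Longrightarrow> h \<cdot> i k = z k"
  using coproduct_universal[OF assms] by blast

lemma pushout_universal:
  assumes "is_pushout C f g u v" "Z \<in> Obj C" "y \<in> Hom C (Cod C f) Z" "z \<in> Hom C (Cod C g) Z"
    "y \<cdot> f = z \<cdot> g"
  shows "\<exists>!h. h \<in> Hom C (Cod C u) Z \<and> h \<cdot> u = y \<and> h \<cdot> v = z"
proof -
  have "\<forall>Z\<in>Obj C. \<forall>y\<in>Hom C (Cod C f) Z. \<forall>z\<in>Hom C (Cod C g) Z. y \<cdot> f = z \<cdot> g \<longrightarrow>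
      (\<exists>!h. h \<in> Hom C (Cod C u) Z \<and> h \<cdot> u = y \<and> h \<cdot> v = z)"
    using assms(1) unfolding is_pushout_def by (elim conjE)
  from this[rule_format, of Z y z] show ?thesis using assms(2-) by simp
qed

lemma pushout_eqI:
  assumes po: "is_pushout C f g u v" and p: "p \<in> Hom C (Cod C u) Z" and q: "q \<in> Hom C (Cod C u) Z"
    and eq: "p \<cdot> u = q \<cdot> u" "p \<cdot> v = q \<cdot> v"
  shows "p = q"
proof -
  have s [simp]: "f \<in> Arr C" "g \<in> Arr C" "Dom C f = Dom C g" "u \<in> Arr C" "v \<in> Arr C"
    "Dom C u = Cod C f" "Dom C v = Cod C g" "Cod C u = Cod C v"
    and uv: "u \<cdot> f = v \<cdot> g"
    using po by (simp_all add: is_pushout_def)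
  have "\<exists>!h. h \<in> Hom C (Cod C u) Z \<and> h \<cdot> u = p \<cdot> u \<and> h \<cdot> v = p \<cdot> v"
    using p uv by (intro pushout_universal[OF po Hom_objs(2)[OF p]]) (simp_all add: Hom_iff)
  then show ?thesis using p q eq by metis
qed

lemma pushout_factor:
  assumes "is_pushout C f g u v" "Z \<in> Obj C" "y \<in> Hom C (Cod C f) Z" "z \<in> Hom C (Cod C g) Z"
    "y \<cdot> f = z \<cdot> g"
  obtains h where "h \<in> Hom C (Cod C u) Z" "h \<cdot> u = y" "h \<cdot> v = z"
  using pushout_universal[OF assms] by blast

lemma pushout_of_id:
  assumes g: "g \<in> Arr C"
  shows "is_pushout C (id\<^sub>C (Dom C g)) g g (id\<^sub>C (Cod C g))"
    and "is_pushout C g (id\<^sub>C (Dom C g)) (id\<^sub>C (Cod C g)) g"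
proof -
  have "\<exists>!h. h \<in> Hom C (Cod C g) Z \<and> h \<cdot> g = y \<and> h \<cdot> id\<^sub>C (Cod C g) = z"
    if "y \<in> Hom C (Dom C g) Z" "z \<in> Hom C (Cod C g) Z" "y \<cdot> id\<^sub>C (Dom C g) = z \<cdot> g" for Z y z
    using that by (metis unit_hom(1))
  then show "is_pushout C (id\<^sub>C (Dom C g)) g g (id\<^sub>C (Cod C g))"
    using g by (simp add: is_pushout_def)
  have "\<exists>!h. h \<in> Hom C (Cod C g) Z \<and> h \<cdot> id\<^sub>C (Cod C g) = y \<and> h \<cdot> g = z"
    if "y \<in> Hom C (Cod C g) Z" "z \<in> Hom C (Dom C g) Z" "y \<cdot> g = z \<cdot> id\<^sub>C (Dom C g)" for Z y z
    using that by (metis unit_hom(1))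
  then show "is_pushout C g (id\<^sub>C (Dom C g)) (id\<^sub>C (Cod C g)) g"
    using g by (simp add: is_pushout_def)
qed

lemma coproduct_singleton:
  assumes "X s \<in> Obj C" "i s = id\<^sub>C (X s)"
  shows "is_coproduct C {s} X (X s) i"
proof -
  have "\<exists>!h. h \<in> Hom C (X s) Z \<and> h \<cdot> id\<^sub>C (X s) = z" if "z \<in> Hom C (X s) Z" for Z z
    using that by (metis unit_hom(1))
  moreover have "id\<^sub>C (X s) \<in> Hom C (X s) (X s)" using assms by (simp add: Hom_iff)
  ultimately show ?thesis using assms by (simp add: is_coproduct_def)
qed

end

section \<open>Lifting left maps against free right maps\<close>

locale awfs_on = cat C for C :: "('o, 'a) category" +
  fixes W :: "'a awfs"
  assumes awfs: "is_awfs C W"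
begin

abbreviation "L \<equiv> FObj (LF W)"
abbreviation "R \<equiv> FObj (RF W)"
abbreviation "M f g a b \<equiv> M_arr W (sq f g a b)"
abbreviation "\<delta> f \<equiv> SqCod (LComult W f)"
abbreviation "\<mu> f \<equiv> SqDom (RMult W f)"

lemma L_functor: "is_functor (arrow_cat C) (arrow_cat C) (LF W)"
  and R_functor: "is_functor (arrow_cat C) (arrow_cat C) (RF W)"
  using awfs by (auto simp: is_awfs_def is_comonad_def is_monad_def)

lemma factorisation [simp]:
  assumes "f \<in> Arr C"
  shows "L f \<in> Arr C" "R f \<in> Arr C" "Dom C (L f) = Dom C f" "Dom C (R f) = Cod C (L f)"
    "Cod C (R f) = Cod C f" "R f \<cdot> L f = f"
    "LCounit W f = sq (L f) f (id\<^sub>C (Dom C f)) (R f)"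
    "RUnit W f = sq f (R f) (L f) (id\<^sub>C (Cod C f))"
proof -
  have e: "LCounit W f = sq (L f) f (id\<^sub>C (Dom C f)) (R f)"
    and u: "RUnit W f = sq f (R f) (L f) (id\<^sub>C (Cod C f))"
    and c: "Cod C (L f) = Dom C (R f)" "R f \<cdot> L f = f"
    using awfs assms by (auto simp: is_awfs_def)
  show "LCounit W f = sq (L f) f (id\<^sub>C (Dom C f)) (R f)"
    "RUnit W f = sq f (R f) (L f) (id\<^sub>C (Cod C f))" by fact+
  show "Dom C (R f) = Cod C (L f)" "R f \<cdot> L f = f" using c by simp_all
  have "\<forall>X\<in>Arr C. LCounit W X \<in> Hom (arrow_cat C) (L X) (FObj (id_functor (arrow_cat C)) X)"
    and "\<forall>X\<in>Arr C. RUnit W X \<in> Hom (arrow_cat C) (FObj (id_functor (arrow_cat C)) X) (R X)"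
    using awfs unfolding is_awfs_def is_comonad_def is_monad_def nat_trans_def arrow_cat_simps
    by blast+
  then have "square (L f) f (id\<^sub>C (Dom C f)) (R f)" "square f (R f) (L f) (id\<^sub>C (Cod C f))"
    using assms e u by (auto simp: id_functor_def Hom_arrow_cat)
  then show "L f \<in> Arr C" "R f \<in> Arr C" "Dom C (L f) = Dom C f" "Cod C (R f) = Cod C f"
    using assms by (auto simp: square_def)
qed

lemma unit_square: "f \<in> Arr C \<Longrightarrow> square f (R f) (L f) (id\<^sub>C (Cod C f))"
  by (simp add: square_def)

text \<open>Both functors of the factorisation act on a square by the same middle arrow, and otherwise
  by an arrow of the square: the other two components are forced by naturality of the counit and
  of the unit.\<close>

lemma LF_sq: "square f g a b \<Longrightarrow> FArr (LF W) (sq f g a b) = sq (L f) (L g) a (M f g a b)"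
  and LF_square: "square f g a b \<Longrightarrow> square (L f) (L g) a (M f g a b)"
proof -
  assume s: "square f g a b"
  note [simp] = square_simps[OF s]
  define t where "t = FArr (LF W) (sq f g a b)"
  have "t \<in> Hom (arrow_cat C) (L f) (L g)"
    using L_functor s
    by (auto simp: is_functor_def sq_in_arrow_cat Hom_def t_def dest!: PiE_mem[where x="sq f g a b"])
  then have t: "t = sq (L f) (L g) (SqDom t) (SqCod t)" and sq: "square (L f) (L g) (SqDom t) (SqCod t)"
    by (auto simp: Hom_arrow_cat)
  note [simp] = square_simps[OF sq]
  have "Comp (arrow_cat C) (LCounit W (SqTgt (sq f g a b))) t =
      Comp (arrow_cat C) (FArr (id_functor (arrow_cat C)) (sq f g a b)) (LCounit W (SqSrc (sq f g a b)))"
    using awfs s unfolding t_def is_awfs_def is_comonad_def nat_trans_def arrow_cat_simps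
    using sq_in_arrow_cat by blast
  then have "id\<^sub>C (Dom C g) \<cdot> SqDom t = a \<cdot> id\<^sub>C (Dom C f)"
    using s by (simp add: id_functor_def sq_in_arrow_cat arrow_cat_comp)
  then have "SqDom t = a" by simp
  then show "FArr (LF W) (sq f g a b) = sq (L f) (L g) a (M f g a b)"
    and "square (L f) (L g) a (M f g a b)"
    using t sq by (simp_all add: t_def M_arr_def)
qed

lemma RF_sq: "square f g a b \<Longrightarrow> FArr (RF W) (sq f g a b) = sq (R f) (R g) (M f g a b) b"
  and RF_square: "square f g a b \<Longrightarrow> square (R f) (R g) (M f g a b) b"
proof -
  assume s: "square f g a b"
  note [simp] = square_simps[OF s]
  define t where "t = FArr (RF W) (sq f g a b)"
  have "t \<in> Hom (arrow_cat C) (R f) (R g)"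
    using R_functor s
    by (auto simp: is_functor_def sq_in_arrow_cat Hom_def t_def dest!: PiE_mem[where x="sq f g a b"])
  then have t: "t = sq (R f) (R g) (SqDom t) (SqCod t)" and sq: "square (R f) (R g) (SqDom t) (SqCod t)"
    by (auto simp: Hom_arrow_cat)
  note [simp] = square_simps[OF sq]
  have "Comp (arrow_cat C) (RUnit W (SqTgt (sq f g a b))) (FArr (id_functor (arrow_cat C)) (sq f g a b)) =
      Comp (arrow_cat C) t (RUnit W (SqSrc (sq f g a b)))"
    using awfs s unfolding t_def is_awfs_def is_monad_def nat_trans_def arrow_cat_simps
    using sq_in_arrow_cat by blast
  then have "SqCod t = b"
    using s by (simp add: id_functor_def sq_in_arrow_cat arrow_cat_comp)
  moreover have "SqDom t = M f g a b"
    using awfs s by (auto simp: is_awfs_def t_def M_arr_def sq_in_arrow_cat)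
  ultimately show "FArr (RF W) (sq f g a b) = sq (R f) (R g) (M f g a b) b"
    and "square (R f) (R g) (M f g a b) b"
    using t sq by (simp_all add: t_def)
qed

lemma M_simps [simp]:
  assumes "square f g a b"
  shows "M f g a b \<in> Arr C" "Dom C (M f g a b) = Cod C (L f)" "Cod C (M f g a b) = Cod C (L g)"
  using square_simps[OF assms] square_simps[OF LF_square[OF assms]] by auto

lemma M_L: "square f g a b \<Longrightarrow> M f g a b \<cdot> L f = L g \<cdot> a"
  using LF_square square_comm by metis

lemma R_M: "square f g a b \<Longrightarrow> R g \<cdot> M f g a b = b \<cdot> R f"
  using RF_square square_comm by metis

lemma M_comp:
  assumes "square f g a b" "square g h a' b'"
  shows "M g h a' b' \<cdot> M f g a b = M f h (a' \<cdot> a) (b' \<cdot> b)"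
proof -
  have "FArr (LF W) (Comp (arrow_cat C) (sq g h a' b') (sq f g a b)) =
      Comp (arrow_cat C) (FArr (LF W) (sq g h a' b')) (FArr (LF W) (sq f g a b))"
    using L_functor assms sq_in_arrow_cat
    unfolding is_functor_def by (metis arrow_cat_simps(2,3) square.select_convs(1,2))
  then show ?thesis using assms square_comp[OF assms] by (simp add: LF_sq)
qed

lemma LComult_eq: "f \<in> Arr C \<Longrightarrow> LComult W f = sq (L f) (L (L f)) (id\<^sub>C (Dom C f)) (\<delta> f)"
  and LComult_square: "f \<in> Arr C \<Longrightarrow> square (L f) (L (L f)) (id\<^sub>C (Dom C f)) (\<delta> f)"
  and R_\<delta>: "f \<in> Arr C \<Longrightarrow> R (L f) \<cdot> \<delta> f = id\<^sub>C (Cod C (L f))"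
proof -
  assume f: "f \<in> Arr C"
  have "LComult W f \<in> Hom (arrow_cat C) (L f) (FObj (comp_functor (arrow_cat C) (LF W) (LF W)) f)"
    using awfs f by (simp add: is_awfs_def is_comonad_def nat_trans_def)
  then have t: "LComult W f = sq (L f) (L (L f)) (SqDom (LComult W f)) (\<delta> f)"
    and sq: "square (L f) (L (L f)) (SqDom (LComult W f)) (\<delta> f)"
    using f by (auto simp: Hom_arrow_cat comp_functor_def)
  note [simp] = square_simps[OF sq]
  have "Comp (arrow_cat C) (LCounit W (L f)) (LComult W f) = Id (arrow_cat C) (L f)"
    using awfs f by (simp add: is_awfs_def is_comonad_def)
  then have "id\<^sub>C (Dom C f) \<cdot> SqDom (LComult W f) = id\<^sub>C (Dom C f)"
    and r: "R (L f) \<cdot> \<delta> f = id\<^sub>C (Cod C (L f))"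
    using f by (simp_all add: arrow_cat_comp)
  then have "SqDom (LComult W f) = id\<^sub>C (Dom C f)" using f sq by simp
  then show "LComult W f = sq (L f) (L (L f)) (id\<^sub>C (Dom C f)) (\<delta> f)"
    and "square (L f) (L (L f)) (id\<^sub>C (Dom C f)) (\<delta> f)"
    and "R (L f) \<cdot> \<delta> f = id\<^sub>C (Cod C (L f))"
    using t sq r by simp_all
qed

lemma \<delta>_simps [simp]:
  assumes "f \<in> Arr C"
  shows "\<delta> f \<in> Arr C" "Dom C (\<delta> f) = Cod C (L f)" "Cod C (\<delta> f) = Cod C (L (L f))"
  using square_simps[OF LComult_square[OF assms]] by auto

lemma \<delta>_L: "f \<in> Arr C \<Longrightarrow> \<delta> f \<cdot> L f = L (L f)"
  using square_comm[OF LComult_square] by simp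

lemma \<delta>_natural:
  assumes "square f g a b"
  shows "\<delta> g \<cdot> M f g a b = M (L f) (L g) a (M f g a b) \<cdot> \<delta> f"
proof -
  note [simp] = square_simps[OF assms]
  have "Comp (arrow_cat C) (LComult W (SqTgt (sq f g a b))) (FArr (LF W) (sq f g a b)) =
      Comp (arrow_cat C) (FArr (comp_functor (arrow_cat C) (LF W) (LF W)) (sq f g a b))
        (LComult W (SqSrc (sq f g a b)))"
    using awfs assms unfolding is_awfs_def is_comonad_def nat_trans_def arrow_cat_simps
    using sq_in_arrow_cat by blast
  then show ?thesis
    using assms by (simp add: comp_functor_def sq_in_arrow_cat LF_sq LF_square arrow_cat_comp)
qed

lemma RMult_eq: "f \<in> Arr C \<Longrightarrow> RMult W f = sq (R (R f)) (R f) (\<mu> f) (id\<^sub>C (Cod C f))"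
  and RMult_square: "f \<in> Arr C \<Longrightarrow> square (R (R f)) (R f) (\<mu> f) (id\<^sub>C (Cod C f))"
  and \<mu>_L: "f \<in> Arr C \<Longrightarrow> \<mu> f \<cdot> L (R f) = id\<^sub>C (Cod C (L f))"
proof -
  assume f: "f \<in> Arr C"
  have "RMult W f \<in> Hom (arrow_cat C) (FObj (comp_functor (arrow_cat C) (RF W) (RF W)) f) (R f)"
    using awfs f by (simp add: is_awfs_def is_monad_def nat_trans_def)
  then have t: "RMult W f = sq (R (R f)) (R f) (\<mu> f) (SqCod (RMult W f))"
    and sq: "square (R (R f)) (R f) (\<mu> f) (SqCod (RMult W f))"
    using f by (auto simp: Hom_arrow_cat comp_functor_def)
  note [simp] = square_simps[OF sq]
  have "Comp (arrow_cat C) (RMult W f) (RUnit W (R f)) = Id (arrow_cat C) (R f)"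
    using awfs f by (simp add: is_awfs_def is_monad_def)
  then have "SqCod (RMult W f) \<cdot> id\<^sub>C (Cod C f) = id\<^sub>C (Cod C f)"
    and r: "\<mu> f \<cdot> L (R f) = id\<^sub>C (Cod C (L f))"
    using f by (simp_all add: arrow_cat_comp)
  then have "SqCod (RMult W f) = id\<^sub>C (Cod C f)" using f sq by simp
  then show "RMult W f = sq (R (R f)) (R f) (\<mu> f) (id\<^sub>C (Cod C f))"
    and "square (R (R f)) (R f) (\<mu> f) (id\<^sub>C (Cod C f))"
    and "\<mu> f \<cdot> L (R f) = id\<^sub>C (Cod C (L f))"
    using t sq r by simp_all
qed

lemma \<mu>_simps [simp]:
  assumes "f \<in> Arr C"
  shows "\<mu> f \<in> Arr C" "Dom C (\<mu> f) = Cod C (L (R f))" "Cod C (\<mu> f) = Cod C (L f)"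
  using square_simps[OF RMult_square[OF assms]] assms by auto

lemma R_\<mu>: "f \<in> Arr C \<Longrightarrow> R f \<cdot> \<mu> f = R (R f)"
  using square_comm[OF RMult_square] by simp

lemma \<mu>_M_L: "f \<in> Arr C \<Longrightarrow> \<mu> f \<cdot> M f (R f) (L f) (id\<^sub>C (Cod C f)) = id\<^sub>C (Cod C (L f))"
proof -
  assume f: "f \<in> Arr C"
  have "Comp (arrow_cat C) (RMult W f) (FArr (RF W) (RUnit W f)) = Id (arrow_cat C) (R f)"
    using awfs f by (simp add: is_awfs_def is_monad_def)
  then show ?thesis using f by (simp add: arrow_cat_comp RF_sq unit_square)
qed

lemma \<mu>_natural:
  assumes "square f g a b"
  shows "M f g a b \<cdot> \<mu> f = \<mu> g \<cdot> M (R f) (R g) (M f g a b) b"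
proof -
  note [simp] = square_simps[OF assms]
  have "Comp (arrow_cat C) (RMult W (SqTgt (sq f g a b)))
        (FArr (comp_functor (arrow_cat C) (RF W) (RF W)) (sq f g a b)) =
      Comp (arrow_cat C) (FArr (RF W) (sq f g a b)) (RMult W (SqSrc (sq f g a b)))"
    using awfs assms unfolding is_awfs_def is_monad_def nat_trans_def arrow_cat_simps
    using sq_in_arrow_cat by blast
  then show ?thesis
    using assms by (simp add: comp_functor_def sq_in_arrow_cat RF_sq RF_square arrow_cat_comp)
qed

lemma \<mu>_assoc:
  assumes "f \<in> Arr C"
  shows "\<mu> f \<cdot> \<mu> (R f) = \<mu> f \<cdot> M (R (R f)) (R f) (\<mu> f) (id\<^sub>C (Cod C f))"
proof -
  have "Comp (arrow_cat C) (RMult W f) (RMult W (R f)) =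
      Comp (arrow_cat C) (RMult W f) (FArr (RF W) (RMult W f))"
    using awfs assms by (simp add: is_awfs_def is_monad_def)
  moreover have "FArr (RF W) (RMult W f) =
      sq (R (R (R f))) (R (R f)) (M (R (R f)) (R f) (\<mu> f) (id\<^sub>C (Cod C f))) (id\<^sub>C (Cod C f))"
    using assms RF_sq[OF RMult_square[OF assms]] by (simp flip: RMult_eq)
  ultimately show ?thesis using assms by (simp add: arrow_cat_comp)
qed

lemma distributive_square: "f \<in> Arr C \<Longrightarrow> square (L (R f)) (R (L f)) (\<delta> f) (\<mu> f)"
  by (simp add: square_def R_\<delta> \<mu>_L)

lemma distributive_law:
  assumes "f \<in> Arr C"
  shows "\<delta> f \<cdot> \<mu> f = \<mu> (L f) \<cdot> M (L (R f)) (R (L f)) (\<delta> f) (\<mu> f) \<cdot> \<delta> (R f)"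
proof -
  define lam where "lam f = sq (L (R f)) (R (L f)) (\<delta> f) (\<mu> f)" for f
  have "Comp (arrow_cat C) (lam f) (FArr (LF W) (RMult W f)) =
      Comp (arrow_cat C) (RMult W (L f)) (Comp (arrow_cat C) (FArr (RF W) (lam f)) (lam (R f)))"
    using awfs assms by (simp add: is_awfs_def is_distributive_law_def lam_def)
  moreover have "SqDom (FArr (LF W) (RMult W f)) = \<mu> f"
    using LF_sq[OF RMult_square[OF assms]] by (simp flip: RMult_eq[OF assms])
  moreover have "SqDom (FArr (RF W) (lam f)) = M (L (R f)) (R (L f)) (\<delta> f) (\<mu> f)"
    using RF_sq[OF distributive_square[OF assms]] by (simp add: lam_def)
  ultimately show ?thesis by (simp add: arrow_cat_comp lam_def)
qed

text \<open>By the counit law the domain component of a coalgebra structure is an identity, so a left map is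
  recorded by the codomain component alone.\<close>

definition left_map :: "'a \<Rightarrow> 'a \<Rightarrow> bool" where
  "left_map f \<alpha> \<longleftrightarrow> f \<in> Arr C \<and> \<alpha> \<in> Hom C (Cod C f) (Cod C (L f)) \<and>
     \<alpha> \<cdot> f = L f \<and> R f \<cdot> \<alpha> = id\<^sub>C (Cod C f) \<and>
     \<delta> f \<cdot> \<alpha> = M f (L f) (id\<^sub>C (Dom C f)) \<alpha> \<cdot> \<alpha>"

lemma left_map_simps:
  assumes "left_map f \<alpha>"
  shows "f \<in> Arr C" "\<alpha> \<in> Arr C" "Dom C \<alpha> = Cod C f" "Cod C \<alpha> = Cod C (L f)"
    "\<alpha> \<cdot> f = L f" "R f \<cdot> \<alpha> = id\<^sub>C (Cod C f)"
  using assms by (auto simp: left_map_def Hom_iff)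

lemma left_map_comult:
  "left_map f \<alpha> \<Longrightarrow> \<delta> f \<cdot> \<alpha> = M f (L f) (id\<^sub>C (Dom C f)) \<alpha> \<cdot> \<alpha>"
  by (simp add: left_map_def)

lemma left_map_square: "left_map f \<alpha> \<Longrightarrow> square f (L f) (id\<^sub>C (Dom C f)) \<alpha>"
  by (simp add: left_map_def square_def Hom_iff)

lemma Obj_LMap_iff:
  "P \<in> Obj (LMap C W) \<longleftrightarrow>
     (\<exists>f \<alpha>. P = (f, sq f (L f) (id\<^sub>C (Dom C f)) \<alpha>) \<and> left_map f \<alpha>)"
proof
  assume "P \<in> Obj (LMap C W)"
  then obtain f s where P: "P = (f, s)" and f: "f \<in> Arr C" and s: "s \<in> Hom (arrow_cat C) f (L f)"
    and u: "Comp (arrow_cat C) (LCounit W f) s = Id (arrow_cat C) f"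
    and d: "Comp (arrow_cat C) (LComult W f) s = Comp (arrow_cat C) (FArr (LF W) s) s"
    by (auto simp: LMap_def coalg_cat_def coalgebras_def simp del: arrow_cat_simps(5))
  from s have e: "s = sq f (L f) (SqDom s) (SqCod s)" and sq: "square f (L f) (SqDom s) (SqCod s)"
    by (auto simp: Hom_arrow_cat)
  note [simp] = square_simps[OF sq]
  have "id\<^sub>C (Dom C f) \<cdot> SqDom s = id\<^sub>C (Dom C f)" and r: "R f \<cdot> SqCod s = id\<^sub>C (Cod C f)"
    using u by (simp_all add: arrow_cat_comp)
  then have a: "SqDom s = id\<^sub>C (Dom C f)" by simp
  have "SqCod s \<cdot> f = L f"
    using square_comm[OF sq] by (simp add: a)
  moreover have "\<delta> f \<cdot> SqCod s = M f (L f) (id\<^sub>C (Dom C f)) (SqCod s) \<cdot> SqCod s"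
  proof -
    have s': "sq f (L f) (id\<^sub>C (Dom C f)) (SqCod s) = s" using e a by simp
    have "SqCod (Comp (arrow_cat C) (LComult W f) s) =
        SqCod (Comp (arrow_cat C) (FArr (LF W) (sq f (L f) (id\<^sub>C (Dom C f)) (SqCod s))) s)"
      using d unfolding s' by simp
    then show ?thesis by (simp add: arrow_cat_comp LF_sq[OF sq[unfolded a]])
  qed
  ultimately have "left_map f (SqCod s)" using r by (simp add: left_map_def Hom_iff)
  moreover have "P = (f, sq f (L f) (id\<^sub>C (Dom C f)) (SqCod s))" using P e a by simp
  ultimately show "\<exists>f \<alpha>. P = (f, sq f (L f) (id\<^sub>C (Dom C f)) \<alpha>) \<and> left_map f \<alpha>" by blast
next
  assume "\<exists>f \<alpha>. P = (f, sq f (L f) (id\<^sub>C (Dom C f)) \<alpha>) \<and> left_map f \<alpha>"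
  then obtain f \<alpha> where P: "P = (f, sq f (L f) (id\<^sub>C (Dom C f)) \<alpha>)" and l: "left_map f \<alpha>" by blast
  note [simp] = left_map_simps[OF l]
  show "P \<in> Obj (LMap C W)"
    using left_map_square[OF l] left_map_comult[OF l]
      arg_cong[OF LComult_eq[of f], of SqTgt] arg_cong[OF LComult_eq[of f], of SqDom] unfolding P
    by (simp add: LMap_def coalg_cat_def coalgebras_def Hom_arrow_cat LF_sq arrow_cat_comp)
qed

lemma LMap_arr_iff:
  assumes "left_map f \<alpha>" "left_map g \<beta>" "P = (f, sq f (L f) (id\<^sub>C (Dom C f)) \<alpha>)"
    "Q = (g, sq g (L g) (id\<^sub>C (Dom C g)) \<beta>)"
  shows "(P, Q, h) \<in> Arr (LMap C W) \<longleftrightarrow>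
    (\<exists>a b. h = sq f g a b \<and> square f g a b \<and> M f g a b \<cdot> \<alpha> = \<beta> \<cdot> b)"
proof -
  note [simp] = left_map_simps[OF assms(1)] left_map_simps[OF assms(2)]
  have PQ: "P \<in> coalgebras (arrow_cat C) (LF W) (LCounit W) (LComult W)"
    "Q \<in> coalgebras (arrow_cat C) (LF W) (LCounit W) (LComult W)"
    using Obj_LMap_iff[of P] Obj_LMap_iff[of Q] assms by (auto simp: LMap_def coalg_cat_def)
  have "(P, Q, h) \<in> Arr (LMap C W) \<longleftrightarrow> h \<in> Hom (arrow_cat C) f g \<and>
      Comp (arrow_cat C) (FArr (LF W) h) (snd P) = Comp (arrow_cat C) (snd Q) h"
    using PQ assms by (simp add: LMap_def coalg_cat_def)
  also have "\<dots> \<longleftrightarrow> (\<exists>a b. h = sq f g a b \<and> square f g a b \<and> M f g a b \<cdot> \<alpha> = \<beta> \<cdot> b)"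
    (is "?l \<longleftrightarrow> ?r")
  proof
    assume l: ?l
    then have h: "h = sq f g (SqDom h) (SqCod h)" and sq: "square f g (SqDom h) (SqCod h)"
      by (auto simp: Hom_arrow_cat)
    have "SqCod (Comp (arrow_cat C) (FArr (LF W) (sq f g (SqDom h) (SqCod h))) (snd P)) =
        SqCod (Comp (arrow_cat C) (snd Q) h)" using l h by simp
    then have "M f g (SqDom h) (SqCod h) \<cdot> \<alpha> = \<beta> \<cdot> SqCod h"
      using assms(3,4) by (simp add: LF_sq[OF sq] arrow_cat_comp)
    then show ?r using h sq by blast
  next
    assume ?r
    then obtain a b where h: "h = sq f g a b" and sq: "square f g a b"
      and e: "M f g a b \<cdot> \<alpha> = \<beta> \<cdot> b" by blast
    note [simp] = square_simps[OF sq]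
    show ?l using sq e assms(3,4) by (simp add: h Hom_arrow_cat LF_sq[OF sq])
  qed
  finally show ?thesis .
qed

text \<open>The coalgebra structure \<open>\<phi>\<close> followed by \<open>M(x, y)\<close> leads into \<open>M(R f)\<close>, and the free algebra structure
  on \<open>R f\<close> brings it back to \<open>M f\<close>.\<close>

definition lift :: "'a \<Rightarrow> 'a \<Rightarrow> 'a \<Rightarrow> 'a \<Rightarrow> 'a \<Rightarrow> 'a" where
  "lift k \<phi> f x y = \<mu> f \<cdot> M k (R f) x y \<cdot> \<phi>"

lemma lift_simps:
  assumes k: "left_map k \<phi>" and f: "f \<in> Arr C" and sq: "square k (R f) x y"
  shows "lift k \<phi> f x y \<in> Arr C" "Dom C (lift k \<phi> f x y) = Cod C k"
    "Cod C (lift k \<phi> f x y) = Cod C (L f)"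
    "lift k \<phi> f x y \<cdot> k = x" "R f \<cdot> lift k \<phi> f x y = y"
proof -
  note [simp] = left_map_simps[OF k] square_simps[OF sq] f M_simps[OF sq]
  show "lift k \<phi> f x y \<in> Arr C" "Dom C (lift k \<phi> f x y) = Cod C k"
    "Cod C (lift k \<phi> f x y) = Cod C (L f)" by (simp_all add: lift_def)
  have "lift k \<phi> f x y \<cdot> k = \<mu> f \<cdot> M k (R f) x y \<cdot> L k" by (simp add: lift_def)
  also have "\<dots> = \<mu> f \<cdot> L (R f) \<cdot> x" by (simp add: M_L[OF sq])
  also have "\<dots> = x" using comp_cong1[OF \<mu>_L[OF f], of x] by simp
  finally show "lift k \<phi> f x y \<cdot> k = x" .
  have "R f \<cdot> lift k \<phi> f x y = R (R f) \<cdot> M k (R f) x y \<cdot> \<phi>"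
    using comp_cong1[OF R_\<mu>[OF f], of "M k (R f) x y \<cdot> \<phi>"] by (simp add: lift_def)
  also have "\<dots> = y \<cdot> R k \<cdot> \<phi>"
    using comp_cong[OF R_M[OF sq], of \<phi>] by simp
  also have "\<dots> = y" by simp
  finally show "R f \<cdot> lift k \<phi> f x y = y" .
qed

text \<open>Naturality of \<open>\<mu>\<close> makes \<open>M(a, b)\<close> a morphism between free algebras, and those preserve lifts.\<close>

lemma M_lift:
  assumes k: "left_map k \<phi>" and sq: "square k (R f) x y" and ab: "square f g a b"
  shows "M f g a b \<cdot> lift k \<phi> f x y = lift k \<phi> g (M f g a b \<cdot> x) (b \<cdot> y)"
proof -
  have sq': "square (R f) (R g) (M f g a b) b" by (rule RF_square[OF ab])
  note sq'' = square_comp[OF sq sq']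
  note [simp] = left_map_simps[OF k] square_simps[OF sq] M_simps[OF sq] square_simps[OF ab]
    M_simps[OF ab] M_simps[OF sq'] M_simps[OF sq'']
  have "M f g a b \<cdot> lift k \<phi> f x y = \<mu> g \<cdot> M (R f) (R g) (M f g a b) b \<cdot> M k (R f) x y \<cdot> \<phi>"
    using comp_cong[OF \<mu>_natural[OF ab], of "M k (R f) x y \<cdot> \<phi>"] by (simp add: lift_def)
  also have "\<dots> = lift k \<phi> g (M f g a b \<cdot> x) (b \<cdot> y)"
    using comp_cong1[OF M_comp[OF sq sq'], of \<phi>] by (simp add: lift_def)
  finally show ?thesis .
qed

text \<open>The arrow \<open>\<mu>\<^sub>g \<circ> M(h, b)\<close> extends the square \<open>(h, b)\<close> to the free algebra on \<open>f\<close>.  It preserves lifts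
  because \<open>\<mu>\<close> is associative.\<close>

lemma \<mu>_M_lift:
  assumes k: "left_map k \<phi>" and sq: "square k (R f) x y" and hb: "square f (R g) h b"
    and f: "f \<in> Arr C" and g: "g \<in> Arr C"
  shows "(\<mu> g \<cdot> M f (R g) h b) \<cdot> lift k \<phi> f x y = lift k \<phi> g ((\<mu> g \<cdot> M f (R g) h b) \<cdot> x) (b \<cdot> y)"
proof -
  have r: "square (R f) (R (R g)) (M f (R g) h b) b" by (rule RF_square[OF hb])
  have sq1: "square k (R (R g)) (M f (R g) h b \<cdot> x) (b \<cdot> y)" by (rule square_comp[OF sq r])
  note m = RMult_square[OF g]
  note sq2 = square_comp[OF sq1 m]
  note [simp] = left_map_simps[OF k] square_simps[OF sq] M_simps[OF sq] square_simps[OF hb]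
    M_simps[OF hb] M_simps[OF r] f g M_simps[OF sq1] M_simps[OF m] M_simps[OF sq2]
  have "(\<mu> g \<cdot> M f (R g) h b) \<cdot> lift k \<phi> f x y = \<mu> g \<cdot> M f (R g) h b \<cdot> lift k \<phi> f x y"
    by (simp add: lift_simps[OF k f sq])
  also have "\<dots> = \<mu> g \<cdot> lift k \<phi> (R g) (M f (R g) h b \<cdot> x) (b \<cdot> y)"
    by (simp add: M_lift[OF k sq hb])
  also have "\<dots> = \<mu> g \<cdot> \<mu> (R g) \<cdot> M k (R (R g)) (M f (R g) h b \<cdot> x) (b \<cdot> y) \<cdot> \<phi>"
    by (simp add: lift_def)
  also have "\<dots> = \<mu> g \<cdot> M (R (R g)) (R g) (\<mu> g) (id\<^sub>C (Cod C g)) \<cdot>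
      M k (R (R g)) (M f (R g) h b \<cdot> x) (b \<cdot> y) \<cdot> \<phi>"
    using comp_cong[OF \<mu>_assoc[OF g], of "M k (R (R g)) (M f (R g) h b \<cdot> x) (b \<cdot> y) \<cdot> \<phi>"] by simp
  also have "\<dots> = \<mu> g \<cdot> M k (R g) (\<mu> g \<cdot> M f (R g) h b \<cdot> x) (id\<^sub>C (Cod C g) \<cdot> b \<cdot> y) \<cdot> \<phi>"
    using comp_cong1[OF M_comp[OF sq1 m], of \<phi>] by simp
  finally show ?thesis by (simp add: lift_def)
qed

text \<open>The distributive law rewrites \<open>\<delta>\<^sub>f \<circ> \<mu>\<^sub>f\<close> so that a comultiplication meets \<open>\<phi>\<close>, where it is absorbed by
  the coalgebra law at the cost of a second copy of \<open>\<phi>\<close>.  This second copy is why a lift appears in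
  the lower side of the new square.\<close>

lemma \<delta>_lift:
  assumes k: "left_map k \<phi>" and f: "f \<in> Arr C" and sq: "square k (R f) x y"
  shows "\<delta> f \<cdot> lift k \<phi> f x y = lift k \<phi> (L f) (\<delta> f \<cdot> x) (lift k \<phi> f x y)"
proof -
  have kk: "square k (L k) (id\<^sub>C (Dom C k)) \<phi>" by (rule left_map_square[OF k])
  have l: "square (L k) (L (R f)) x (M k (R f) x y)" by (rule LF_square[OF sq])
  have d: "square (L (R f)) (R (L f)) (\<delta> f) (\<mu> f)" by (rule distributive_square[OF f])
  note [simp] = left_map_simps[OF k] square_simps[OF sq] M_simps[OF sq] f
    M_simps[OF kk] M_simps[OF l] M_simps[OF d]
  have s1: "square k (L (R f)) x (M k (R f) x y \<cdot> \<phi>)" using square_comp[OF kk l] by simp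
  note s2 = square_comp[OF s1 d]
  note [simp] = M_simps[OF s1] M_simps[OF s2]
  have "\<delta> f \<cdot> lift k \<phi> f x y =
      (\<mu> (L f) \<cdot> M (L (R f)) (R (L f)) (\<delta> f) (\<mu> f) \<cdot> \<delta> (R f)) \<cdot> M k (R f) x y \<cdot> \<phi>"
    using comp_cong1[OF distributive_law[OF f], of "M k (R f) x y \<cdot> \<phi>"] by (simp add: lift_def)
  also have "\<dots> = \<mu> (L f) \<cdot> M (L (R f)) (R (L f)) (\<delta> f) (\<mu> f) \<cdot> \<delta> (R f) \<cdot> M k (R f) x y \<cdot> \<phi>"
    by simp
  also have "\<dots> = \<mu> (L f) \<cdot> M (L (R f)) (R (L f)) (\<delta> f) (\<mu> f) \<cdot>
      M (L k) (L (R f)) x (M k (R f) x y) \<cdot> \<delta> k \<cdot> \<phi>"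
    using comp_cong[OF \<delta>_natural[OF sq], of \<phi>] by simp
  also have "\<dots> = \<mu> (L f) \<cdot> M (L (R f)) (R (L f)) (\<delta> f) (\<mu> f) \<cdot>
      M (L k) (L (R f)) x (M k (R f) x y) \<cdot> M k (L k) (id\<^sub>C (Dom C k)) \<phi> \<cdot> \<phi>"
    by (simp add: left_map_comult[OF k])
  also have "\<dots> = \<mu> (L f) \<cdot> M (L (R f)) (R (L f)) (\<delta> f) (\<mu> f) \<cdot>
      M k (L (R f)) x (M k (R f) x y \<cdot> \<phi>) \<cdot> \<phi>"
    using comp_cong1[OF M_comp[OF kk l], of \<phi>] by simp
  also have "\<dots> = \<mu> (L f) \<cdot> M k (R (L f)) (\<delta> f \<cdot> x) (\<mu> f \<cdot> M k (R f) x y \<cdot> \<phi>) \<cdot> \<phi>"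
    using comp_cong1[OF M_comp[OF s1 d], of \<phi>] by simp
  finally show ?thesis by (simp add: lift_def)
qed

text \<open>The unit law \<open>\<mu>\<^sub>f \<circ> M(L f, 1) = 1\<close> leaves only the structure map.\<close>

lemma lift_self:
  assumes "left_map f \<alpha>"
  shows "lift f \<alpha> f (L f) (id\<^sub>C (Cod C f)) = \<alpha>"
proof -
  note [simp] = left_map_simps[OF assms] M_simps[OF unit_square[OF left_map_simps(1)[OF assms]]]
  show ?thesis using comp_cong1[OF \<mu>_M_L, of f \<alpha>] by (simp add: lift_def)
qed

text \<open>The structure of a composite left map is a lift of its second factor \<open>g\<close>, namely in the following
  square, whose upper side is the structure of the first factor carried along \<open>(1, g)\<close>.\<close>

lemma composite_square:
  assumes "left_map f \<alpha>" "g \<in> Arr C" "Dom C g = Cod C f"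
  shows "square g (R (g \<cdot> f)) (M f (g \<cdot> f) (id\<^sub>C (Dom C f)) g \<cdot> \<alpha>) (id\<^sub>C (Cod C g))"
proof -
  note [simp] = left_map_simps[OF assms(1)] assms(2,3)
  have sq: "square f (g \<cdot> f) (id\<^sub>C (Dom C f)) g" by (simp add: square_def)
  note [simp] = M_simps[OF sq]
  have "R (g \<cdot> f) \<cdot> M f (g \<cdot> f) (id\<^sub>C (Dom C f)) g \<cdot> \<alpha> = g \<cdot> R f \<cdot> \<alpha>"
    using comp_cong[OF R_M[OF sq], of \<alpha>] by simp
  then show ?thesis by (simp add: square_def)
qed

lemma LMap_comp_eq:
  assumes "left_map f \<alpha>" "left_map g \<beta>" "Dom C g = Cod C f"
  shows "LMap_comp C W (f, sq f (L f) (id\<^sub>C (Dom C f)) \<alpha>) (g, sq g (L g) (id\<^sub>C (Dom C g)) \<beta>) =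
    (g \<cdot> f, sq (g \<cdot> f) (L (g \<cdot> f)) (id\<^sub>C (Dom C f))
       (lift g \<beta> (g \<cdot> f) (M f (g \<cdot> f) (id\<^sub>C (Dom C f)) g \<cdot> \<alpha>) (id\<^sub>C (Cod C g))))"
  by (simp add: LMap_comp_def Let_def lift_def)

end

section \<open>Cell complexes\<close>

locale spaces =
  fixes U :: "'u universe"
  assumes universe: "is_universe U"
begin

lemma Arr_Top_image: "f \<in> Arr (Top U) \<Longrightarrow> x \<in> topspace (TDom f) \<Longrightarrow> TFun f x \<in> topspace (TCod f)"
  by (auto simp: Top_def continuous_map_def)

lemma Top_category: "is_category (Top U)"
  unfolding is_category_def
proof (intro conjI ballI impI)
  fix f assume f: "f \<in> Arr (Top U)"
  show "Dom (Top U) f \<in> Obj (Top U)" "Cod (Top U) f \<in> Obj (Top U)"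
    using f by (auto simp: Top_def)
  have e: "TFun f \<in> extensional (topspace (TDom f))" using f by (simp add: Top_def)
  then have "compose (topspace (TDom f)) (TFun f) (restrict (\<lambda>x. x) (topspace (TDom f))) = TFun f"
    by (auto simp: compose_def fun_eq_iff extensional_def)
  then show "Comp (Top U) f (Id (Top U) (Dom (Top U) f)) = f" by (simp add: Top_def)
  have "compose (topspace (TDom f)) (restrict (\<lambda>x. x) (topspace (TCod f))) (TFun f) = TFun f"
    using e Arr_Top_image[OF f] by (auto simp: compose_def fun_eq_iff extensional_def)
  then show "Comp (Top U) (Id (Top U) (Cod (Top U) f)) f = f" by (simp add: Top_def)
next
  fix X assume "X \<in> Obj (Top U)"
  moreover have "continuous_map X X (restrict (\<lambda>x. x) (topspace X))"
    by (rule continuous_map_eq[OF continuous_map_id]) simp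
  ultimately show "Id (Top U) X \<in> Hom (Top U) X X"
    by (simp add: Top_def Hom_def)
next
  fix f g assume fg: "f \<in> Arr (Top U)" "g \<in> Arr (Top U)" "Dom (Top U) g = Cod (Top U) f"
  then have "continuous_map (TDom f) (TCod g) (TFun g \<circ> TFun f)"
    by (auto simp: Top_def intro: continuous_map_compose)
  then have "continuous_map (TDom f) (TCod g) (compose (topspace (TDom f)) (TFun g) (TFun f))"
    by (rule continuous_map_eq) (simp add: compose_def)
  then show "Comp (Top U) g f \<in> Hom (Top U) (Dom (Top U) f) (Cod (Top U) g)"
    using fg by (simp add: Top_def Hom_def)
next
  fix f g h assume fgh: "f \<in> Arr (Top U)" "g \<in> Arr (Top U)" "h \<in> Arr (Top U)"
    "Dom (Top U) g = Cod (Top U) f" "Dom (Top U) h = Cod (Top U) g"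
  then have "TDom g = TCod f" by (simp add: Top_def)
  then have "compose (topspace (TDom f)) (TFun h) (compose (topspace (TDom f)) (TFun g) (TFun f)) =
      compose (topspace (TDom f)) (compose (topspace (TDom g)) (TFun h) (TFun g)) (TFun f)"
    using Arr_Top_image[OF fgh(1)] by (auto simp: compose_def fun_eq_iff)
  then show "Comp (Top U) h (Comp (Top U) g f) = Comp (Top U) (Comp (Top U) h g) f"
    by (simp add: Top_def)
qed

end

sublocale spaces \<subseteq> cat "Top U"
  by unfold_locales (rule Top_category)

context spaces
begin

abbreviation "T \<equiv> Top U"

notation comp (infixr "\<cdot>" 75)

lemma TCod_eq: "TCod f = Cod T f"
  by (simp add: Top_def)

lemma small_empty: "small U {}"
  using universe unfolding is_universe_def by blast

lemma initial_space:
  assumes "Z \<in> Obj T"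
  shows "\<exists>!h. h \<in> Hom T (discrete_topology {}) Z"
proof (rule ex1I)
  define e where "e = \<lparr>TDom = discrete_topology {}, TCod = Z, TFun = \<lambda>_. undefined\<rparr>"
  show "e \<in> Hom T (discrete_topology {}) Z"
    using assms small_empty by (simp add: e_def Top_def Hom_def)
  fix h assume "h \<in> Hom T (discrete_topology {}) Z"
  then have "TDom h = discrete_topology {}" "TCod h = Z" "TFun h \<in> extensional {}"
    by (auto simp: Top_def Hom_def)
  then show "h = e" by (intro top_arr.equality) (auto simp: e_def)
qed

lemma empty_coproduct: "is_coproduct T {} X (discrete_topology {}) i"
proof -
  have "discrete_topology {} \<in> Obj T" using small_empty by (simp add: Top_def)
  then show ?thesis using initial_space by (simp add: is_coproduct_def)
qed

lemma cell_incl_hom: "cell_incl U n \<in> Hom T (bd_sphere U n) (disc U n)"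
proof -
  define e where "e = inv (embed U)"
  define S where "S = subtopology (Euclidean_space n) {x. (\<Sum>i<n. (x i)\<^sup>2) = 1}"
  define D where "D = subtopology (Euclidean_space n) {x. (\<Sum>i<n. (x i)\<^sup>2) \<le> 1}"
  have inj: "inj (embed U)" using universe by (simp add: is_universe_def)
  have small: "small U (embed U ` A)" for A
    using universe unfolding is_universe_def by (meson image_mono subset_UNIV)
  have top: "topspace (transport U X) = embed U ` topspace X" for X
    using inj by (auto simp: transport_def topspace_pullback_topology)
  have "continuous_map (transport U S) (transport U D) id"
    unfolding transport_def
  proof (rule continuous_map_pullback')
    have "continuous_map (pullback_topology (embed U ` topspace S) (inv (embed U)) S) S (inv (embed U))"
      using continuous_map_pullback[OF continuous_map_id, of "embed U ` topspace S" "inv (embed U)" S]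
      by (simp add: id_def comp_def)
    moreover have "continuous_map S D id"
      by (auto simp: S_def D_def continuous_map_in_subtopology)
    ultimately show "continuous_map (pullback_topology (embed U ` topspace S) (inv (embed U)) S) D
        (inv (embed U) \<circ> id)"
      using continuous_map_compose[of _ S "inv (embed U)" D id] by simp
    show "topspace (pullback_topology (embed U ` topspace S) (inv (embed U)) S) \<subseteq>
      id -` embed U ` topspace D"
    proof -
      have "topspace S \<subseteq> topspace D" unfolding S_def D_def topspace_subtopology by auto
      then have "embed U ` topspace S \<subseteq> embed U ` topspace D" by (rule image_mono)
      then show ?thesis using top[of S] unfolding transport_def by (simp add: vimage_def id_def)
    qed
  qed
  then have "continuous_map (bd_sphere U n) (disc U n) (restrict (\<lambda>x. x) (topspace (bd_sphere U n)))"
    unfolding bd_sphere_def disc_def S_def D_def by (rule continuous_map_eq) simp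
  then show ?thesis
    using small by (simp add: Hom_def Top_def cell_incl_def) (simp add: bd_sphere_def disc_def top)
qed

lemmas cell_incl_simps [simp] = cell_incl_hom[unfolded Hom_iff, THEN conjunct1]
  cell_incl_hom[unfolded Hom_iff, THEN conjunct2, THEN conjunct1]
  cell_incl_hom[unfolded Hom_iff, THEN conjunct2, THEN conjunct2]

subsection \<open>Strata\<close>

lemma body_simps:
  assumes "is_body U P u c"
  shows "u \<in> Hom T (bdry P) (Cod T u)"
    "s \<in> cells P \<Longrightarrow> c s \<in> Hom T (disc U (kind P s)) (Cod T u)"
    "s \<in> cells P \<Longrightarrow> att P s \<in> Hom T (bd_sphere U (kind P s)) (bdry P)"
    "s \<in> cells P \<Longrightarrow> c s \<cdot> cell_incl U (kind P s) = u \<cdot> att P s"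
proof -
  obtain S i D j k b d where
    S: "is_coproduct T (cells P) (\<lambda>s. bd_sphere U (kind P s)) S i" and
    D: "is_coproduct T (cells P) (\<lambda>s. disc U (kind P s)) D j" and
    k: "k \<in> Hom T S D" "\<And>s. s \<in> cells P \<Longrightarrow> k \<cdot> i s = j s \<cdot> cell_incl U (kind P s)" and
    b: "b \<in> Hom T S (bdry P)" "\<And>s. s \<in> cells P \<Longrightarrow> b \<cdot> i s = att P s" and
    po: "is_pushout T k b d u" and c: "\<And>s. s \<in> cells P \<Longrightarrow> c s = d \<cdot> j s"
    using assms unfolding is_body_def by blast
  have i: "i s \<in> Hom T (bd_sphere U (kind P s)) S" and j: "j s \<in> Hom T (disc U (kind P s)) D"
    if "s \<in> cells P" for s using S D that by (auto simp: is_coproduct_def)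
  have [simp]: "d \<in> Arr T" "Dom T d = D" "Cod T d = Cod T u" "d \<cdot> k = u \<cdot> b"
    using po k(1) by (simp_all add: is_pushout_def Hom_iff)
  show u: "u \<in> Hom T (bdry P) (Cod T u)"
    using po b(1) by (simp add: is_pushout_def Hom_iff)
  assume s: "s \<in> cells P"
  show "c s \<in> Hom T (disc U (kind P s)) (Cod T u)" using c[OF s] j[OF s] by (simp add: Hom_iff)
  show "att P s \<in> Hom T (bd_sphere U (kind P s)) (bdry P)"
    using b(1) i[OF s] by (simp add: Hom_iff flip: b(2)[OF s])
  have "c s \<cdot> cell_incl U (kind P s) = d \<cdot> k \<cdot> i s"
    using j[OF s] k(2)[OF s] by (simp add: c[OF s] Hom_iff)
  also have "\<dots> = u \<cdot> b \<cdot> i s"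
    by (rule comp_cong) (use i[OF s] k b u in \<open>auto simp: Hom_iff\<close>)
  finally show "c s \<cdot> cell_incl U (kind P s) = u \<cdot> att P s" using b(2)[OF s] by simp
qed

lemma body_eqI:
  assumes body: "is_body U P u c" and p: "p \<in> Hom T (Cod T u) Z" and q: "q \<in> Hom T (Cod T u) Z"
    and eq: "p \<cdot> u = q \<cdot> u" "\<And>s. s \<in> cells P \<Longrightarrow> p \<cdot> c s = q \<cdot> c s"
  shows "p = q"
proof -
  obtain S i D j k b d where
    D: "is_coproduct T (cells P) (\<lambda>s. disc U (kind P s)) D j" and k: "k \<in> Hom T S D" and
    po: "is_pushout T k b d u" and c: "\<And>s. s \<in> cells P \<Longrightarrow> c s = d \<cdot> j s"
    using body unfolding is_body_def by blast
  have j: "j s \<in> Hom T (disc U (kind P s)) D" if "s \<in> cells P" for s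
    using D that by (auto simp: is_coproduct_def)
  have [simp]: "d \<in> Arr T" "Dom T d = D" "Cod T d = Cod T u"
    using po k by (simp_all add: is_pushout_def Hom_iff)
  have "p \<cdot> d = q \<cdot> d"
  proof (rule coproduct_eqI[OF D])
    show "p \<cdot> d \<in> Hom T D Z" "q \<cdot> d \<in> Hom T D Z" using p q by (simp_all add: Hom_iff)
    show "(p \<cdot> d) \<cdot> j s = (q \<cdot> d) \<cdot> j s" if "s \<in> cells P" for s
      using eq(2)[OF that] j[OF that] c[OF that] p q by (simp add: Hom_iff)
  qed
  then show ?thesis using pushout_eqI[OF po, of p Z q] p q eq(1) by simp
qed

lemma body_factor:
  assumes body: "is_body U P u c" and z: "z \<in> Hom T (bdry P) Z"
    and w: "\<And>s. s \<in> cells P \<Longrightarrow> w s \<in> Hom T (disc U (kind P s)) Z"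
      "\<And>s. s \<in> cells P \<Longrightarrow> w s \<cdot> cell_incl U (kind P s) = z \<cdot> att P s"
  obtains h where "h \<in> Hom T (Cod T u) Z" "h \<cdot> u = z" "\<And>s. s \<in> cells P \<Longrightarrow> h \<cdot> c s = w s"
proof -
  obtain S i D j k b d where
    S: "is_coproduct T (cells P) (\<lambda>s. bd_sphere U (kind P s)) S i" and
    D: "is_coproduct T (cells P) (\<lambda>s. disc U (kind P s)) D j" and
    k: "k \<in> Hom T S D" "\<And>s. s \<in> cells P \<Longrightarrow> k \<cdot> i s = j s \<cdot> cell_incl U (kind P s)" and
    b: "b \<in> Hom T S (bdry P)" "\<And>s. s \<in> cells P \<Longrightarrow> b \<cdot> i s = att P s" and
    po: "is_pushout T k b d u" and c: "\<And>s. s \<in> cells P \<Longrightarrow> c s = d \<cdot> j s"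
    using body unfolding is_body_def by blast
  have i: "i s \<in> Hom T (bd_sphere U (kind P s)) S" and j: "j s \<in> Hom T (disc U (kind P s)) D"
    if "s \<in> cells P" for s using S D that by (auto simp: is_coproduct_def)
  have [simp]: "d \<in> Arr T" "Dom T d = D" "Cod T d = Cod T u"
    using po k(1) by (simp_all add: is_pushout_def Hom_iff)
  have Z: "Z \<in> Obj T" using z by (auto simp: Hom_iff)
  obtain y where y: "y \<in> Hom T D Z" "\<And>s. s \<in> cells P \<Longrightarrow> y \<cdot> j s = w s"
    using coproduct_factor[OF D Z, of w] w by blast
  have "y \<cdot> k = z \<cdot> b"
  proof (rule coproduct_eqI[OF S])
    show "y \<cdot> k \<in> Hom T S Z" "z \<cdot> b \<in> Hom T S Z" using y k z b by auto
    fix s assume s: "s \<in> cells P"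
    have "(y \<cdot> k) \<cdot> i s = y \<cdot> j s \<cdot> cell_incl U (kind P s)"
      using y(1) k i[OF s] s by (simp add: Hom_iff)
    also have "\<dots> = w s \<cdot> cell_incl U (kind P s)"
      by (rule comp_cong1[OF y(2)[OF s]]) (use y(1) j[OF s] in \<open>auto simp: Hom_iff\<close>)
    also have "\<dots> = (z \<cdot> b) \<cdot> i s" using w(2)[OF s] z b i[OF s] s by (simp add: Hom_iff)
    finally show "(y \<cdot> k) \<cdot> i s = (z \<cdot> b) \<cdot> i s" .
  qed
  then obtain h where h: "h \<in> Hom T (Cod T d) Z" "h \<cdot> d = y" "h \<cdot> u = z"
    using pushout_factor[OF po Z, of y z] y(1) z k b by (auto simp: Hom_iff)
  show ?thesis
  proof (rule that)
    show "h \<in> Hom T (Cod T u) Z" "h \<cdot> u = z" using h by simp_all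
    show "h \<cdot> c s = w s" if "s \<in> cells P" for s
      using comp_cong1[OF h(2), of "j s"] h(1) j[OF that] y that by (simp add: c Hom_iff)
  qed
qed

lemma stratum_body_map_props:
  assumes P: "is_body U P u c" and Q: "is_body U Q u' c'" and m: "is_stratum_map U P Q f p"
  shows "stratum_body_map U P u c u' c' f p \<in> Hom T (Cod T u) (Cod T u')"
    "stratum_body_map U P u c u' c' f p \<cdot> u = u' \<cdot> f"
    "s \<in> cells P \<Longrightarrow> stratum_body_map U P u c u' c' f p \<cdot> c s = c' (p s)"
proof -
  have f: "f \<in> Hom T (bdry P) (bdry Q)" and p: "\<And>s. s \<in> cells P \<Longrightarrow> p s \<in> cells Q"
    and kind: "\<And>s. s \<in> cells P \<Longrightarrow> kind P s = kind Q (p s)"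
    and att: "\<And>s. s \<in> cells P \<Longrightarrow> f \<cdot> att P s = att Q (p s)"
    using m by (auto simp: is_stratum_map_def)
  note bP = body_simps[OF P] and bQ = body_simps[OF Q]
  have 1: "u' \<cdot> f \<in> Hom T (bdry P) (Cod T u')" using f bQ(1) by blast
  have 2: "c' (p s) \<in> Hom T (disc U (kind P s)) (Cod T u')" if "s \<in> cells P" for s
    using bQ(2)[OF p[OF that]] kind[OF that] by simp
  have 3: "c' (p s) \<cdot> cell_incl U (kind P s) = (u' \<cdot> f) \<cdot> att P s" if "s \<in> cells P" for s
    using bQ(1) bQ(4)[OF p[OF that]] kind[OF that] att[OF that] f bP(3)[OF that] by (simp add: Hom_iff)
  obtain h where h: "h \<in> Hom T (Cod T u) (Cod T u')" "h \<cdot> u = u' \<cdot> f"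
    "\<And>s. s \<in> cells P \<Longrightarrow> h \<cdot> c s = c' (p s)"
    by (rule body_factor[OF P 1, of "\<lambda>s. c' (p s)"]) (use 2 3 in auto)
  have "stratum_body_map U P u c u' c' f p = h"
    unfolding stratum_body_map_def TCod_eq
  proof (rule the_equality)
    fix h' assume "h' \<in> Hom T (Cod T u) (Cod T u') \<and> h' \<cdot> u = u' \<cdot> f \<and> (\<forall>s\<in>cells P. h' \<cdot> c s = c' (p s))"
    then show "h' = h" using h by (intro body_eqI[OF P, of h' "Cod T u'" h]) simp_all
  qed (use h in simp)
  then show "stratum_body_map U P u c u' c' f p \<in> Hom T (Cod T u) (Cod T u')"
    "stratum_body_map U P u c u' c' f p \<cdot> u = u' \<cdot> f"
    "s \<in> cells P \<Longrightarrow> stratum_body_map U P u c u' c' f p \<cdot> c s = c' (p s)"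
    using h by simp_all
qed

lemma is_bodyI:
  assumes "c \<in> extensional (cells P)"
    "is_coproduct T (cells P) (\<lambda>s. bd_sphere U (kind P s)) S i"
    "is_coproduct T (cells P) (\<lambda>s. disc U (kind P s)) D j"
    "k \<in> Hom T S D" "\<And>s. s \<in> cells P \<Longrightarrow> k \<cdot> i s = j s \<cdot> cell_incl U (kind P s)"
    "b \<in> Hom T S (bdry P)" "\<And>s. s \<in> cells P \<Longrightarrow> b \<cdot> i s = att P s"
    "is_pushout T k b d u" "\<And>s. s \<in> cells P \<Longrightarrow> c s = d \<cdot> j s"
  shows "is_body U P u c"
  unfolding is_body_def using assms by blast

text \<open>The maps \<open>kind\<close> and \<open>att\<close> of a stratum are extensional on its cells, which leaves no choice for them
  here.\<close>

definition empty_stratum :: "'u topology \<Rightarrow> 'u stratum" where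
  "empty_stratum X = \<lparr>bdry = X, cells = {}, kind = (\<lambda>_. undefined), att = (\<lambda>_. undefined)\<rparr>"

lemma empty_stratum_simps [simp]: "bdry (empty_stratum X) = X" "cells (empty_stratum X) = {}"
  by (simp_all add: empty_stratum_def)

lemma empty_stratum:
  assumes "X \<in> Obj T"
  shows "is_stratum U (empty_stratum X)" "is_body U (empty_stratum X) (id\<^sub>C X) (\<lambda>_. undefined)"
proof -
  show "is_stratum U (empty_stratum X)"
    using assms small_empty by (simp add: is_stratum_def empty_stratum_def)
  define E where "E = (discrete_topology {} :: 'u topology)"
  have cop: "is_coproduct T {} Y E i" for Y :: "'u \<Rightarrow> 'u topology" and i
    unfolding E_def by (rule empty_coproduct)
  have E: "E \<in> Obj T" using cop by (simp add: is_coproduct_def)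
  obtain b where b: "b \<in> Hom T E X" using initial_space[OF assms] by (auto simp: E_def)
  have "is_pushout T (id\<^sub>C E) b b (id\<^sub>C X)" using pushout_of_id(1)[of b] b by (simp add: Hom_iff)
  then show "is_body U (empty_stratum X) (id\<^sub>C X) (\<lambda>_. undefined)"
    using cop b E by (intro is_bodyI[where S=E and D=E and k="id\<^sub>C E" and b=b and d=b]) (simp_all add: Hom_iff)
qed

text \<open>The only inhabited stratum of the complexes in the image of \<open>eta\<close>.\<close>

definition cell_stratum :: "nat \<Rightarrow> 'u stratum" where
  "cell_stratum n = \<lparr>bdry = bd_sphere U n, cells = {embed U (\<lambda>_. 0)},
     kind = restrict (\<lambda>_. n) {embed U (\<lambda>_. 0)},
     att = restrict (\<lambda>_. id\<^sub>C (bd_sphere U n)) {embed U (\<lambda>_. 0)}\<rparr>"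

definition cell_chr :: "nat \<Rightarrow> 'u \<Rightarrow> 'u top_arr" where
  "cell_chr n = restrict (\<lambda>_. id\<^sub>C (disc U n)) {embed U (\<lambda>_. 0)}"

lemma cell_stratum:
  shows "is_stratum U (cell_stratum n)" "is_body U (cell_stratum n) (cell_incl U n) (cell_chr n)"
proof -
  define star where "star = embed U (\<lambda>_. 0)"
  have "small U {star}"
    using universe unfolding is_universe_def star_def by (meson empty_subsetI insert_subset rangeI)
  moreover have o: "bd_sphere U n \<in> Obj T" "disc U n \<in> Obj T"
    using Hom_objs[OF cell_incl_hom[of n]] by blast+
  ultimately show "is_stratum U (cell_stratum n)"
    by (auto simp: is_stratum_def cell_stratum_def star_def Hom_iff)
  have "is_pushout T (cell_incl U n) (id\<^sub>C (bd_sphere U n)) (id\<^sub>C (disc U n)) (cell_incl U n)"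
    using pushout_of_id(2)[of "cell_incl U n"] by simp
  moreover have "is_coproduct T {star} (\<lambda>s. bd_sphere U (kind (cell_stratum n) s)) (bd_sphere U n)
      (\<lambda>_. id\<^sub>C (bd_sphere U n))"
    using coproduct_singleton[of "\<lambda>s. bd_sphere U (kind (cell_stratum n) s)" star] o
    by (simp add: cell_stratum_def star_def)
  moreover have "is_coproduct T {star} (\<lambda>s. disc U (kind (cell_stratum n) s)) (disc U n)
      (\<lambda>_. id\<^sub>C (disc U n))"
    using coproduct_singleton[of "\<lambda>s. disc U (kind (cell_stratum n) s)" star] o
    by (simp add: cell_stratum_def star_def)
  moreover have "cells (cell_stratum n) = {star}" "bdry (cell_stratum n) = bd_sphere U n"
    "kind (cell_stratum n) star = n" "att (cell_stratum n) star = id\<^sub>C (bd_sphere U n)"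
    "cell_chr n star = id\<^sub>C (disc U n)" "cell_chr n \<in> extensional {star}"
    by (simp_all add: cell_stratum_def cell_chr_def star_def)
  ultimately show "is_body U (cell_stratum n) (cell_incl U n) (cell_chr n)"
    using o by (intro is_bodyI[where S="bd_sphere U n" and D="disc U n" and k="cell_incl U n" and
          i="\<lambda>_. id\<^sub>C (bd_sphere U n)" and j="\<lambda>_. id\<^sub>C (disc U n)" and
          b="id\<^sub>C (bd_sphere U n)" and d="id\<^sub>C (disc U n)"]) (simp_all add: Hom_iff)
qed

subsection \<open>Maps out of a cell complex\<close>

context
  fixes A :: "'u cell_complex"
  assumes A: "is_cell_complex U A"
begin

lemma cx_stratum: "is_stratum U (strat A n)"
  and cx_is_body: "is_body U (strat A n) (incl A n) (chr A n)"
  and cx_incl_Cod: "Cod T (incl A n) = cx_space A (Suc n)"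
  and cx_colimit: "is_seq_colimit T (cx_space A) (incl A) (cx_body A) (leg A)"
  using A by (auto simp: is_cell_complex_def TCod_eq)

lemma cx_hom:
  shows "incl A n \<in> Hom T (cx_space A n) (cx_space A (Suc n))"
    and "leg A n \<in> Hom T (cx_space A n) (cx_body A)"
    and "s \<in> cells (strat A n) \<Longrightarrow>
      chr A n s \<in> Hom T (disc U (kind (strat A n) s)) (cx_space A (Suc n))"
    and "s \<in> cells (strat A n) \<Longrightarrow>
      att (strat A n) s \<in> Hom T (bd_sphere U (kind (strat A n) s)) (cx_space A n)"
  using body_simps[OF cx_is_body[of n]] seq_colimit_simps(3)[OF cx_colimit, of n]
  by (simp_all add: cx_incl_Cod cx_space_def)

lemma leg_incl: "leg A (Suc n) \<cdot> incl A n = leg A n"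
  using seq_colimit_simps[OF cx_colimit] by simp

lemma chr_cell_incl:
  "s \<in> cells (strat A n) \<Longrightarrow>
    chr A n s \<cdot> cell_incl U (kind (strat A n) s) = incl A n \<cdot> att (strat A n) s"
  using body_simps(4)[OF cx_is_body] .

lemma leg_chr_cell_incl:
  assumes s: "s \<in> cells (strat A n)"
  shows "leg A (Suc n) \<cdot> chr A n s \<cdot> cell_incl U (kind (strat A n) s) =
    leg A n \<cdot> att (strat A n) s"
  using comp_cong1[OF leg_incl, of "att (strat A n) s"] cx_hom(1)[of n] cx_hom(2)[of "Suc n"]
    cx_hom(4)[OF s] chr_cell_incl[OF s]
  by (simp add: Hom_iff)

text \<open>The legs of the colimit are jointly epic, and so are, at every stage, the inclusion of the previous
  space and the characteristic maps of the cells.  On each cell the two maps may be compared under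
  the hypothesis that they agree on all earlier stages.\<close>

lemma cx_eqI:
  assumes p: "p \<in> Hom T (cx_body A) Z" and q: "q \<in> Hom T (cx_body A) Z"
    and base: "p \<cdot> leg A 0 = q \<cdot> leg A 0"
    and cell: "\<And>n s. p \<cdot> leg A n = q \<cdot> leg A n \<Longrightarrow> s \<in> cells (strat A n) \<Longrightarrow>
      p \<cdot> leg A (Suc n) \<cdot> chr A n s = q \<cdot> leg A (Suc n) \<cdot> chr A n s"
  shows "p = q"
proof (rule seq_colimit_eqI[OF cx_colimit p q])
  fix n show "p \<cdot> leg A n = q \<cdot> leg A n"
  proof (induction n)
    case (Suc n)
    show ?case
    proof (rule body_eqI[OF cx_is_body[of n], of _ Z])
      show "p \<cdot> leg A (Suc n) \<in> Hom T (Cod T (incl A n)) Z"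
        "q \<cdot> leg A (Suc n) \<in> Hom T (Cod T (incl A n)) Z"
        using p q cx_hom(2)[of "Suc n"] unfolding cx_incl_Cod by blast+
      show "(p \<cdot> leg A (Suc n)) \<cdot> incl A n = (q \<cdot> leg A (Suc n)) \<cdot> incl A n"
        using Suc p q cx_hom(2)[of "Suc n"] cx_hom(1)[of n] by (simp add: Hom_iff leg_incl)
      show "(p \<cdot> leg A (Suc n)) \<cdot> chr A n s = (q \<cdot> leg A (Suc n)) \<cdot> chr A n s"
        if "s \<in> cells (strat A n)" for s
        using cell[OF Suc that] p q cx_hom(2)[of "Suc n"] cx_hom(3)[OF that] by (simp add: Hom_iff)
    qed
  qed (rule base)
qed

text \<open>A map out of the body is a compatible sequence of maps out of the stages.  The value \<open>E\<close> on a new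
  cell may depend on the map constructed so far, for which the invariant \<open>I\<close> is maintained; the
  successive choices are made by dependent choice.\<close>

lemma cx_recursion:
  assumes z0: "z0 \<in> Hom T (cx_boundary A) Z" "I 0 z0"
    and E: "\<And>n z s. z \<in> Hom T (cx_space A n) Z \<Longrightarrow> I n z \<Longrightarrow> s \<in> cells (strat A n) \<Longrightarrow>
      E n s z \<in> Hom T (disc U (kind (strat A n) s)) Z \<and>
      E n s z \<cdot> cell_incl U (kind (strat A n) s) = z \<cdot> att (strat A n) s"
    and I: "\<And>n z z'. z \<in> Hom T (cx_space A n) Z \<Longrightarrow> I n z \<Longrightarrow>
      z' \<in> Hom T (cx_space A (Suc n)) Z \<Longrightarrow> z' \<cdot> incl A n = z \<Longrightarrow>
      (\<And>s. s \<in> cells (strat A n) \<Longrightarrow> z' \<cdot> chr A n s = E n s z) \<Longrightarrow> I (Suc n) z'"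
  obtains h where "h \<in> Hom T (cx_body A) Z" "h \<cdot> leg A 0 = z0" "\<And>n. I n (h \<cdot> leg A n)"
    "\<And>n s. s \<in> cells (strat A n) \<Longrightarrow> h \<cdot> leg A (Suc n) \<cdot> chr A n s = E n s (h \<cdot> leg A n)"
proof -
  \<comment> \<open>Dependent choice leaves the initial value open, so the property at stage \<open>0\<close> imposes it.\<close>
  define V where "V n z \<longleftrightarrow> z \<in> Hom T (cx_space A n) Z \<and> I n z \<and> (n = 0 \<longrightarrow> z = z0)" for n z
  define S where "S n z z' \<longleftrightarrow> z' \<cdot> incl A n = z \<and> (\<forall>s\<in>cells (strat A n). z' \<cdot> chr A n s = E n s z)"
    for n z z'
  have "\<exists>z. \<forall>n. V n (z n) \<and> S n (z n) (z (Suc n))"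
  proof (rule dependent_nat_choice)
    show "\<exists>z. V 0 z" using z0 by (auto simp: V_def cx_boundary_def)
    fix z n assume "V n z"
    then have z: "z \<in> Hom T (cx_space A n) Z" and Iz: "I n z" by (auto simp: V_def)
    obtain h where h: "h \<in> Hom T (Cod T (incl A n)) Z" "h \<cdot> incl A n = z"
      "\<And>s. s \<in> cells (strat A n) \<Longrightarrow> h \<cdot> chr A n s = E n s z"
      by (rule body_factor[OF cx_is_body[of n], of z Z "\<lambda>s. E n s z"])
        (use z E[OF z Iz] in \<open>auto simp: cx_space_def\<close>)
    then have "I (Suc n) h" using I[OF z Iz] by (simp add: cx_incl_Cod)
    then show "\<exists>z'. V (Suc n) z' \<and> S n z z'" using h by (auto simp: V_def S_def cx_incl_Cod)
  qed
  then obtain z where z: "\<And>n. V n (z n)" "\<And>n. S n (z n) (z (Suc n))" by blast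
  have zh: "z n \<in> Hom T (cx_space A n) Z" "I n (z n)" "z (Suc n) \<cdot> incl A n = z n" for n
    using z[of n] by (auto simp: V_def S_def)
  obtain h where h: "h \<in> Hom T (cx_body A) Z" "\<And>n. h \<cdot> leg A n = z n"
    using seq_colimit_factor[OF cx_colimit Hom_objs(2)[OF z0(1)], of z] zh by blast
  show ?thesis
  proof (rule that[of h])
    show "h \<in> Hom T (cx_body A) Z" by fact
    show "h \<cdot> leg A 0 = z0" using h(2) z(1)[of 0] by (simp add: V_def)
    show "I n (h \<cdot> leg A n)" for n using h(2) zh(2) by simp
    show "h \<cdot> leg A (Suc n) \<cdot> chr A n s = E n s (h \<cdot> leg A n)" if s: "s \<in> cells (strat A n)" for n s
    proof -
      have "h \<cdot> leg A (Suc n) \<cdot> chr A n s = z (Suc n) \<cdot> chr A n s"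
        by (rule comp_cong1[OF h(2)]) (use h(1) cx_hom(2)[of "Suc n"] cx_hom(3)[OF s] in \<open>auto simp: Hom_iff\<close>)
      then show ?thesis using z(2)[of n] s h(2) by (simp add: S_def)
    qed
  qed
qed

end

subsection \<open>Finite cell complexes\<close>

text \<open>If no cells are attached from stage \<open>N\<close> on, the sequence of spaces is eventually constant, so that its
  \<open>N\<close>-th space serves as body.\<close>

lemma finite_cell_complex:
  assumes X: "X \<in> Obj T"
    and fin: "\<And>n. n < N \<Longrightarrow> is_stratum U (strat A n)"
      "\<And>n. n < N \<Longrightarrow> is_body U (strat A n) (incl A n) (chr A n)"
      "\<And>n. n < N \<Longrightarrow> Cod T (incl A n) = cx_space A (Suc n)"
      "\<And>n s m. n < N \<Longrightarrow> s \<in> cells (strat A n) \<Longrightarrow> m < n \<Longrightarrow>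
        \<not> factors_through T (att (strat A n) s) (seq_map T (cx_space A) (incl A) m (n - m))"
    and const: "\<And>n. n \<ge> N \<Longrightarrow> strat A n = empty_stratum X"
      "\<And>n. n \<ge> N \<Longrightarrow> incl A n = id\<^sub>C X" "\<And>n. n \<ge> N \<Longrightarrow> chr A n = (\<lambda>_. undefined)"
    and leg: "\<And>n. leg A n = (if n < N then seq_map T (cx_space A) (incl A) n (N - n) else id\<^sub>C X)"
  shows "is_cell_complex U A" "cx_body A = X" "cx_space A N = X"
proof -
  have sp: "cx_space A n = X" if "n \<ge> N" for n using const(1)[OF that] by (simp add: cx_space_def)
  have body: "is_body U (strat A n) (incl A n) (chr A n)" for n
    using fin(2)[of n] const[of n] empty_stratum(2)[OF X] by (cases "n < N") auto
  have strat: "is_stratum U (strat A n)" for n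
    using fin(1)[of n] const[of n] empty_stratum(1)[OF X] by (cases "n < N") auto
  have cod: "Cod T (incl A n) = cx_space A (Suc n)" for n
    using fin(3)[of n] const(2)[of n] sp[of "Suc n"] X by (cases "n < N") auto
  have incl: "incl A n \<in> Hom T (cx_space A n) (cx_space A (Suc n))" for n
    using body_simps(1)[OF body[of n]] by (simp add: cod) (simp add: cx_space_def)
  have leg_hom: "leg A n \<in> Hom T (cx_space A n) X" for n
    using seq_map_hom[of "incl A" "cx_space A" n "N - n"] incl X sp[of N] sp[of n]
    by (cases "n < N") (auto simp: leg Hom_iff)
  have leg_step: "leg A (Suc n) \<cdot> incl A n = leg A n" for n
  proof (cases "n < N")
    case True
    have "leg A (Suc n) = seq_map T (cx_space A) (incl A) (Suc n) (N - Suc n)"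
      using True sp[of N] leg[of "Suc n"] by (cases "Suc n = N") auto
    then show ?thesis
      using seq_map_Suc_shift[of "incl A" "cx_space A" n "N - Suc n"] incl True leg[of n]
      by (simp add: Suc_diff_Suc)
  next
    case False
    then show ?thesis using const(2)[of n] X by (simp add: leg)
  qed
  show bodyX: "cx_body A = X" using leg_hom[of 0] by (simp add: cx_body_def TCod_eq Hom_iff)
  show "cx_space A N = X" using sp by simp
  have "is_seq_colimit T (cx_space A) (incl A) (cx_body A) (leg A)"
    unfolding bodyX
    by (rule seq_colimit_eventually_const[where N = N]) (use incl leg_hom leg_step sp const(2) leg in auto)
  moreover have "cells (strat A n) = {}" if "\<not> n < N" for n using const(1)[of n] that by simp
  ultimately show "is_cell_complex U A"
    using strat body cod fin(4) unfolding is_cell_complex_def TCod_eq by (metis empty_iff)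
qed

text \<open>A stratum is regarded as a cell complex all of whose cells lie in the first stratum.  The complexes in
  the image of \<open>eta\<close> have this form.\<close>

definition stratum_cx :: "'u stratum \<Rightarrow> 'u top_arr \<Rightarrow> ('u \<Rightarrow> 'u top_arr) \<Rightarrow> 'u cell_complex" where
  "stratum_cx P u c =
    \<lparr>strat = (\<lambda>n. if n = 0 then P else empty_stratum (Cod T u)),
     incl = (\<lambda>n. if n = 0 then u else id\<^sub>C (Cod T u)),
     chr = (\<lambda>n. if n = 0 then c else (\<lambda>_. undefined)),
     leg = (\<lambda>n. if n = 0 then u else id\<^sub>C (Cod T u))\<rparr>"

lemma stratum_cx_sel [simp]:
  "strat (stratum_cx P u c) 0 = P" "incl (stratum_cx P u c) 0 = u" "chr (stratum_cx P u c) 0 = c"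
  "leg (stratum_cx P u c) 0 = u" "n > 0 \<Longrightarrow> leg (stratum_cx P u c) n = id\<^sub>C (Cod T u)"
  "n > 0 \<Longrightarrow> strat (stratum_cx P u c) n = empty_stratum (Cod T u)"
  "n > 0 \<Longrightarrow> incl (stratum_cx P u c) n = id\<^sub>C (Cod T u)"
  "n > 0 \<Longrightarrow> chr (stratum_cx P u c) n = (\<lambda>_. undefined)"
  "cx_body (stratum_cx P u c) = Cod T u" "cx_boundary (stratum_cx P u c) = bdry P"
  "cx_space (stratum_cx P u c) 0 = bdry P"
  "n > 0 \<Longrightarrow> cx_space (stratum_cx P u c) n = Cod T u"
  by (simp_all add: stratum_cx_def cx_body_def TCod_eq cx_boundary_def cx_space_def)

lemma stratum_cx:
  assumes "is_stratum U P" "is_body U P u c"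
  shows "is_cell_complex U (stratum_cx P u c)"
proof (rule finite_cell_complex[where N = 1])
  have u: "u \<in> Hom T (bdry P) (Cod T u)" using body_simps[OF assms(2)] by blast
  show "Cod T u \<in> Obj T" using Hom_objs[OF u] by simp
  show "leg (stratum_cx P u c) n = (if n < 1
    then seq_map T (cx_space (stratum_cx P u c)) (incl (stratum_cx P u c)) n (1 - n)
    else id\<^sub>C (Cod T u))" for n
    using u by (auto simp: unit_hom)
qed (use assms in auto)

abbreviation cell_cx :: "nat \<Rightarrow> 'u cell_complex" where
  "cell_cx n \<equiv> stratum_cx (cell_stratum n) (cell_incl U n) (cell_chr n)"

lemma eta_obj_eq: "eta_obj U n = cell_cx n"
  by (auto simp: eta_obj_def Let_def stratum_cx_def cell_stratum_def cell_chr_def empty_stratum_def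
      fun_eq_iff)

definition trunc :: "nat \<Rightarrow> 'u cell_complex \<Rightarrow> 'u cell_complex" where
  "trunc N A =
    \<lparr>strat = (\<lambda>n. if n < N then strat A n else empty_stratum (cx_space A N)),
     incl = (\<lambda>n. if n < N then incl A n else id\<^sub>C (cx_space A N)),
     chr = (\<lambda>n. if n < N then chr A n else (\<lambda>_. undefined)),
     leg = (\<lambda>n. if n < N then seq_map T (cx_space A) (incl A) n (N - n) else id\<^sub>C (cx_space A N))\<rparr>"

lemma trunc_sel [simp]:
  "n < N \<Longrightarrow> strat (trunc N A) n = strat A n" "n < N \<Longrightarrow> incl (trunc N A) n = incl A n"
  "n < N \<Longrightarrow> chr (trunc N A) n = chr A n"
  "n \<ge> N \<Longrightarrow> strat (trunc N A) n = empty_stratum (cx_space A N)"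
  "n \<ge> N \<Longrightarrow> incl (trunc N A) n = id\<^sub>C (cx_space A N)"
  "n \<ge> N \<Longrightarrow> chr (trunc N A) n = (\<lambda>_. undefined)"
  "n \<ge> N \<Longrightarrow> leg (trunc N A) n = id\<^sub>C (cx_space A N)"
  "cx_space (trunc N A) n = cx_space A (min n N)"
  by (simp_all add: trunc_def cx_space_def min_def)

lemma seq_map_trunc:
  assumes "m + k \<le> N"
  shows "seq_map T (cx_space (trunc N A)) (incl (trunc N A)) m k = seq_map T (cx_space A) (incl A) m k"
  using assms by (induction k) auto

lemma trunc:
  assumes A: "is_cell_complex U A"
  shows "is_cell_complex U (trunc N A)" "cx_body (trunc N A) = cx_space A N"
proof -
  have X: "cx_space A N \<in> Obj T" using Hom_objs[OF cx_hom(1)[OF A]] by blast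
  have *: "\<not> factors_through T (att (strat A n) s) (seq_map T (cx_space A) (incl A) m (n - m))"
    if "s \<in> cells (strat A n)" "m < n" for n s m
    using A that by (simp add: is_cell_complex_def)
  note fin = finite_cell_complex[of "cx_space A N" N "trunc N A", OF X]
  show "is_cell_complex U (trunc N A)" "cx_body (trunc N A) = cx_space A N"
    by (rule fin; use * in \<open>auto simp: seq_map_trunc cx_stratum[OF A] cx_is_body[OF A] cx_incl_Cod[OF A]
      min_def trunc_def[of N A, THEN arg_cong[where f = leg]]\<close>)+
qed

subsection \<open>The category of cell complexes\<close>

text \<open>In the definition of a morphism each map is the one induced on bodies by its predecessor.  Being the
  only map with the prescribed composites, it can be recognised by plain equations.\<close>

lemma CellCx_arrI:
  assumes "is_cell_complex U A" "is_cell_complex U B"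
    and "\<And>n. f n \<in> Hom T (cx_space A n) (cx_space B n)"
    and "\<And>n. p n \<in> cells (strat A n) \<rightarrow>\<^sub>E cells (strat B n)"
    and "\<And>n s. s \<in> cells (strat A n) \<Longrightarrow> kind (strat B n) (p n s) = kind (strat A n) s"
    and "\<And>n s. s \<in> cells (strat A n) \<Longrightarrow> f n \<cdot> att (strat A n) s = att (strat B n) (p n s)"
    and "\<And>n. f (Suc n) \<cdot> incl A n = incl B n \<cdot> f n"
    and "\<And>n s. s \<in> cells (strat A n) \<Longrightarrow> f (Suc n) \<cdot> chr A n s = chr B n (p n s)"
  shows "\<lparr>CxSrc = A, CxTgt = B, CxMap = f, CxCell = p\<rparr> \<in> Arr (CellCx U)"
proof -
  have m: "is_stratum_map U (strat A n) (strat B n) (f n) (p n)" for n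
    using assms(3-6) by (simp add: is_stratum_map_def cx_space_def)
  have "f (Suc n) = stratum_body_map U (strat A n) (incl A n) (chr A n) (incl B n) (chr B n) (f n) (p n)"
    for n
  proof (rule body_eqI[OF cx_is_body[OF assms(1), of n]])
    note h = stratum_body_map_props[OF cx_is_body[OF assms(1)] cx_is_body[OF assms(2)] m[of n]]
    show "f (Suc n) \<in> Hom T (Cod T (incl A n)) (cx_space B (Suc n))"
      using assms(3)[of "Suc n"] by (simp add: cx_incl_Cod[OF assms(1)])
    show "stratum_body_map U (strat A n) (incl A n) (chr A n) (incl B n) (chr B n) (f n) (p n)
        \<in> Hom T (Cod T (incl A n)) (cx_space B (Suc n))"
      using h(1) by (simp add: cx_incl_Cod[OF assms(2)])
    show "f (Suc n) \<cdot> incl A n =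
        stratum_body_map U (strat A n) (incl A n) (chr A n) (incl B n) (chr B n) (f n) (p n) \<cdot> incl A n"
      using h(2) assms(7) by simp
    show "f (Suc n) \<cdot> chr A n s =
        stratum_body_map U (strat A n) (incl A n) (chr A n) (incl B n) (chr B n) (f n) (p n) \<cdot> chr A n s"
      if "s \<in> cells (strat A n)" for s using h(3)[OF that] assms(8)[OF that] by simp
  qed
  then show ?thesis using assms(1,2) m by (simp add: CellCx_def)
qed

lemma CellCx_arr_simps:
  assumes "\<phi> \<in> Arr (CellCx U)"
  shows "is_cell_complex U (CxSrc \<phi>)" "is_cell_complex U (CxTgt \<phi>)"
    "CxMap \<phi> n \<in> Hom T (cx_space (CxSrc \<phi>) n) (cx_space (CxTgt \<phi>) n)"
    "CxCell \<phi> n \<in> cells (strat (CxSrc \<phi>) n) \<rightarrow>\<^sub>E cells (strat (CxTgt \<phi>) n)"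
    "s \<in> cells (strat (CxSrc \<phi>) n) \<Longrightarrow> CxCell \<phi> n s \<in> cells (strat (CxTgt \<phi>) n)"
    "s \<in> cells (strat (CxSrc \<phi>) n) \<Longrightarrow>
      kind (strat (CxTgt \<phi>) n) (CxCell \<phi> n s) = kind (strat (CxSrc \<phi>) n) s"
    "s \<in> cells (strat (CxSrc \<phi>) n) \<Longrightarrow>
      CxMap \<phi> n \<cdot> att (strat (CxSrc \<phi>) n) s = att (strat (CxTgt \<phi>) n) (CxCell \<phi> n s)"
    "CxMap \<phi> (Suc n) \<cdot> incl (CxSrc \<phi>) n = incl (CxTgt \<phi>) n \<cdot> CxMap \<phi> n"
    "s \<in> cells (strat (CxSrc \<phi>) n) \<Longrightarrow>
      CxMap \<phi> (Suc n) \<cdot> chr (CxSrc \<phi>) n s = chr (CxTgt \<phi>) n (CxCell \<phi> n s)"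
proof -
  have A: "is_cell_complex U (CxSrc \<phi>)" and B: "is_cell_complex U (CxTgt \<phi>)"
    and m: "is_stratum_map U (strat (CxSrc \<phi>) n) (strat (CxTgt \<phi>) n) (CxMap \<phi> n) (CxCell \<phi> n)"
    and e: "CxMap \<phi> (Suc n) = stratum_body_map U (strat (CxSrc \<phi>) n)
         (incl (CxSrc \<phi>) n) (chr (CxSrc \<phi>) n) (incl (CxTgt \<phi>) n) (chr (CxTgt \<phi>) n)
         (CxMap \<phi> n) (CxCell \<phi> n)"
    using assms by (simp_all add: CellCx_def)
  note h = stratum_body_map_props[OF cx_is_body[OF A] cx_is_body[OF B] m]
  show "is_cell_complex U (CxSrc \<phi>)" "is_cell_complex U (CxTgt \<phi>)" by fact+
  show "CxMap \<phi> n \<in> Hom T (cx_space (CxSrc \<phi>) n) (cx_space (CxTgt \<phi>) n)"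
    "CxCell \<phi> n \<in> cells (strat (CxSrc \<phi>) n) \<rightarrow>\<^sub>E cells (strat (CxTgt \<phi>) n)"
    using m by (simp_all add: is_stratum_map_def cx_space_def)
  show "CxMap \<phi> (Suc n) \<cdot> incl (CxSrc \<phi>) n = incl (CxTgt \<phi>) n \<cdot> CxMap \<phi> n"
    using h(2) e by simp
  assume s: "s \<in> cells (strat (CxSrc \<phi>) n)"
  show "CxMap \<phi> (Suc n) \<cdot> chr (CxSrc \<phi>) n s = chr (CxTgt \<phi>) n (CxCell \<phi> n s)"
    using h(3)[OF s] e by simp
  show "CxCell \<phi> n s \<in> cells (strat (CxTgt \<phi>) n)"
    "kind (strat (CxTgt \<phi>) n) (CxCell \<phi> n s) = kind (strat (CxSrc \<phi>) n) s"
    "CxMap \<phi> n \<cdot> att (strat (CxSrc \<phi>) n) s = att (strat (CxTgt \<phi>) n) (CxCell \<phi> n s)"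
    using m s by (auto simp: is_stratum_map_def)
qed

lemma CellCx_simps [simp]:
  "Obj (CellCx U) = {A. is_cell_complex U A}" "Dom (CellCx U) = CxSrc" "Cod (CellCx U) = CxTgt"
  by (simp_all add: CellCx_def)

lemma CellCx_category: "is_category (CellCx U)"
  unfolding is_category_def CellCx_simps mem_Collect_eq
proof (intro conjI ballI impI)
  fix f assume f: "f \<in> Arr (CellCx U)"
  note s = CellCx_arr_simps[OF f]
  show "is_cell_complex U (CxSrc f)" "is_cell_complex U (CxTgt f)" by (rule s)+
  have m: "CxMap f n \<cdot> id\<^sub>C (cx_space (CxSrc f) n) = CxMap f n"
    "id\<^sub>C (cx_space (CxTgt f) n) \<cdot> CxMap f n = CxMap f n" for n
    using unit_hom[OF s(3)] by auto
  have c: "compose (cells (strat (CxSrc f) n)) (CxCell f n) (restrict (\<lambda>s. s) (cells (strat (CxSrc f) n))) =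
      CxCell f n"
    "compose (cells (strat (CxSrc f) n)) (restrict (\<lambda>s. s) (cells (strat (CxTgt f) n))) (CxCell f n) =
      CxCell f n" for n
    using s(4)[of n] by (auto simp: compose_def fun_eq_iff PiE_iff extensional_def)
  show "Comp (CellCx U) f (Id (CellCx U) (CxSrc f)) = f"
    "Comp (CellCx U) (Id (CellCx U) (CxTgt f)) f = f"
    by (simp_all add: CellCx_def m c)
next
  fix A assume "A \<in> {A. is_cell_complex U A}"
  then have A: "is_cell_complex U A" by simp
  have "\<lparr>CxSrc = A, CxTgt = A, CxMap = (\<lambda>n. id\<^sub>C (cx_space A n)),
      CxCell = (\<lambda>n. restrict (\<lambda>s. s) (cells (strat A n)))\<rparr> \<in> Arr (CellCx U)"
    using A cx_hom[OF A] Hom_objs[OF cx_hom(1)[OF A]]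
    by (intro CellCx_arrI) (auto simp: unit_hom Hom_iff)
  then show "Id (CellCx U) A \<in> Hom (CellCx U) A A" by (simp add: CellCx_def Hom_def)
next
  fix f g assume f: "f \<in> Arr (CellCx U)" and g: "g \<in> Arr (CellCx U)" and fg: "CxSrc g = CxTgt f"
  note sf = CellCx_arr_simps[OF f] and sg = CellCx_arr_simps[OF g, unfolded fg]
  have "\<lparr>CxSrc = CxSrc f, CxTgt = CxTgt g, CxMap = (\<lambda>n. CxMap g n \<cdot> CxMap f n),
      CxCell = (\<lambda>n. compose (cells (strat (CxSrc f) n)) (CxCell g n) (CxCell f n))\<rparr> \<in> Arr (CellCx U)"
  proof (rule CellCx_arrI)
    fix n
    show "CxMap g n \<cdot> CxMap f n \<in> Hom T (cx_space (CxSrc f) n) (cx_space (CxTgt g) n)"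
      using sf(3) sg(3) by blast
    show "compose (cells (strat (CxSrc f) n)) (CxCell g n) (CxCell f n)
        \<in> cells (strat (CxSrc f) n) \<rightarrow>\<^sub>E cells (strat (CxTgt g) n)"
      using sf(5) sg(5) by (auto simp: compose_def)
    show "(CxMap g (Suc n) \<cdot> CxMap f (Suc n)) \<cdot> incl (CxSrc f) n =
        incl (CxTgt g) n \<cdot> CxMap g n \<cdot> CxMap f n"
    proof -
      have "(CxMap g (Suc n) \<cdot> CxMap f (Suc n)) \<cdot> incl (CxSrc f) n =
          CxMap g (Suc n) \<cdot> incl (CxTgt f) n \<cdot> CxMap f n"
        using sf(3)[of "Suc n"] sg(3)[of "Suc n"] sf(8)[of n] cx_hom(1)[OF sf(1), of n]
        by (simp add: Hom_iff)
      also have "\<dots> = incl (CxTgt g) n \<cdot> CxMap g n \<cdot> CxMap f n"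
        by (rule comp_cong[OF sg(8)[of n]])
          (use sf(3)[of n] sg(3)[of n] sg(3)[of "Suc n"] cx_hom(1)[OF sg(1), of n] cx_hom(1)[OF sg(2), of n]
            in \<open>auto simp: Hom_iff\<close>)
      finally show ?thesis .
    qed
    fix s assume s: "s \<in> cells (strat (CxSrc f) n)"
    show "kind (strat (CxTgt g) n) (compose (cells (strat (CxSrc f) n)) (CxCell g n) (CxCell f n) s) =
        kind (strat (CxSrc f) n) s"
      using sf(5,6)[OF s] sg(6) s by (simp add: compose_def)
    show "(CxMap g n \<cdot> CxMap f n) \<cdot> att (strat (CxSrc f) n) s = att (strat (CxTgt g) n)
        (compose (cells (strat (CxSrc f) n)) (CxCell g n) (CxCell f n) s)"
      using sf(5,7)[OF s] sg(7) s sf(3)[of n] sg(3)[of n] cx_hom(4)[OF sf(1) s]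
      by (simp add: compose_def Hom_iff)
    show "(CxMap g (Suc n) \<cdot> CxMap f (Suc n)) \<cdot> chr (CxSrc f) n s =
        chr (CxTgt g) n (compose (cells (strat (CxSrc f) n)) (CxCell g n) (CxCell f n) s)"
      using sf(5,9)[OF s] sg(9) s sf(3)[of "Suc n"] sg(3)[of "Suc n"] cx_hom(3)[OF sf(1) s]
      by (simp add: compose_def Hom_iff)
  qed (rule sf sg)+
  then show "Comp (CellCx U) g f \<in> Hom (CellCx U) (CxSrc f) (CxTgt g)"
    by (simp add: CellCx_def Hom_def)
next
  fix f g h assume f: "f \<in> Arr (CellCx U)" and g: "g \<in> Arr (CellCx U)" and h: "h \<in> Arr (CellCx U)"
    and fg: "CxSrc g = CxTgt f" "CxSrc h = CxTgt g"
  note sf = CellCx_arr_simps[OF f] and sg = CellCx_arr_simps[OF g, unfolded fg]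
    and sh = CellCx_arr_simps[OF h, unfolded fg]
  have m: "(CxMap h n \<cdot> CxMap g n) \<cdot> CxMap f n = CxMap h n \<cdot> CxMap g n \<cdot> CxMap f n" for n
    using sf(3)[of n] sg(3)[of n] sh(3)[of n] by (simp add: Hom_iff)
  have c: "compose (cells (strat (CxSrc f) n)) (CxCell h n)
        (compose (cells (strat (CxSrc f) n)) (CxCell g n) (CxCell f n)) =
      compose (cells (strat (CxSrc f) n)) (compose (cells (strat (CxTgt f) n)) (CxCell h n) (CxCell g n))
        (CxCell f n)" for n
    using sf(5)[of _ n] by (auto simp: compose_def fun_eq_iff)
  show "Comp (CellCx U) h (Comp (CellCx U) g f) = Comp (CellCx U) (Comp (CellCx U) h g) f"
    by (simp add: CellCx_def m c fg)
qed

lemma cx_body_map_props: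
  assumes \<phi>: "\<phi> \<in> Arr (CellCx U)"
  shows "cx_body_map U \<phi> \<in> Hom T (cx_body (CxSrc \<phi>)) (cx_body (CxTgt \<phi>))"
    "cx_body_map U \<phi> \<cdot> leg (CxSrc \<phi>) n = leg (CxTgt \<phi>) n \<cdot> CxMap \<phi> n"
    "h \<in> Hom T (cx_body (CxSrc \<phi>)) (cx_body (CxTgt \<phi>)) \<Longrightarrow>
      (\<And>n. h \<cdot> leg (CxSrc \<phi>) n = leg (CxTgt \<phi>) n \<cdot> CxMap \<phi> n) \<Longrightarrow> cx_body_map U \<phi> = h"
proof -
  note s = CellCx_arr_simps[OF \<phi>]
  define z where "z n = leg (CxTgt \<phi>) n \<cdot> CxMap \<phi> n" for n
  have z: "z n \<in> Hom T (cx_space (CxSrc \<phi>) n) (cx_body (CxTgt \<phi>))" for n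
    unfolding z_def using s(3) cx_hom(2)[OF s(2)] by blast
  have "z (Suc n) \<cdot> incl (CxSrc \<phi>) n = z n" for n
  proof -
    have "z (Suc n) \<cdot> incl (CxSrc \<phi>) n = leg (CxTgt \<phi>) (Suc n) \<cdot> incl (CxTgt \<phi>) n \<cdot> CxMap \<phi> n"
      using cx_hom(2)[OF s(2), of "Suc n"] cx_hom(1)[OF s(1), of n] s(3)[of "Suc n"] s(8)[of n]
      by (simp add: z_def Hom_iff)
    also have "\<dots> = z n" unfolding z_def
      by (rule comp_cong1[OF leg_incl[OF s(2)]])
        (use cx_hom(2)[OF s(2), of "Suc n"] cx_hom(1)[OF s(2), of n] s(3)[of n] in \<open>auto simp: Hom_iff\<close>)
    finally show ?thesis .
  qed
  then have ex: "\<exists>!h. h \<in> Hom T (cx_body (CxSrc \<phi>)) (cx_body (CxTgt \<phi>)) \<and>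
      (\<forall>n. h \<cdot> leg (CxSrc \<phi>) n = z n)"
    using seq_colimit_universal[OF cx_colimit[OF s(1)] Hom_objs(2)[OF z]] z by blast
  from theI'[OF ex] show "cx_body_map U \<phi> \<in> Hom T (cx_body (CxSrc \<phi>)) (cx_body (CxTgt \<phi>))"
    "cx_body_map U \<phi> \<cdot> leg (CxSrc \<phi>) n = leg (CxTgt \<phi>) n \<cdot> CxMap \<phi> n"
    by (simp_all add: cx_body_map_def z_def)
  assume "h \<in> Hom T (cx_body (CxSrc \<phi>)) (cx_body (CxTgt \<phi>))"
    "\<And>n. h \<cdot> leg (CxSrc \<phi>) n = leg (CxTgt \<phi>) n \<cdot> CxMap \<phi> n"
  then show "cx_body_map U \<phi> = h"
    using the1_equality[OF ex, of h] by (simp add: cx_body_map_def z_def)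
qed

lemma cx_body_map_cell:
  assumes \<phi>: "\<phi> \<in> Arr (CellCx U)" and c: "s \<in> cells (strat (CxSrc \<phi>) n)"
  shows "cx_body_map U \<phi> \<cdot> leg (CxSrc \<phi>) (Suc n) \<cdot> chr (CxSrc \<phi>) n s =
      leg (CxTgt \<phi>) (Suc n) \<cdot> chr (CxTgt \<phi>) n (CxCell \<phi> n s)"
    "cx_body_map U \<phi> \<cdot> leg (CxSrc \<phi>) n \<cdot> att (strat (CxSrc \<phi>) n) s =
      leg (CxTgt \<phi>) n \<cdot> att (strat (CxTgt \<phi>) n) (CxCell \<phi> n s)"
proof -
  note s = CellCx_arr_simps[OF \<phi>] and b = cx_body_map_props[OF \<phi>]
  note hom = b(1) cx_hom(2)[OF s(1), of n] cx_hom(2)[OF s(1), of "Suc n"] cx_hom(3,4)[OF s(1) c]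
    cx_hom(2)[OF s(2), of n] cx_hom(2)[OF s(2), of "Suc n"] s(3)[of n] s(3)[of "Suc n"]
  have "cx_body_map U \<phi> \<cdot> leg (CxSrc \<phi>) (Suc n) \<cdot> chr (CxSrc \<phi>) n s =
      leg (CxTgt \<phi>) (Suc n) \<cdot> CxMap \<phi> (Suc n) \<cdot> chr (CxSrc \<phi>) n s"
    by (rule comp_cong[OF b(2)]) (use hom in \<open>auto simp: Hom_iff\<close>)
  then show "cx_body_map U \<phi> \<cdot> leg (CxSrc \<phi>) (Suc n) \<cdot> chr (CxSrc \<phi>) n s =
      leg (CxTgt \<phi>) (Suc n) \<cdot> chr (CxTgt \<phi>) n (CxCell \<phi> n s)"
    using s(9)[OF c] by simp
  have "cx_body_map U \<phi> \<cdot> leg (CxSrc \<phi>) n \<cdot> att (strat (CxSrc \<phi>) n) s =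
      leg (CxTgt \<phi>) n \<cdot> CxMap \<phi> n \<cdot> att (strat (CxSrc \<phi>) n) s"
    by (rule comp_cong[OF b(2)]) (use hom in \<open>auto simp: Hom_iff\<close>)
  then show "cx_body_map U \<phi> \<cdot> leg (CxSrc \<phi>) n \<cdot> att (strat (CxSrc \<phi>) n) s =
      leg (CxTgt \<phi>) n \<cdot> att (strat (CxTgt \<phi>) n) (CxCell \<phi> n s)"
    using s(7)[OF c] by simp
qed

lemma cx_body_map_Id:
  assumes "is_cell_complex U A"
  shows "cx_body_map U (Id (CellCx U) A) = id\<^sub>C (cx_body A)"
proof -
  have "Id (CellCx U) A \<in> Arr (CellCx U)"
    using CellCx_category assms by (auto simp: is_category_def Hom_def)
  then show ?thesis
    using cx_hom(2)[OF assms] Hom_objs[OF cx_hom(2)[OF assms]]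
    by (intro cx_body_map_props(3)) (auto simp: CellCx_def unit_hom Hom_iff)
qed

lemma cx_body_map_Comp:
  assumes f: "f \<in> Arr (CellCx U)" and g: "g \<in> Arr (CellCx U)" and fg: "CxSrc g = CxTgt f"
  shows "cx_body_map U (Comp (CellCx U) g f) = cx_body_map U g \<cdot> cx_body_map U f"
proof (rule cx_body_map_props(3))
  note bf = cx_body_map_props[OF f] and bg = cx_body_map_props[OF g, unfolded fg]
  note sf = CellCx_arr_simps[OF f] and sg = CellCx_arr_simps[OF g, unfolded fg]
  show "Comp (CellCx U) g f \<in> Arr (CellCx U)"
    using CellCx_category f g fg by (auto simp: is_category_def Hom_def)
  have c: "CxSrc (Comp (CellCx U) g f) = CxSrc f" "CxTgt (Comp (CellCx U) g f) = CxTgt g"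
    "CxMap (Comp (CellCx U) g f) n = CxMap g n \<cdot> CxMap f n" for n
    by (simp_all add: CellCx_def)
  show "cx_body_map U g \<cdot> cx_body_map U f \<in> Hom T (cx_body (CxSrc (Comp (CellCx U) g f)))
      (cx_body (CxTgt (Comp (CellCx U) g f)))" unfolding c using bf(1) bg(1) by blast
  fix n
  have "(cx_body_map U g \<cdot> cx_body_map U f) \<cdot> leg (CxSrc f) n =
      cx_body_map U g \<cdot> leg (CxTgt f) n \<cdot> CxMap f n"
    using bf(1) bg(1) bf(2)[of n] cx_hom(2)[OF sf(1), of n] by (simp add: Hom_iff)
  also have "\<dots> = leg (CxTgt g) n \<cdot> CxMap g n \<cdot> CxMap f n"
    by (rule comp_cong[OF bg(2)[of n]])
      (use bg(1) cx_hom(2)[OF sg(1), of n] cx_hom(2)[OF sg(2), of n] sf(3)[of n] sg(3)[of n] in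
        \<open>auto simp: Hom_iff\<close>)
  finally show "(cx_body_map U g \<cdot> cx_body_map U f) \<cdot> leg (CxSrc (Comp (CellCx U) g f)) n =
      leg (CxTgt (Comp (CellCx U) g f)) n \<cdot> CxMap (Comp (CellCx U) g f) n"
    by (simp add: c)
qed

lemma CellCx_forget_simps [simp]:
  "is_cell_complex U A \<Longrightarrow> FObj (CellCx_forget U) A = leg A 0"
  "\<phi> \<in> Arr (CellCx U) \<Longrightarrow> FArr (CellCx_forget U) \<phi> =
    sq (leg (CxSrc \<phi>) 0) (leg (CxTgt \<phi>) 0) (CxMap \<phi> 0) (cx_body_map U \<phi>)"
  by (simp_all add: CellCx_forget_def)

lemma cx_arr_square:
  assumes \<phi>: "\<phi> \<in> Arr (CellCx U)"
  shows "square (leg (CxSrc \<phi>) 0) (leg (CxTgt \<phi>) 0) (CxMap \<phi> 0) (cx_body_map U \<phi>)"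
  using CellCx_arr_simps(3)[OF \<phi>, of 0] cx_body_map_props(1,2)[OF \<phi>]
    cx_hom(2)[OF CellCx_arr_simps(1)[OF \<phi>], of 0] cx_hom(2)[OF CellCx_arr_simps(2)[OF \<phi>], of 0]
  by (simp add: square_def Hom_iff)

end

sublocale spaces \<subseteq> CellCx: cat "CellCx U"
  by unfold_locales (rule CellCx_category)

context spaces
begin

lemma leg_simps:
  assumes "is_cell_complex U A"
  shows "leg A n \<in> Arr T" "Dom T (leg A n) = cx_space A n" "Cod T (leg A n) = cx_body A"
  using cx_hom(2)[OF assms, of n] by (auto simp: Hom_iff)

lemma forget_Comp:
  assumes "f \<in> Arr (CellCx U)" "g \<in> Arr (CellCx U)" "CxSrc g = CxTgt f"
  shows "FArr (CellCx_forget U) (Comp (CellCx U) g f) =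
    Comp (arrow_cat T) (FArr (CellCx_forget U) g) (FArr (CellCx_forget U) f)"
proof -
  have "Comp (CellCx U) g f \<in> Arr (CellCx U)" using CellCx.comp_simps(1) assms by simp
  moreover have "CxSrc (Comp (CellCx U) g f) = CxSrc f" "CxTgt (Comp (CellCx U) g f) = CxTgt g"
    "CxMap (Comp (CellCx U) g f) 0 = CxMap g 0 \<cdot> CxMap f 0"
    by (simp_all add: CellCx_def)
  ultimately show ?thesis
    using assms cx_body_map_Comp[OF assms] by simp
qed

lemma forget_Id:
  assumes "is_cell_complex U A"
  shows "FArr (CellCx_forget U) (Id (CellCx U) A) = Id (arrow_cat T) (leg A 0)"
proof -
  have "Id (CellCx U) A \<in> Arr (CellCx U)" using CellCx.id_simps(1) assms by simp
  moreover have "CxSrc (Id (CellCx U) A) = A" "CxTgt (Id (CellCx U) A) = A"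
    "CxMap (Id (CellCx U) A) 0 = id\<^sub>C (cx_space A 0)"
    by (simp_all add: CellCx_def)
  ultimately show ?thesis
    using cx_body_map_Id[OF assms] leg_simps[OF assms, of 0] by simp
qed

lemma stratum_composite_simps:
  assumes "is_stratum_composite U A P u c C a"
  shows "is_stratum U P" "is_body U P u c" "is_cell_complex U A" "is_cell_complex U C"
    "a \<in> Arr (CellCx U)" "CxSrc a = A" "CxTgt a = C" "cx_body_map U a = u"
    "leg C 0 = u \<cdot> leg A 0" "u \<in> Hom T (cx_body A) (cx_body C)" "Cod T u = cx_body C"
    "bdry P = cx_body A"
proof -
  have a: "a \<in> Hom (CellCx U) A C" and P: "is_stratum U P" "is_body U P u c" "bdry P = cx_body A"
    and forget: "FArr (CellCx_forget U) a = sq (leg A 0) (leg C 0) (id\<^sub>C (cx_boundary A)) u"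
    using assms by (auto simp: is_stratum_composite_def)
  show P': "is_stratum U P" "is_body U P u c" "bdry P = cx_body A" by fact+
  show a': "a \<in> Arr (CellCx U)" "CxSrc a = A" "CxTgt a = C" using a by (auto simp: CellCx.Hom_iff)
  show AC: "is_cell_complex U A" "is_cell_complex U C" using CellCx_arr_simps(1,2)[OF a'(1)] a' by auto
  show u: "cx_body_map U a = u" using forget a' by simp
  have "CxMap a 0 = id\<^sub>C (cx_boundary A)" using forget a' by simp
  then have "square (leg A 0) (leg C 0) (id\<^sub>C (Dom T (leg A 0))) u"
    using cx_arr_square[OF a'(1)] a' u leg_simps(2)[OF AC(1), of 0] by (simp add: cx_boundary_def)
  then show "leg C 0 = u \<cdot> leg A 0" by (rule square_id_comm)
  show "u \<in> Hom T (cx_body A) (cx_body C)" using cx_body_map_props(1)[OF a'(1)] a' u by simp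
  then show "Cod T u = cx_body C" by (simp add: Hom_iff)
qed

lemma stratum_composite_cells:
  assumes "is_stratum_composite U A P u c C a"
  shows "\<exists>j. \<forall>n. cells (strat C n) = CxCell a n ` cells (strat A n) \<union> j n ` level_cells U A P n \<and>
    (\<forall>t\<in>level_cells U A P n. kind (strat C n) (j n t) = kind P t \<and>
       (\<exists>g\<in>Hom T (bd_sphere U (kind P t)) (cx_space A n). leg A n \<cdot> g = att P t \<and>
         att (strat C n) (j n t) = CxMap a n \<cdot> g) \<and>
       leg C (Suc n) \<cdot> chr C n (j n t) = c t)"
  using assms unfolding is_stratum_composite_def
  by (elim conjE ex_forward) (rule allI, drule spec, elim conjE, intro conjI)

subsection \<open>Decomposing a cell complex into strata\<close>

text \<open>The attaching map and the characteristic map of a cell form a square from the inclusion of a sphere;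
  this square underlies a morphism of cell complexes.\<close>

definition cell_map :: "'u stratum \<Rightarrow> 'u top_arr \<Rightarrow> ('u \<Rightarrow> 'u top_arr) \<Rightarrow> 'u \<Rightarrow> 'u cx_arr" where
  "cell_map P u c s =
    \<lparr>CxSrc = cell_cx (kind P s),
     CxTgt = stratum_cx P u c,
     CxMap = (\<lambda>n. if n = 0 then att P s else c s),
     CxCell = (\<lambda>n. if n = 0 then restrict (\<lambda>_. s) {embed U (\<lambda>_. 0)} else (\<lambda>_. undefined))\<rparr>"

lemma cell_map:
  assumes P: "is_stratum U P" "is_body U P u c" and s: "s \<in> cells P"
  shows "cell_map P u c s \<in> Arr (CellCx U)" "cx_body_map U (cell_map P u c s) = c s"
proof -
  define k where "k = kind P s"
  note b = body_simps[OF P(2)]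
  have o: "bd_sphere U k \<in> Obj T" "disc U k \<in> Obj T" using Hom_objs[OF cell_incl_hom] by blast+
  have c: "cells (cell_stratum k) = {embed U (\<lambda>_. 0)}" "kind (cell_stratum k) (embed U (\<lambda>_. 0)) = k"
    "att (cell_stratum k) (embed U (\<lambda>_. 0)) = id\<^sub>C (bd_sphere U k)"
    "cell_chr k (embed U (\<lambda>_. 0)) = id\<^sub>C (disc U k)" "bdry (cell_stratum k) = bd_sphere U k"
    by (simp_all add: cell_stratum_def cell_chr_def)
  have att: "att P s \<in> Hom T (bd_sphere U k) (bdry P)" and chr: "c s \<in> Hom T (disc U k) (Cod T u)"
    and comm: "c s \<cdot> cell_incl U k = u \<cdot> att P s"
    using b(2,3,4)[OF s] by (simp_all add: k_def)
  have Cod: "Cod T u \<in> Obj T" using Hom_objs[OF b(1)] by blast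
  show arr: "cell_map P u c s \<in> Arr (CellCx U)"
    unfolding cell_map_def k_def[symmetric]
  proof (rule CellCx_arrI)
    show "is_cell_complex U (cell_cx k)"
      "is_cell_complex U (stratum_cx P u c)"
      using stratum_cx[OF cell_stratum] stratum_cx[OF P] by blast+
    fix n
    show "(if n = 0 then att P s else c s) \<in>
        Hom T (cx_space (cell_cx k) n)
          (cx_space (stratum_cx P u c) n)"
      using att chr c by (cases "n = 0") simp_all
    show "(if n = 0 then restrict (\<lambda>_. s) {embed U (\<lambda>_. 0)} else (\<lambda>_. undefined)) \<in>
        cells (strat (cell_cx k) n) \<rightarrow>\<^sub>E
        cells (strat (stratum_cx P u c) n)"
      using s c by (cases "n = 0") auto
    show "(if Suc n = 0 then att P s else c s) \<cdot>
          incl (cell_cx k) n =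
        incl (stratum_cx P u c) n \<cdot> (if n = 0 then att P s else c s)"
      using comm chr unit_hom[OF chr] by (cases "n = 0") simp_all
    fix x assume "x \<in> cells (strat (cell_cx k) n)"
    then have n: "n = 0" "x = embed U (\<lambda>_. 0)" by (cases n; simp add: c)+
    show "kind (strat (stratum_cx P u c) n)
        ((if n = 0 then restrict (\<lambda>_. s) {embed U (\<lambda>_. 0)} else (\<lambda>_. undefined)) x) =
      kind (strat (cell_cx k) n) x"
      using c(2) by (simp add: n flip: k_def)
    show "(if n = 0 then att P s else c s) \<cdot>
        att (strat (cell_cx k) n) x =
      att (strat (stratum_cx P u c) n)
        ((if n = 0 then restrict (\<lambda>_. s) {embed U (\<lambda>_. 0)} else (\<lambda>_. undefined)) x)"
      using unit_hom(1)[OF att] by (simp add: n c)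
    show "(if Suc n = 0 then att P s else c s) \<cdot>
        chr (cell_cx k) n x =
      chr (stratum_cx P u c) n
        ((if n = 0 then restrict (\<lambda>_. s) {embed U (\<lambda>_. 0)} else (\<lambda>_. undefined)) x)"
      using unit_hom(1)[OF chr] by (simp add: n c)
  qed
  show "cx_body_map U (cell_map P u c s) = c s"
  proof (rule cx_body_map_props(3)[OF arr])
    show "c s \<in> Hom T (cx_body (CxSrc (cell_map P u c s))) (cx_body (CxTgt (cell_map P u c s)))"
      using chr by (simp add: cell_map_def k_def)
    fix n show "c s \<cdot> leg (CxSrc (cell_map P u c s)) n =
        leg (CxTgt (cell_map P u c s)) n \<cdot> CxMap (cell_map P u c s) n"
      using comm unit_hom[OF chr] by (cases "n = 0") (simp_all add: cell_map_def k_def)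
  qed
qed

lemma leg_seq_map:
  assumes A: "is_cell_complex U A"
  shows "leg A (m + k) \<cdot> seq_map T (cx_space A) (incl A) m k = leg A m"
proof (induction k)
  case 0
  then show ?case using unit_hom(1)[OF cx_hom(2)[OF A]] by simp
next
  case (Suc k)
  note h = seq_map_hom[of "incl A" "cx_space A" m k, OF cx_hom(1)[OF A]]
  have "leg A (Suc (m + k)) \<cdot> incl A (m + k) \<cdot> seq_map T (cx_space A) (incl A) m k =
      leg A (m + k) \<cdot> seq_map T (cx_space A) (incl A) m k"
    using h cx_hom(1)[OF A, of "m + k"] cx_hom(2)[OF A, of "Suc (m + k)"]
    by (intro comp_cong1[OF leg_incl[OF A]]) (auto simp: Hom_iff)
  then show ?case using Suc by simp
qed

text \<open>Up to stage \<open>N\<close> this morphism consists of identities and afterwards of the composites of the sequence.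
  With \<open>min n N\<close> and with subtraction truncated at \<open>0\<close>, one formula covers both ranges.\<close>

definition trunc_map :: "nat \<Rightarrow> 'u cell_complex \<Rightarrow> 'u cx_arr" where
  "trunc_map N A =
    \<lparr>CxSrc = trunc N A, CxTgt = A,
     CxMap = (\<lambda>n. seq_map T (cx_space A) (incl A) (min n N) (n - N)),
     CxCell = (\<lambda>n. restrict (\<lambda>s. s) (cells (strat (trunc N A) n)))\<rparr>"

lemma trunc_map:
  assumes A: "is_cell_complex U A"
  shows "trunc_map N A \<in> Arr (CellCx U)" "cx_body_map U (trunc_map N A) = leg A N"
proof -
  have incl: "incl A n \<in> Hom T (cx_space A n) (cx_space A (Suc n))" for n by (rule cx_hom(1)[OF A])
  have h: "seq_map T (cx_space A) (incl A) (min n N) (n - N) \<in> Hom T (cx_space A (min n N)) (cx_space A n)"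
    for n
    using seq_map_hom[of "incl A" "cx_space A" "min n N" "n - N", OF incl]
    by (cases "n \<le> N") (simp_all add: min_def)
  have o: "cx_space A n \<in> Obj T" for n using Hom_objs[OF incl] by blast
  show arr: "trunc_map N A \<in> Arr (CellCx U)"
    unfolding trunc_map_def
  proof (rule CellCx_arrI)
    show "is_cell_complex U (trunc N A)" "is_cell_complex U A" by (rule trunc(1)[OF A] A)+
    fix n
    show "seq_map T (cx_space A) (incl A) (min n N) (n - N) \<in>
        Hom T (cx_space (trunc N A) n) (cx_space A n)"
      using h by simp
    show "restrict (\<lambda>s. s) (cells (strat (trunc N A) n)) \<in>
        cells (strat (trunc N A) n) \<rightarrow>\<^sub>E cells (strat A n)"
      by (cases "n < N") auto
    show "seq_map T (cx_space A) (incl A) (min (Suc n) N) (Suc n - N) \<cdot> incl (trunc N A) n =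
        incl A n \<cdot> seq_map T (cx_space A) (incl A) (min n N) (n - N)"
    proof (cases "n < N")
      case True
      then show ?thesis using unit_hom[OF incl[of n]] by (simp add: min_def)
    next
      case False
      have "seq_map T (cx_space A) (incl A) N (Suc n - N) \<in> Hom T (cx_space A N) (cx_space A (Suc n))"
        using h[of "Suc n"] False by (simp add: min_def)
      from unit_hom(1)[OF this] show ?thesis using False by (simp add: min_def Suc_diff_le)
    qed
    fix s assume s: "s \<in> cells (strat (trunc N A) n)"
    then have n: "n < N" by (cases "n < N") auto
    then show "kind (strat A n) (restrict (\<lambda>s. s) (cells (strat (trunc N A) n)) s) =
        kind (strat (trunc N A) n) s" using s by simp
    have s': "s \<in> cells (strat A n)" using s n by simp
    show "seq_map T (cx_space A) (incl A) (min n N) (n - N) \<cdot> att (strat (trunc N A) n) s =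
        att (strat A n) (restrict (\<lambda>s. s) (cells (strat (trunc N A) n)) s)"
      using s n unit_hom(2)[OF cx_hom(4)[OF A s']] by (simp add: min_def)
    show "seq_map T (cx_space A) (incl A) (min (Suc n) N) (Suc n - N) \<cdot> chr (trunc N A) n s =
        chr A n (restrict (\<lambda>s. s) (cells (strat (trunc N A) n)) s)"
      using s n unit_hom(2)[OF cx_hom(3)[OF A s']] by (simp add: min_def)
  qed
  show "cx_body_map U (trunc_map N A) = leg A N"
  proof (rule cx_body_map_props(3)[OF arr])
    show "leg A N \<in> Hom T (cx_body (CxSrc (trunc_map N A))) (cx_body (CxTgt (trunc_map N A)))"
      using cx_hom(2)[OF A] by (simp add: trunc_map_def trunc(2)[OF A])
    fix n
    have "leg A N \<cdot> leg (trunc N A) n = leg A n \<cdot> seq_map T (cx_space A) (incl A) (min n N) (n - N)"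
    proof (cases "n < N")
      case True
      then have "leg (trunc N A) n = seq_map T (cx_space A) (incl A) n (N - n)"
        by (simp add: trunc_def)
      then show ?thesis using leg_seq_map[OF A, of n "N - n"] unit_hom[OF cx_hom(2)[OF A, of n]] True
        by (simp add: min_def)
    next
      case False
      then show ?thesis using leg_seq_map[OF A, of N "n - N"] unit_hom[OF cx_hom(2)[OF A, of N]]
        by (simp add: min_def)
    qed
    then show "leg A N \<cdot> leg (CxSrc (trunc_map N A)) n =
        leg (CxTgt (trunc_map N A)) n \<cdot> CxMap (trunc_map N A) n"
      by (simp add: trunc_map_def)
  qed
qed

lemma trunc_trunc: "N \<le> M \<Longrightarrow> trunc N (trunc M A) = trunc N A"
proof -
  assume "N \<le> M"
  then have "n < N \<Longrightarrow> seq_map T (cx_space (trunc M A)) (incl (trunc M A)) n (N - n) =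
      seq_map T (cx_space A) (incl A) n (N - n)" for n
    by (intro seq_map_trunc) simp
  then show ?thesis using \<open>N \<le> M\<close> unfolding trunc_def[of N] by (auto simp: fun_eq_iff)
qed

lemma empty_stratum_composite:
  assumes D: "is_cell_complex U D"
  shows "is_stratum_composite U D (empty_stratum (cx_body D)) (id\<^sub>C (cx_body D)) (\<lambda>_. undefined) D
    (Id (CellCx U) D)"
proof -
  have o: "cx_body D \<in> Obj T" using Hom_objs[OF cx_hom(2)[OF D]] by blast
  have i: "Id (CellCx U) D \<in> Hom (CellCx U) D D" using D CellCx.id_simps by (simp add: CellCx.Hom_iff)
  have sel: "CxSrc (Id (CellCx U) D) = D" "CxTgt (Id (CellCx U) D) = D"
    "CxMap (Id (CellCx U) D) n = id\<^sub>C (cx_space D n)"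
    "CxCell (Id (CellCx U) D) n = restrict (\<lambda>s. s) (cells (strat D n))" for n
    by (simp_all add: CellCx_def)
  have "FArr (CellCx_forget U) (Id (CellCx U) D) =
      sq (leg D 0) (leg D 0) (id\<^sub>C (cx_boundary D)) (id\<^sub>C (cx_body D))"
    using i by (simp add: CellCx.Hom_iff sel cx_body_map_Id[OF D] cx_boundary_def)
  moreover have "level_cells U D (empty_stratum (cx_body D)) n = {}" for n
    by (simp add: level_cells_def)
  ultimately show ?thesis
    unfolding is_stratum_composite_def using empty_stratum[OF o] i
    by (auto simp: sel inj_on_def)
qed

text \<open>Properness of \<open>A\<close> says exactly that a cell of stratum \<open>n\<close> is not attached to an earlier stage, so on
  composition it returns to stratum \<open>n\<close>.\<close>

lemma level_cells_trunc:
  assumes A: "is_cell_complex U A"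
  shows "level_cells U (trunc n A) (strat A n) k = (if k = n then cells (strat A n) else {})"
proof -
  have f: "factors_through T (att (strat A n) t) (leg (trunc n A) m) \<longleftrightarrow> n \<le> m"
    if t: "t \<in> cells (strat A n)" for t m
  proof (cases "n \<le> m")
    case True
    have "att (strat A n) t = id\<^sub>C (cx_space A n) \<cdot> att (strat A n) t"
      using unit_hom(2)[OF cx_hom(4)[OF A t]] by simp
    moreover have "cx_space A n \<in> Obj T" using Hom_objs[OF cx_hom(4)[OF A t]] by blast
    moreover have "att (strat A n) t \<in> Hom T (Dom T (att (strat A n) t)) (cx_space A n)"
      using cx_hom(4)[OF A t] by (simp add: Hom_iff)
    ultimately have "\<exists>h\<in>Hom T (Dom T (att (strat A n) t)) (Dom T (id\<^sub>C (cx_space A n))).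
        att (strat A n) t = id\<^sub>C (cx_space A n) \<cdot> h"
      by (intro bexI[of _ "att (strat A n) t"]) simp_all
    then show ?thesis using True by (simp add: factors_through_def)
  next
    case False
    then have "leg (trunc n A) m = seq_map T (cx_space A) (incl A) m (n - m)" by (simp add: trunc_def)
    moreover have "\<not> factors_through T (att (strat A n) t) (seq_map T (cx_space A) (incl A) m (n - m))"
      using A t False by (simp add: is_cell_complex_def)
    ultimately show ?thesis using False by simp
  qed
  have "(LEAST m. n \<le> m) = n" by (rule Least_equality) auto
  then show ?thesis using f by (auto simp: level_cells_def)
qed

lemma trunc_Suc_stratum_composite:
  assumes A: "is_cell_complex U A"
  shows "is_stratum_composite U (trunc n A) (strat A n) (incl A n) (chr A n) (trunc (Suc n) A)
    (trunc_map n (trunc (Suc n) A))"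
proof -
  define D a where "D = trunc (Suc n) A" and "a = trunc_map n D"
  have D: "is_cell_complex U D" using trunc(1)[OF A] by (simp add: D_def)
  have tD: "trunc n D = trunc n A" by (simp add: D_def trunc_trunc)
  have incl: "incl A n \<in> Hom T (cx_space A n) (cx_space A (Suc n))" by (rule cx_hom(1)[OF A])
  have legD: "leg D n = incl A n" using unit_hom(1)[OF incl] by (simp add: D_def trunc_def)
  have a: "a \<in> Arr (CellCx U)" "CxSrc a = trunc n A" "CxTgt a = D" "cx_body_map U a = incl A n"
    "CxMap a k = seq_map T (cx_space D) (incl D) (min k n) (k - n)"
    "CxCell a k = restrict (\<lambda>s. s) (cells (strat (trunc n A) k))" for k
    using trunc_map[OF D, of n] tD legD by (simp_all add: a_def trunc_map_def)
  have mid: "CxMap a k = id\<^sub>C (cx_space A k)" if "k \<le> n" for k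
    using that by (simp add: a(5) min_def D_def)
  have "is_stratum_composite U (trunc n A) (strat A n) (incl A n) (chr A n) D a"
    unfolding is_stratum_composite_def
  \<comment> \<open>The new cells enter a stratum that was empty before, so they can keep their labels.\<close>
  proof (intro conjI exI[of _ "\<lambda>_ t. t"] allI)
    show "is_stratum U (strat A n)" "is_body U (strat A n) (incl A n) (chr A n)"
      by (rule cx_stratum[OF A] cx_is_body[OF A])+
    show "bdry (strat A n) = cx_body (trunc n A)" by (simp add: trunc(2)[OF A] cx_space_def)
    show "a \<in> Hom (CellCx U) (trunc n A) D" using a by (simp add: CellCx.Hom_iff)
    show "FArr (CellCx_forget U) a =
        sq (leg (trunc n A) 0) (leg D 0) (id\<^sub>C (cx_boundary (trunc n A))) (incl A n)"
      using a(1-4) mid[of 0] by (simp add: cx_boundary_def)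
    fix k
    show "inj_on (CxCell a k) (cells (strat (trunc n A) k))" by (simp add: a(6) inj_on_def)
    show "inj_on (\<lambda>t. t) (level_cells U (trunc n A) (strat A n) k)" by simp
    show "CxCell a k ` cells (strat (trunc n A) k) \<inter> (\<lambda>t. t) ` level_cells U (trunc n A) (strat A n) k = {}"
      by (cases "k < n") (auto simp: a(6) level_cells_trunc[OF A])
    show "cells (strat D k) = CxCell a k ` cells (strat (trunc n A) k) \<union>
        (\<lambda>t. t) ` level_cells U (trunc n A) (strat A n) k"
      by (cases k n rule: linorder_cases) (auto simp: a(6) level_cells_trunc[OF A] D_def)
    show "\<forall>t\<in>level_cells U (trunc n A) (strat A n) k.
        kind (strat D k) t = kind (strat A n) t \<and>
        (\<exists>g\<in>Hom T (bd_sphere U (kind (strat A n) t)) (cx_space (trunc n A) k).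
           leg (trunc n A) k \<cdot> g = att (strat A n) t \<and> att (strat D k) t = CxMap a k \<cdot> g) \<and>
        leg D (Suc k) \<cdot> chr D k t = chr A n t"
    proof
      fix t assume "t \<in> level_cells U (trunc n A) (strat A n) k"
      then have k: "k = n" and t: "t \<in> cells (strat A n)"
        by (auto simp: level_cells_trunc[OF A] split: if_splits)
      note att = cx_hom(4)[OF A t]
      have "\<exists>g\<in>Hom T (bd_sphere U (kind (strat A n) t)) (cx_space (trunc n A) k).
           leg (trunc n A) k \<cdot> g = att (strat A n) t \<and> att (strat D k) t = CxMap a k \<cdot> g"
        using att unit_hom(2)[OF att] mid[of n] by (intro bexI[of _ "att (strat A n) t"]) (simp_all add: k D_def)
      then show "kind (strat D k) t = kind (strat A n) t \<and>
        (\<exists>g\<in>Hom T (bd_sphere U (kind (strat A n) t)) (cx_space (trunc n A) k).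
           leg (trunc n A) k \<cdot> g = att (strat A n) t \<and> att (strat D k) t = CxMap a k \<cdot> g) \<and>
        leg D (Suc k) \<cdot> chr D k t = chr A n t"
        using unit_hom(2)[OF cx_hom(3)[OF A t]] by (simp add: k D_def)
    qed
  qed
  then show ?thesis by (simp add: D_def a_def)
qed

text \<open>Only the first stratum of the second complex has cells, so the sequence of composites is stationary
  after one step, and its colimit in \<open>CellCx\<close> is reached there.\<close>

lemma trunc_Suc_composite:
  assumes A: "is_cell_complex U A"
  shows "is_composite U (stratum_cx (strat A n) (incl A n) (chr A n)) (trunc n A) (trunc (Suc n) A)"
proof -
  define D a B where "D = trunc (Suc n) A" and "a = trunc_map n D"
    and "B = stratum_cx (strat A n) (incl A n) (chr A n)"
  have D: "is_cell_complex U D" "cx_body D = cx_space A (Suc n)" using trunc[OF A] by (simp_all add: D_def)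
  have cod: "Cod T (incl A n) = cx_space A (Suc n)" by (rule cx_incl_Cod[OF A])
  have B: "is_cell_complex U B" unfolding B_def by (rule stratum_cx[OF cx_stratum[OF A] cx_is_body[OF A]])
  have tA: "is_cell_complex U (trunc n A)" "cx_body (trunc n A) = cx_space A n" using trunc[OF A] by simp_all
  have comp: "is_stratum_composite U (trunc n A) (strat A n) (incl A n) (chr A n) D a"
    using trunc_Suc_stratum_composite[OF A] by (simp add: D_def a_def)
  note s = stratum_composite_simps[OF comp]
  define As as where "As m = (if m = 0 then trunc n A else D)"
    and "as m = (if m = 0 then a else Id (CellCx U) D)" for m :: nat
  have id: "Id (CellCx U) D \<in> Hom (CellCx U) D D" using D CellCx.id_simps by (simp add: CellCx.Hom_iff)
  have a: "a \<in> Hom (CellCx U) (trunc n A) D" using s(5-7) by (simp add: CellCx.Hom_iff)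
  have col: "is_seq_colimit (CellCx U) As as D as"
  proof (rule CellCx.seq_colimit_eventually_const[where N = 1])
    show "as m \<in> Hom (CellCx U) (As m) (As (Suc m))" "as m \<in> Hom (CellCx U) (As m) D" for m
      using a id by (simp_all add: As_def as_def)
    show "As m = D \<and> as m = Id (CellCx U) D \<and> as m = Id (CellCx U) D" if "1 \<le> m" for m
      using that by (simp add: As_def as_def)
    show "Comp (CellCx U) (as (Suc m)) (as m) = as m" for m
      using CellCx.unit_hom(2)[OF a] CellCx.unit_hom(2)[OF id] by (simp add: as_def)
  qed
  have strata: "is_stratum_composite U (As m) (strat B m) (incl B m) (chr B m) (As (Suc m)) (as m)" for m
    using comp empty_stratum_composite[OF D(1)] D(2) cod
    by (cases "m = 0") (simp_all add: As_def as_def B_def)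
  have forget: "FArr (CellCx_forget U) (as m) =
      sq (leg (As m) 0) (leg D 0) (id\<^sub>C (cx_boundary (trunc n A))) (leg B m)" for m
  proof (cases "m = 0")
    case True
    have "FArr (CellCx_forget U) a =
        sq (leg (trunc n A) 0) (leg D 0) (id\<^sub>C (cx_boundary (trunc n A))) (incl A n)"
      using comp by (simp add: is_stratum_composite_def)
    then show ?thesis using True by (simp add: As_def as_def B_def)
  next
    case False
    have "CxMap (Id (CellCx U) D) 0 = id\<^sub>C (cx_space D 0)" "CxSrc (Id (CellCx U) D) = D"
      "CxTgt (Id (CellCx U) D) = D" by (simp_all add: CellCx_def)
    then have "FArr (CellCx_forget U) (Id (CellCx U) D) =
        sq (leg D 0) (leg D 0) (id\<^sub>C (cx_space A 0)) (id\<^sub>C (cx_space A (Suc n)))"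
      using id by (simp add: CellCx.Hom_iff cx_body_map_Id[OF D(1)] D(2)) (simp add: D_def)
    then show ?thesis using False cod by (simp add: As_def as_def B_def cx_boundary_def)
  qed
  have "is_composite U B (trunc n A) D"
    unfolding is_composite_def
  proof (intro conjI exI[of _ As] exI[of _ as] allI)
    show "As 0 = trunc n A" by (simp add: As_def)
    show "cx_body (trunc n A) = cx_boundary B" by (simp add: tA B_def cx_space_def)
  qed (use tA B strata col forget in simp_all)
  then show ?thesis by (simp add: B_def D_def)
qed

end

section \<open>Cellular maps\<close>

text \<open>The family \<open>\<phi>\<close> stands for the functor from \<open>\<J>\<close> to left maps: on a discrete category a functor over the
  arrow category is a choice of left map structures.\<close>

locale generating_left_maps = spaces U + awfs_on "Top U" W for U :: "'u universe" and W +
  fixes \<phi> :: "nat \<Rightarrow> 'u top_arr"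
  assumes \<phi>: "\<And>n. left_map (cell_incl U n) (\<phi> n)"
begin

abbreviation cell_lift where "cell_lift n \<equiv> lift (cell_incl U n) (\<phi> n)"

text \<open>The square that is lifted on a cell \<open>s\<close> is read off from \<open>z\<close>: its upper side is \<open>z\<close> on the boundary of
  the cell, its lower side is \<open>R f \<circ> z\<close> on the cell.\<close>

definition cellular :: "'u cell_complex \<Rightarrow> 'u top_arr \<Rightarrow> 'u top_arr \<Rightarrow> bool" where
  "cellular A f z \<longleftrightarrow> f \<in> Arr T \<and> z \<in> Hom T (cx_body A) (Cod T (L f)) \<and>
    (\<forall>n. \<forall>s\<in>cells (strat A n). z \<cdot> leg A (Suc n) \<cdot> chr A n s =
       cell_lift (kind (strat A n) s) f (z \<cdot> leg A n \<cdot> att (strat A n) s)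
         (R f \<cdot> z \<cdot> leg A (Suc n) \<cdot> chr A n s))"

lemma cellular_simps:
  assumes "cellular A f z"
  shows "f \<in> Arr T" "z \<in> Hom T (cx_body A) (Cod T (L f))"
    "s \<in> cells (strat A n) \<Longrightarrow> z \<cdot> leg A (Suc n) \<cdot> chr A n s =
       cell_lift (kind (strat A n) s) f (z \<cdot> leg A n \<cdot> att (strat A n) s)
         (R f \<cdot> z \<cdot> leg A (Suc n) \<cdot> chr A n s)"
  using assms by (auto simp: cellular_def)

context
  fixes A assumes A: "is_cell_complex U A"
begin

lemma cell_square:
  assumes "f \<in> Arr T" "z \<in> Hom T (cx_body A) (Cod T (L f))" "s \<in> cells (strat A n)"
  shows "square (cell_incl U (kind (strat A n) s)) (R f)
    (z \<cdot> leg A n \<cdot> att (strat A n) s) (R f \<cdot> z \<cdot> leg A (Suc n) \<cdot> chr A n s)"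
  using assms leg_chr_cell_incl[OF A assms(3)] cx_hom(2)[OF A, of n] cx_hom(2)[OF A, of "Suc n"]
    cx_hom(3,4)[OF A assms(3)]
  by (simp add: square_def Hom_iff)

text \<open>On each cell, both sides are the chosen lift of the same square as soon as they agree on the
  earlier stages.\<close>

lemma cellular_eqI:
  assumes z: "cellular A f z" and z': "cellular A f z'"
    and base: "z \<cdot> leg A 0 = z' \<cdot> leg A 0" and R: "R f \<cdot> z = R f \<cdot> z'"
  shows "z = z'"
proof (rule cx_eqI[OF A cellular_simps(2)[OF z] cellular_simps(2)[OF z'] base])
  fix n s assume eq: "z \<cdot> leg A n = z' \<cdot> leg A n" and s: "s \<in> cells (strat A n)"
  note hom = cellular_simps(1,2)[OF z] cellular_simps(2)[OF z'] cx_hom(2)[OF A, of n]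
    cx_hom(2)[OF A, of "Suc n"] cx_hom(3,4)[OF A s]
  have "z \<cdot> leg A n \<cdot> att (strat A n) s = z' \<cdot> leg A n \<cdot> att (strat A n) s"
    by (rule comp_cong[OF eq]) (use hom in \<open>auto simp: Hom_iff\<close>)
  moreover have "R f \<cdot> z \<cdot> leg A (Suc n) \<cdot> chr A n s = R f \<cdot> z' \<cdot> leg A (Suc n) \<cdot> chr A n s"
    by (rule comp_cong[OF R]) (use hom in \<open>auto simp: Hom_iff\<close>)
  ultimately show "z \<cdot> leg A (Suc n) \<cdot> chr A n s = z' \<cdot> leg A (Suc n) \<cdot> chr A n s"
    using cellular_simps(3)[OF z s] cellular_simps(3)[OF z' s] by simp
qed

text \<open>Each stage is extended over its cells by the chosen lifts.  The invariant \<open>R f \<circ> z = y\<close> on the stages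
  built so far guarantees that there is a square to lift.\<close>

lemma cellular_exists:
  assumes f: "f \<in> Arr T" and sq: "square (leg A 0) (R f) x y"
  obtains z where "cellular A f z" "z \<cdot> leg A 0 = x" "R f \<cdot> z = y"
proof -
  note [simp] = square_simps[OF sq] f
  have x: "x \<in> Hom T (cx_boundary A) (Cod T (L f))" and y: "y \<in> Hom T (cx_body A) (Cod T f)"
    using square_simps[OF sq] cx_hom(2)[OF A, of 0] by (simp_all add: Hom_iff cx_boundary_def)
  define I where "I n z \<longleftrightarrow> R f \<cdot> z = y \<cdot> leg A n" for n z
  define E where "E n s z = cell_lift (kind (strat A n) s) f (z \<cdot> att (strat A n) s)
    (y \<cdot> leg A (Suc n) \<cdot> chr A n s)" for n s z
  have E: "square (cell_incl U (kind (strat A n) s)) (R f) (z \<cdot> att (strat A n) s)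
      (y \<cdot> leg A (Suc n) \<cdot> chr A n s)"
    if "z \<in> Hom T (cx_space A n) (Cod T (L f))" "I n z" "s \<in> cells (strat A n)" for n z s
  proof -
    note hom = that(1) cx_hom(2)[OF A, of n] cx_hom(2)[OF A, of "Suc n"] cx_hom(3,4)[OF A that(3)] y
    have "R f \<cdot> z \<cdot> att (strat A n) s = y \<cdot> leg A n \<cdot> att (strat A n) s"
      by (rule comp_cong[OF that(2)[unfolded I_def]]) (use hom in \<open>auto simp: Hom_iff\<close>)
    then show ?thesis using hom leg_chr_cell_incl[OF A that(3)] by (simp add: square_def Hom_iff)
  qed
  obtain h where h: "h \<in> Hom T (cx_body A) (Cod T (L f))" "h \<cdot> leg A 0 = x" "\<And>n. I n (h \<cdot> leg A n)"
    "\<And>n s. s \<in> cells (strat A n) \<Longrightarrow> h \<cdot> leg A (Suc n) \<cdot> chr A n s = E n s (h \<cdot> leg A n)"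
  proof (rule cx_recursion[OF A, of x "Cod T (L f)" I E])
    show "x \<in> Hom T (cx_boundary A) (Cod T (L f))" by (rule x)
    show "I 0 x" using square_comm[OF sq] by (simp add: I_def)
    show "E n s z \<in> Hom T (disc U (kind (strat A n) s)) (Cod T (L f)) \<and>
        E n s z \<cdot> cell_incl U (kind (strat A n) s) = z \<cdot> att (strat A n) s"
      if "z \<in> Hom T (cx_space A n) (Cod T (L f))" "I n z" "s \<in> cells (strat A n)" for n z s
      using lift_simps[OF \<phi> f E[OF that]] by (simp add: E_def Hom_iff)
    show "I (Suc n) z'"
      if z: "z \<in> Hom T (cx_space A n) (Cod T (L f))" "I n z"
        and z': "z' \<in> Hom T (cx_space A (Suc n)) (Cod T (L f))" "z' \<cdot> incl A n = z"
        and c: "\<And>s. s \<in> cells (strat A n) \<Longrightarrow> z' \<cdot> chr A n s = E n s z" for n z z'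
      unfolding I_def
    proof (rule body_eqI[OF cx_is_body[OF A, of n], of _ "Cod T f"])
      note hom = z(1) z'(1) y cx_hom(2)[OF A, of "Suc n"] cx_hom(1)[OF A, of n]
      show "R f \<cdot> z' \<in> Hom T (Cod T (incl A n)) (Cod T f)"
        "y \<cdot> leg A (Suc n) \<in> Hom T (Cod T (incl A n)) (Cod T f)"
        using hom by (simp_all add: cx_incl_Cod[OF A] Hom_iff)
      show "(R f \<cdot> z') \<cdot> incl A n = (y \<cdot> leg A (Suc n)) \<cdot> incl A n"
        using hom z(2) z'(2) by (simp add: I_def Hom_iff leg_incl[OF A])
      fix s assume s: "s \<in> cells (strat A n)"
      show "(R f \<cdot> z') \<cdot> chr A n s = (y \<cdot> leg A (Suc n)) \<cdot> chr A n s"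
        using lift_simps(5)[OF \<phi> f E[OF z s]] hom cx_hom(3)[OF A s] c[OF s]
        by (simp add: E_def Hom_iff)
    qed
  qed blast
  have R: "R f \<cdot> h = y"
  proof (rule seq_colimit_eqI[OF cx_colimit[OF A], of _ "Cod T f"])
    show "R f \<cdot> h \<in> Hom T (cx_body A) (Cod T f)" using h(1) by (simp add: Hom_iff)
    show "(R f \<cdot> h) \<cdot> leg A n = y \<cdot> leg A n" for n
      using h(1) h(3)[of n] cx_hom(2)[OF A, of n] by (simp add: Hom_iff I_def)
  qed (rule y)
  have "h \<cdot> leg A (Suc n) \<cdot> chr A n s =
       cell_lift (kind (strat A n) s) f (h \<cdot> leg A n \<cdot> att (strat A n) s)
         (R f \<cdot> h \<cdot> leg A (Suc n) \<cdot> chr A n s)" if s: "s \<in> cells (strat A n)" for n s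
  proof -
    note hom = h(1) cx_hom(2)[OF A, of n] cx_hom(2)[OF A, of "Suc n"] cx_hom(3,4)[OF A s]
    have "R f \<cdot> h \<cdot> leg A (Suc n) \<cdot> chr A n s = y \<cdot> leg A (Suc n) \<cdot> chr A n s"
      by (rule comp_cong1[OF R]) (use hom in \<open>auto simp: Hom_iff\<close>)
    then show ?thesis using h(4)[OF s] hom by (simp add: E_def Hom_iff)
  qed
  then have "cellular A f h" using h(1) by (simp add: cellular_def)
  then show ?thesis using that h(2) R by blast
qed

text \<open>Maps that carry chosen lifts to chosen lifts carry cellular maps to cellular maps.  The lower side of
  the new square is determined by the lift itself, which covers the twisted case of \<open>\<delta>\<close>.\<close>

lemma cellular_comp:
  assumes z: "cellular A f z" and g: "g \<in> Arr T" and t: "t \<in> Hom T (Cod T (L f)) (Cod T (L g))"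
    and lift: "\<And>n x y. square (cell_incl U n) (R f) x y \<Longrightarrow>
      t \<cdot> cell_lift n f x y = cell_lift n g (t \<cdot> x) (R g \<cdot> t \<cdot> cell_lift n f x y)"
  shows "cellular A g (t \<cdot> z)"
proof -
  note s = cellular_simps[OF z]
  have "(t \<cdot> z) \<cdot> leg A (Suc n) \<cdot> chr A n s =
       cell_lift (kind (strat A n) s) g ((t \<cdot> z) \<cdot> leg A n \<cdot> att (strat A n) s)
         (R g \<cdot> (t \<cdot> z) \<cdot> leg A (Suc n) \<cdot> chr A n s)" if c: "s \<in> cells (strat A n)" for n s
  proof -
    note hom = t s(1,2) cx_hom(2)[OF A, of n] cx_hom(2)[OF A, of "Suc n"] cx_hom(3,4)[OF A c]
    show ?thesis
      using lift[OF cell_square[OF s(1,2) c]] hom g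
      unfolding s(3)[OF c, symmetric] by (simp add: Hom_iff)
  qed
  then show ?thesis using t s(2) g by (auto simp: cellular_def)
qed

lemma cellular_M:
  assumes z: "cellular A f z" and ab: "square f g a b"
  shows "cellular A g (M f g a b \<cdot> z)"
proof (rule cellular_comp[OF z])
  note [simp] = square_simps[OF ab] M_simps[OF ab]
  show "g \<in> Arr T" "M f g a b \<in> Hom T (Cod T (L f)) (Cod T (L g))" by (simp_all add: Hom_iff)
  fix n x y assume sq: "square (cell_incl U n) (R f) x y"
  note [simp] = square_simps[OF sq] lift_simps[OF \<phi> square_simps(1)[OF ab] sq]
  have "R g \<cdot> M f g a b \<cdot> cell_lift n f x y = b \<cdot> y"
    using comp_cong[OF R_M[OF ab], of "cell_lift n f x y"] by simp
  then show "M f g a b \<cdot> cell_lift n f x y =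
      cell_lift n g (M f g a b \<cdot> x) (R g \<cdot> M f g a b \<cdot> cell_lift n f x y)"
    using M_lift[OF \<phi> sq ab] by simp
qed

lemma cellular_\<mu>_M:
  assumes z: "cellular A f z" and g: "g \<in> Arr T" and hb: "square f (R g) h b"
  shows "cellular A g ((\<mu> g \<cdot> M f (R g) h b) \<cdot> z)"
proof (rule cellular_comp[OF z])
  note [simp] = square_simps[OF hb] M_simps[OF hb] g
  show "g \<in> Arr T" "\<mu> g \<cdot> M f (R g) h b \<in> Hom T (Cod T (L f)) (Cod T (L g))"
    by (simp_all add: Hom_iff)
  fix n x y assume sq: "square (cell_incl U n) (R f) x y"
  note [simp] = square_simps[OF sq] lift_simps[OF \<phi> square_simps(1)[OF hb] sq]
  have "R g \<cdot> (\<mu> g \<cdot> M f (R g) h b) \<cdot> cell_lift n f x y =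
      R (R g) \<cdot> M f (R g) h b \<cdot> cell_lift n f x y"
    using comp_cong1[OF R_\<mu>[OF g], of "M f (R g) h b \<cdot> cell_lift n f x y"] by simp
  also have "\<dots> = b \<cdot> y"
    using comp_cong[OF R_M[OF hb], of "cell_lift n f x y"] by simp
  finally show "(\<mu> g \<cdot> M f (R g) h b) \<cdot> cell_lift n f x y =
      cell_lift n g ((\<mu> g \<cdot> M f (R g) h b) \<cdot> x) (R g \<cdot> (\<mu> g \<cdot> M f (R g) h b) \<cdot> cell_lift n f x y)"
    using \<mu>_M_lift[OF \<phi> sq hb square_simps(1)[OF hb] g] by simp
qed

lemma cellular_\<delta>:
  assumes z: "cellular A f z"
  shows "cellular A (L f) (\<delta> f \<cdot> z)"
proof (rule cellular_comp[OF z])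
  note f [simp] = cellular_simps(1)[OF z]
  show "L f \<in> Arr T" "\<delta> f \<in> Hom T (Cod T (L f)) (Cod T (L (L f)))" by (simp_all add: Hom_iff)
  fix n x y assume sq: "square (cell_incl U n) (R f) x y"
  note [simp] = square_simps[OF sq] lift_simps[OF \<phi> f sq]
  have "R (L f) \<cdot> \<delta> f \<cdot> cell_lift n f x y = cell_lift n f x y"
    using comp_cong1[OF R_\<delta>[OF f], of "cell_lift n f x y"] by simp
  then show "\<delta> f \<cdot> cell_lift n f x y =
      cell_lift n (L f) (\<delta> f \<cdot> x) (R (L f) \<cdot> \<delta> f \<cdot> cell_lift n f x y)"
    using \<delta>_lift[OF \<phi> f sq] by simp
qed

end

lemma cellular_pullback:
  assumes p: "p \<in> Arr (CellCx U)" and z: "cellular (CxTgt p) f z"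
  shows "cellular (CxSrc p) f (z \<cdot> cx_body_map U p)"
proof -
  define A B h where "A = CxSrc p" and "B = CxTgt p" and "h = cx_body_map U p"
  note sp = CellCx_arr_simps[OF p, folded A_def B_def] and bp = cx_body_map_props[OF p, folded A_def B_def h_def]
  note sz = cellular_simps[OF z, folded B_def]
  have "(z \<cdot> h) \<cdot> leg A (Suc n) \<cdot> chr A n s =
       cell_lift (kind (strat A n) s) f ((z \<cdot> h) \<cdot> leg A n \<cdot> att (strat A n) s)
         (R f \<cdot> (z \<cdot> h) \<cdot> leg A (Suc n) \<cdot> chr A n s)" if c: "s \<in> cells (strat A n)" for n s
  proof -
    define s' where "s' = CxCell p n s"
    have c': "s' \<in> cells (strat B n)" using sp(5)[OF c] by (simp add: s'_def)
    note hom = sz(1,2) bp(1) cx_hom(2)[OF sp(1), of n] cx_hom(2)[OF sp(1), of "Suc n"]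
      cx_hom(3,4)[OF sp(1) c] cx_hom(2)[OF sp(2), of n] cx_hom(2)[OF sp(2), of "Suc n"]
      cx_hom(3,4)[OF sp(2) c']
    note cell = cx_body_map_cell[OF p c[unfolded A_def], folded A_def B_def h_def s'_def]
    show ?thesis
      using hom sz(3)[OF c'] sp(6)[OF c] cell by (simp add: Hom_iff s'_def[symmetric])
  qed
  then have "cellular A f (z \<cdot> h)" using sz(1,2) bp(1) by (auto simp: cellular_def)
  then show ?thesis by (simp add: A_def h_def)
qed

section \<open>The left map underlying a cell complex\<close>

text \<open>The cellular filler of the square \<open>(L f, 1)\<close> from the underlying map \<open>f\<close> to \<open>R f\<close>.\<close>

definition cx_struct :: "'u cell_complex \<Rightarrow> 'u top_arr" where
  "cx_struct A = (THE \<alpha>. cellular A (leg A 0) \<alpha> \<and> \<alpha> \<cdot> leg A 0 = L (leg A 0) \<and>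
     R (leg A 0) \<cdot> \<alpha> = id\<^sub>C (cx_body A))"

lemma cx_struct_unique:
  assumes A: "is_cell_complex U A"
  shows "\<exists>!\<alpha>. cellular A (leg A 0) \<alpha> \<and> \<alpha> \<cdot> leg A 0 = L (leg A 0) \<and>
     R (leg A 0) \<cdot> \<alpha> = id\<^sub>C (cx_body A)"
proof -
  have f: "leg A 0 \<in> Arr T" "Cod T (leg A 0) = cx_body A"
    using cx_hom(2)[OF A, of 0] by (auto simp: Hom_iff)
  have sq: "square (leg A 0) (R (leg A 0)) (L (leg A 0)) (id\<^sub>C (cx_body A))"
    using unit_square[OF f(1)] f(2) by simp
  obtain z where z: "cellular A (leg A 0) z" "z \<cdot> leg A 0 = L (leg A 0)"
    "R (leg A 0) \<cdot> z = id\<^sub>C (cx_body A)"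
    using cellular_exists[OF A f(1) sq] .
  show ?thesis
  proof (rule ex1I[of _ z])
    show "cellular A (leg A 0) z \<and> z \<cdot> leg A 0 = L (leg A 0) \<and> R (leg A 0) \<cdot> z = id\<^sub>C (cx_body A)"
      by (intro conjI z)
    fix z' assume "cellular A (leg A 0) z' \<and> z' \<cdot> leg A 0 = L (leg A 0) \<and>
      R (leg A 0) \<cdot> z' = id\<^sub>C (cx_body A)"
    then have z': "cellular A (leg A 0) z'" "z' \<cdot> leg A 0 = z \<cdot> leg A 0"
      "R (leg A 0) \<cdot> z' = R (leg A 0) \<cdot> z" unfolding z(2,3) by blast+
    show "z' = z" by (rule cellular_eqI[OF A z'(1) z(1) z'(2,3)])
  qed
qed

lemma cx_struct_props:
  assumes A: "is_cell_complex U A"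
  shows "cellular A (leg A 0) (cx_struct A)" "cx_struct A \<cdot> leg A 0 = L (leg A 0)"
    "R (leg A 0) \<cdot> cx_struct A = id\<^sub>C (cx_body A)" "cx_struct A \<in> Hom T (cx_body A) (Cod T (L (leg A 0)))"
proof -
  note t = theI'[OF cx_struct_unique[OF A], folded cx_struct_def]
  show "cellular A (leg A 0) (cx_struct A)" "cx_struct A \<cdot> leg A 0 = L (leg A 0)"
    "R (leg A 0) \<cdot> cx_struct A = id\<^sub>C (cx_body A)"
    by (rule t[THEN conjunct1] t[THEN conjunct2, THEN conjunct1] t[THEN conjunct2, THEN conjunct2])+
  from cellular_simps(2)[OF this(1)] show "cx_struct A \<in> Hom T (cx_body A) (Cod T (L (leg A 0)))" .
qed

lemma cx_struct_eqI:
  assumes "is_cell_complex U A" "cellular A (leg A 0) \<alpha>" "\<alpha> \<cdot> leg A 0 = L (leg A 0)"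
    "R (leg A 0) \<cdot> \<alpha> = id\<^sub>C (cx_body A)"
  shows "cx_struct A = \<alpha>"
  unfolding cx_struct_def by (rule the1_equality[OF cx_struct_unique[OF assms(1)]]) (intro conjI assms)

text \<open>For coassociativity, \<open>\<delta> \<circ> \<alpha>\<close> and \<open>M(1, \<alpha>) \<circ> \<alpha>\<close> are cellular fillers of the same square from \<open>f\<close> to
  \<open>R (L f)\<close>: both restrict to \<open>L (L f)\<close> on the boundary, and both lie over \<open>\<alpha>\<close>.\<close>

lemma left_map_cx_struct:
  assumes A: "is_cell_complex U A"
  shows "left_map (leg A 0) (cx_struct A)"
proof -
  define f \<alpha> where "f = leg A 0" and "\<alpha> = cx_struct A"
  note s = cx_struct_props[OF A, folded f_def \<alpha>_def]
  note [simp] = leg_simps[OF A, of 0, folded f_def]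
  have [simp]: "cx_space A 0 \<in> Obj T" using obj(1)[of f] by simp
  have [simp]: "\<alpha> \<in> Arr T" "Dom T \<alpha> = cx_body A" "Cod T \<alpha> = Cod T (L f)"
    using s(4) by (auto simp: Hom_iff)
  have sq: "square f (L f) (id\<^sub>C (cx_space A 0)) \<alpha>" using s(2) by (simp add: square_def del: leg_simps)
  note [simp] = M_simps[OF sq]
  have "\<delta> f \<cdot> \<alpha> = M f (L f) (id\<^sub>C (cx_space A 0)) \<alpha> \<cdot> \<alpha>"
  proof (rule cellular_eqI[OF A cellular_\<delta>[OF A s(1)] cellular_M[OF A s(1) sq]])
    have "(\<delta> f \<cdot> \<alpha>) \<cdot> f = L (L f)" by (simp add: s(2) \<delta>_L)
    also have "\<dots> = (M f (L f) (id\<^sub>C (cx_space A 0)) \<alpha> \<cdot> \<alpha>) \<cdot> f"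
      using M_L[OF sq] by (simp add: s(2))
    finally show "(\<delta> f \<cdot> \<alpha>) \<cdot> leg A 0 = (M f (L f) (id\<^sub>C (cx_space A 0)) \<alpha> \<cdot> \<alpha>) \<cdot> leg A 0"
      by (simp add: f_def)
    have "R (L f) \<cdot> \<delta> f \<cdot> \<alpha> = \<alpha>"
      using comp_cong1[OF R_\<delta>, of f \<alpha>] by simp
    moreover have "R (L f) \<cdot> M f (L f) (id\<^sub>C (cx_space A 0)) \<alpha> \<cdot> \<alpha> = \<alpha>"
      using comp_cong[OF R_M[OF sq], of \<alpha>] by (simp add: s(3))
    ultimately show "R (L f) \<cdot> \<delta> f \<cdot> \<alpha> = R (L f) \<cdot> M f (L f) (id\<^sub>C (cx_space A 0)) \<alpha> \<cdot> \<alpha>" by simp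
  qed
  then show ?thesis using s by (simp add: left_map_def Hom_iff flip: f_def \<alpha>_def)
qed

text \<open>Both sides are cellular fillers of the same square from the source of \<open>p\<close> to \<open>R\<close> of its target.\<close>

lemma cx_struct_natural:
  assumes p: "p \<in> Arr (CellCx U)"
  shows "M (leg (CxSrc p) 0) (leg (CxTgt p) 0) (CxMap p 0) (cx_body_map U p) \<cdot> cx_struct (CxSrc p) =
    cx_struct (CxTgt p) \<cdot> cx_body_map U p"
proof -
  define A B a h where "A = CxSrc p" and "B = CxTgt p" and "a = CxMap p 0" and "h = cx_body_map U p"
  define f g where "f = leg A 0" and "g = leg B 0"
  have A: "is_cell_complex U A" and B: "is_cell_complex U B"
    using CellCx_arr_simps[OF p] by (simp_all add: A_def B_def)
  have sq: "square f g a h"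
    using cx_arr_square[OF p] by (simp add: A_def B_def f_def g_def a_def h_def)
  note sA = cx_struct_props[OF A, folded f_def] and sB = cx_struct_props[OF B, folded g_def]
  note [simp] = leg_simps[OF A, of 0, folded f_def] leg_simps[OF B, of 0, folded g_def]
    M_simps[OF sq] square_simps[OF sq] sA(4)[unfolded Hom_iff] sB(4)[unfolded Hom_iff]
  have "M f g a h \<cdot> cx_struct A = cx_struct B \<cdot> h"
  proof (rule cellular_eqI[OF A cellular_M[OF A sA(1) sq]])
    show "cellular A g (cx_struct B \<cdot> h)"
      using cellular_pullback[OF p] sB(1) unfolding A_def B_def h_def by blast
    have "(M f g a h \<cdot> cx_struct A) \<cdot> f = L g \<cdot> a" by (simp add: sA(2) M_L[OF sq])
    also have "\<dots> = cx_struct B \<cdot> h \<cdot> f"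
      using comp_cong1[OF sB(2), of a] square_comm[OF sq] by simp
    finally show "(M f g a h \<cdot> cx_struct A) \<cdot> leg A 0 = (cx_struct B \<cdot> h) \<cdot> leg A 0" by (simp add: f_def[symmetric])
    have "R g \<cdot> M f g a h \<cdot> cx_struct A = h"
      using comp_cong[OF R_M[OF sq], of "cx_struct A"] by (simp add: sA(3))
    moreover have "R g \<cdot> cx_struct B \<cdot> h = h"
      using comp_cong1[OF sB(3), of h] by simp
    ultimately show "R g \<cdot> M f g a h \<cdot> cx_struct A = R g \<cdot> cx_struct B \<cdot> h" by simp
  qed
  then show ?thesis unfolding A_def B_def f_def g_def a_def h_def .
qed

abbreviation lmap_of :: "'u top_arr \<Rightarrow> 'u top_arr \<Rightarrow> 'u top_arr lmap" where
  "lmap_of f \<alpha> \<equiv> (f, sq f (L f) (id\<^sub>C (Dom T f)) \<alpha>)"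

definition cx_lmap :: "'u cell_complex \<Rightarrow> 'u top_arr lmap" where
  "cx_lmap A = lmap_of (leg A 0) (cx_struct A)"

definition cx_functor ::
    "('u cell_complex, 'u cx_arr, 'u top_arr lmap, 'u top_arr lmap_arr) cat_functor" where
  "cx_functor =
    \<lparr>FObj = restrict cx_lmap (Obj (CellCx U)),
     FArr = restrict (\<lambda>p. (cx_lmap (CxSrc p), cx_lmap (CxTgt p), FArr (CellCx_forget U) p))
       (Arr (CellCx U))\<rparr>"

lemma cx_lmap_obj:
  assumes "is_cell_complex U A"
  shows "cx_lmap A \<in> Obj (LMap T W)"
  unfolding Obj_LMap_iff cx_lmap_def using left_map_cx_struct[OF assms] by blast

lemma cx_lmap_arr:
  assumes "p \<in> Arr (CellCx U)"
  shows "(cx_lmap (CxSrc p), cx_lmap (CxTgt p), FArr (CellCx_forget U) p) \<in> Arr (LMap T W)"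
proof (rule iffD2[OF LMap_arr_iff[OF left_map_cx_struct left_map_cx_struct cx_lmap_def cx_lmap_def]])
  show "\<exists>a b. FArr (CellCx_forget U) p = sq (leg (CxSrc p) 0) (leg (CxTgt p) 0) a b \<and>
      square (leg (CxSrc p) 0) (leg (CxTgt p) 0) a b \<and>
      M (leg (CxSrc p) 0) (leg (CxTgt p) 0) a b \<cdot> cx_struct (CxSrc p) = cx_struct (CxTgt p) \<cdot> b"
    using cx_arr_square[OF assms] cx_struct_natural[OF assms] CellCx_forget_simps(2)[OF assms] by blast
qed (rule CellCx_arr_simps[OF assms])+

lemma LMap_simps:
  "Dom (LMap T W) (P, Q, h) = P" "Cod (LMap T W) (P, Q, h) = Q"
  "Id (LMap T W) P = (P, P, Id (arrow_cat T) (fst P))"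
  "Comp (LMap T W) (P', Q', h') (P, Q, h) = (P, Q', Comp (arrow_cat T) h' h)"
  by (simp_all add: LMap_def coalg_cat_def)

lemma cx_functor_over:
  assumes "is_category (LMap T W)"
  shows "is_functor_over (CellCx U) (CellCx_forget U) (LMap T W) (LMap_forget T W) cx_functor"
proof -
  have "is_functor (CellCx U) (LMap T W) cx_functor"
    unfolding is_functor_def
  proof (intro conjI ballI impI)
    show "FObj cx_functor \<in> Obj (CellCx U) \<rightarrow>\<^sub>E Obj (LMap T W)"
      by (auto simp: cx_functor_def cx_lmap_obj)
    show "FArr cx_functor \<in> Arr (CellCx U) \<rightarrow>\<^sub>E Arr (LMap T W)"
      unfolding cx_functor_def using cx_lmap_arr by auto
    fix f assume f: "f \<in> Arr (CellCx U)"
    note sf = CellCx_arr_simps[OF f]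
    show "Dom (LMap T W) (FArr cx_functor f) = FObj cx_functor (Dom (CellCx U) f)"
      "Cod (LMap T W) (FArr cx_functor f) = FObj cx_functor (Cod (CellCx U) f)"
      using f sf(1,2) by (simp_all add: cx_functor_def LMap_simps)
    fix g assume g: "g \<in> Arr (CellCx U)" and fg: "Dom (CellCx U) g = Cod (CellCx U) f"
    have "Comp (CellCx U) g f \<in> Arr (CellCx U)" using CellCx.comp_simps(1) f g fg by simp
    moreover have "CxSrc (Comp (CellCx U) g f) = CxSrc f" "CxTgt (Comp (CellCx U) g f) = CxTgt g"
      by (simp_all add: CellCx_def)
    ultimately show "FArr cx_functor (Comp (CellCx U) g f) =
        Comp (LMap T W) (FArr cx_functor g) (FArr cx_functor f)"
      using f g fg by (simp add: cx_functor_def LMap_simps forget_Comp del: CellCx_forget_simps)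
  next
    fix A assume "A \<in> Obj (CellCx U)"
    then have A: "is_cell_complex U A" by simp
    have "Id (CellCx U) A \<in> Arr (CellCx U)" using CellCx.id_simps(1) A by simp
    moreover have "CxSrc (Id (CellCx U) A) = A" "CxTgt (Id (CellCx U) A) = A"
      by (simp_all add: CellCx_def)
    ultimately show "FArr cx_functor (Id (CellCx U) A) = Id (LMap T W) (FObj cx_functor A)"
      using A by (simp add: cx_functor_def LMap_simps forget_Id cx_lmap_def
          del: CellCx_forget_simps arrow_cat_simps)
  qed (rule CellCx_category assms)+
  moreover have "comp_functor (CellCx U) (LMap_forget T W) cx_functor = CellCx_forget U"
    unfolding comp_functor_def CellCx_forget_def
    using cx_lmap_obj cx_lmap_arr
    by (auto simp: cx_functor_def LMap_forget_def cx_lmap_def fun_eq_iff)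
  ultimately show ?thesis by (simp add: is_functor_over_def)
qed

text \<open>On a single cell the filler of \<open>(L k, 1)\<close> is the chosen lift of that square, hence the given
  structure.\<close>

lemma cx_struct_cell:
  "cx_struct (cell_cx n) = \<phi> n"
proof (rule cx_struct_eqI)
  note s = left_map_simps[OF \<phi>[of n]]
  note [simp] = s
  show cx: "is_cell_complex U (cell_cx n)"
    using cell_stratum stratum_cx by blast
  have c: "cells (cell_stratum n) = {embed U (\<lambda>_. 0)}" "kind (cell_stratum n) (embed U (\<lambda>_. 0)) = n"
    "att (cell_stratum n) (embed U (\<lambda>_. 0)) = id\<^sub>C (bd_sphere U n)"
    "cell_chr n (embed U (\<lambda>_. 0)) = id\<^sub>C (disc U n)"
    by (simp_all add: cell_stratum_def cell_chr_def)
  have [simp]: "disc U n \<in> Obj T" "bd_sphere U n \<in> Obj T"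
    using Hom_objs[OF cell_incl_hom] by auto
  show "cellular (cell_cx n)
     (leg (cell_cx n) 0) (\<phi> n)"
    unfolding cellular_def
  proof (intro conjI allI ballI)
    fix k s assume "s \<in> cells (strat (cell_cx n) k)"
    then have "k = 0" "s = embed U (\<lambda>_. 0)" by (cases k; simp add: c)+
    then show "\<phi> n \<cdot> leg (cell_cx n) (Suc k) \<cdot>
        chr (cell_cx n) k s =
       cell_lift (kind (strat (cell_cx n) k) s)
        (leg (cell_cx n) 0)
        (\<phi> n \<cdot> leg (cell_cx n) k \<cdot>
          att (strat (cell_cx n) k) s)
        (R (leg (cell_cx n) 0) \<cdot> \<phi> n \<cdot>
          leg (cell_cx n) (Suc k) \<cdot>
          chr (cell_cx n) k s)"
      using lift_self[OF \<phi>[of n]] by (simp add: c)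
  qed (simp_all add: Hom_iff)
  show "\<phi> n \<cdot> leg (cell_cx n) 0 =
      L (leg (cell_cx n) 0)"
    "R (leg (cell_cx n) 0) \<cdot> \<phi> n =
      id\<^sub>C (cx_body (cell_cx n))"
    by simp_all
qed

section \<open>Composites of cell complexes\<close>

text \<open>The structure of \<open>P * A\<close> is cellular with respect to the cells of \<open>P\<close>.  The filler \<open>\<gamma>\<close> that continues it
  from the body of \<open>A\<close> by lifting the cells of \<open>P\<close> is cellular on the composite: a cell of the composite
  comes either from \<open>A\<close>, where \<open>\<gamma>\<close> agrees with the structure, or from \<open>P\<close>, where \<open>\<gamma>\<close> is a lift by
  construction.  By uniqueness \<open>\<gamma>\<close> is the structure itself.\<close>

lemma cx_struct_stratum_composite:
  assumes comp: "is_stratum_composite U A P u c C a" and t: "t \<in> cells P"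
  shows "cx_struct C \<cdot> c t = cell_lift (kind P t) (leg C 0) (cx_struct C \<cdot> u \<cdot> att P t) (c t)"
proof -
  note s = stratum_composite_simps[OF comp]
  define B f where "B = stratum_cx P u c" and "f = leg C 0"
  have B: "is_cell_complex U B" unfolding B_def by (rule stratum_cx[OF s(1,2)])
  have bodyB: "cx_body B = cx_body C" "leg B 0 = u" using s(11) by (simp_all add: B_def)
  note sC = cx_struct_props[OF s(4), folded f_def] and lC = leg_simps[OF s(4), of 0, folded f_def]
  have u: "u \<in> Arr T" "Dom T u = cx_body A" "Cod T u = cx_body C" using s(10) by (auto simp: Hom_iff)
  have "R f \<cdot> cx_struct C \<cdot> u = u"
    using comp_cong1[OF sC(3), of u] sC(4) lC u Hom_objs(1)[OF sC(4)] by (simp add: Hom_iff)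
  then have sq: "square u (R f) (cx_struct C \<cdot> u) (id\<^sub>C (cx_body C))"
    using sC(4) lC u Hom_objs(1)[OF sC(4)] by (simp add: square_def Hom_iff)
  obtain \<gamma> where \<gamma>: "cellular B f \<gamma>" "\<gamma> \<cdot> u = cx_struct C \<cdot> u" "R f \<cdot> \<gamma> = id\<^sub>C (cx_body C)"
    using cellular_exists[OF B lC(1), of "cx_struct C \<cdot> u" "id\<^sub>C (cx_body C)"] sq bodyB(2) by auto
  have \<gamma>_hom: "\<gamma> \<in> Hom T (cx_body C) (Cod T (L f))" using cellular_simps(2)[OF \<gamma>(1)] bodyB by simp
  have cell: "\<gamma> \<cdot> c t = cell_lift (kind P t) f (\<gamma> \<cdot> u \<cdot> att P t) (c t)" if t: "t \<in> cells P" for t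
  proof -
    note b = body_simps[OF s(2)]
    have "id\<^sub>C (cx_body C) \<cdot> c t = c t" using unit_hom(2)[OF b(2)[OF t]] s(11) by simp
    moreover have "R f \<cdot> \<gamma> \<cdot> c t = id\<^sub>C (cx_body C) \<cdot> c t"
      using \<gamma>(3) lC b(2)[OF t] \<gamma>_hom s(11) by (intro comp_cong1) (auto simp: Hom_iff)
    ultimately show ?thesis
      using cellular_simps(3)[OF \<gamma>(1), of t 0] t s(11) by (simp add: B_def)
  qed
  have swap: "\<gamma> \<cdot> u \<cdot> x = cx_struct C \<cdot> u \<cdot> x" if "x \<in> Hom T X (cx_body A)" for x X
    using \<gamma>(2) \<gamma>_hom sC(4) u that by (intro comp_cong) (auto simp: Hom_iff)
  obtain j where j: "\<And>n. cells (strat C n) = CxCell a n ` cells (strat A n) \<union> j n ` level_cells U A P n"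
    "\<And>n t. t \<in> level_cells U A P n \<Longrightarrow> kind (strat C n) (j n t) = kind P t \<and>
       (\<exists>g\<in>Hom T (bd_sphere U (kind P t)) (cx_space A n). leg A n \<cdot> g = att P t \<and>
         att (strat C n) (j n t) = CxMap a n \<cdot> g) \<and>
       leg C (Suc n) \<cdot> chr C n (j n t) = c t"
    using stratum_composite_cells[OF comp]
    by (elim exE, intro that)
      (drule spec, erule conjunct1, drule spec, drule conjunct2, drule bspec, assumption, assumption)
  have "cellular C f \<gamma>"
    unfolding cellular_def
  proof (intro conjI allI ballI)
    show "f \<in> Arr T" "\<gamma> \<in> Hom T (cx_body C) (Cod T (L f))" by (rule lC \<gamma>_hom)+
    fix n x assume x: "x \<in> cells (strat C n)"
    then consider x' where "x' \<in> cells (strat A n)" "x = CxCell a n x'"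
      | t where "t \<in> level_cells U A P n" "x = j n t" using j(1) by auto
    then show "\<gamma> \<cdot> leg C (Suc n) \<cdot> chr C n x = cell_lift (kind (strat C n) x) f
        (\<gamma> \<cdot> leg C n \<cdot> att (strat C n) x) (R f \<cdot> \<gamma> \<cdot> leg C (Suc n) \<cdot> chr C n x)"
    proof cases
      case 1
      note m = cx_body_map_cell[OF s(5), unfolded s(6,7,8), OF 1(1), folded 1(2), symmetric]
      have "leg A (Suc n) \<cdot> chr A n x' \<in> Hom T (disc U (kind (strat A n) x')) (cx_body A)"
        "leg A n \<cdot> att (strat A n) x' \<in> Hom T (bd_sphere U (kind (strat A n) x')) (cx_body A)"
        using cx_hom[OF s(3)] 1(1) by blast+
      then show ?thesis
        using cellular_simps(3)[OF sC(1) x] by (simp only: m swap)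
    next
      case 2
      then have t: "t \<in> cells P" by (simp add: level_cells_def)
      obtain g where g: "g \<in> Hom T (bd_sphere U (kind P t)) (cx_space A n)" "leg A n \<cdot> g = att P t"
        "att (strat C n) x = CxMap a n \<cdot> g" using j(2)[OF 2(1)] 2(2) by blast
      have k: "kind (strat C n) x = kind P t" "leg C (Suc n) \<cdot> chr C n x = c t"
        using j(2)[OF 2(1)] 2(2) by simp_all
      have "leg C n \<cdot> CxMap a n \<cdot> g = u \<cdot> leg A n \<cdot> g"
        using cx_body_map_props(2)[OF s(5), of n] s(6,7,8) u g(1) leg_simps[OF s(3), of n]
          leg_simps[OF s(4), of n] CellCx_arr_simps(3)[OF s(5), of n]
        by (intro comp_cong) (auto simp: Hom_iff)
      then have "leg C n \<cdot> att (strat C n) x = u \<cdot> att P t" using g by simp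
      moreover have "R f \<cdot> \<gamma> \<cdot> c t = c t"
      proof -
        note b = body_simps(2)[OF s(2) t]
        have "R f \<cdot> \<gamma> \<cdot> c t = id\<^sub>C (cx_body C) \<cdot> c t"
          using \<gamma>(3) lC b \<gamma>_hom s(11) by (intro comp_cong1) (auto simp: Hom_iff)
        then show ?thesis using unit_hom(2)[OF b] s(11) by simp
      qed
      ultimately show ?thesis using cell[OF t] k by simp
    qed
  qed
  moreover have "\<gamma> \<cdot> f = cx_struct C \<cdot> f"
    using swap[OF cx_hom(2)[OF s(3), of 0]] s(9) by (simp add: f_def)
  moreover have "R f \<cdot> \<gamma> = R f \<cdot> cx_struct C" using \<gamma>(3) sC(3) by simp
  ultimately have "\<gamma> = cx_struct C"
    using cellular_eqI[OF s(4), of f \<gamma> "cx_struct C"] sC(1) unfolding f_def by blast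
  then show ?thesis using cell[OF t] by (simp add: f_def)
qed

text \<open>On the \<open>m\<close>-th space of \<open>B\<close>, which is the body of the \<open>m\<close>-th partial composite, naturality expresses the
  structure of \<open>C\<close> by that of the partial composite.  The latter is obtained by lifting on the cells of
  the stratum composed last, and \<open>M(1, leg B m)\<close> preserves lifts.\<close>

lemma composite_cellular:
  assumes "is_composite U B A C"
  shows "leg C 0 = leg B 0 \<cdot> leg A 0" "cx_body C = cx_body B" "is_cell_complex U C"
    "cellular B (leg C 0) (cx_struct C)"
    "cx_struct C \<cdot> leg B 0 = M (leg A 0) (leg C 0) (id\<^sub>C (cx_boundary A)) (leg B 0) \<cdot> cx_struct A"
proof -
  obtain As as ks where As: "As 0 = A"
    "\<And>m. is_stratum_composite U (As m) (strat B m) (incl B m) (chr B m) (As (Suc m)) (as m)"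
    "is_seq_colimit (CellCx U) As as C ks"
    "\<And>m. FArr (CellCx_forget U) (ks m) =
       sq (leg (As m) 0) (leg C 0) (id\<^sub>C (cx_boundary A)) (leg B m)"
    and A: "is_cell_complex U A" and B: "is_cell_complex U B"
    using assms unfolding is_composite_def by auto
  have k: "ks m \<in> Arr (CellCx U)" "CxSrc (ks m) = As m" "CxTgt (ks m) = C" for m
    using CellCx.seq_colimit_simps(3)[OF As(3), of m] by (auto simp: CellCx.Hom_iff)
  have b: "cx_body_map U (ks m) = leg B m" "CxMap (ks m) 0 = id\<^sub>C (cx_boundary A)" for m
    using As(4)[of m] k[of m] by simp_all
  show C: "is_cell_complex U C" using CellCx_arr_simps(2)[OF k(1)] k(3) by simp
  have bh: "leg B m \<in> Hom T (cx_body (As m)) (cx_body C)" for m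
    using cx_body_map_props(1)[OF k(1), of m] k b by simp
  then show body: "cx_body C = cx_body B" using leg_simps(3)[OF B, of 0] by (auto simp: Hom_iff)
  have sqk: "square (leg (As m) 0) (leg C 0) (id\<^sub>C (cx_boundary A)) (leg B m)" for m
    using cx_arr_square[OF k(1), of m] k b by simp
  have nat: "M (leg (As m) 0) (leg C 0) (id\<^sub>C (cx_boundary A)) (leg B m) \<cdot> cx_struct (As m) = cx_struct C \<cdot> leg B m" for m
    using cx_struct_natural[OF k(1), of m] k b by simp
  show "cx_struct C \<cdot> leg B 0 = M (leg A 0) (leg C 0) (id\<^sub>C (cx_boundary A)) (leg B 0) \<cdot> cx_struct A"
    using nat[of 0] As(1) by simp
  show "leg C 0 = leg B 0 \<cdot> leg A 0"
    using sqk[of 0] As(1) leg_simps(2)[OF A, of 0]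
    by (intro square_id_comm) (simp add: cx_boundary_def)
  note sC = cx_struct_props[OF C] and lC = leg_simps[OF C, of 0]
  show "cellular B (leg C 0) (cx_struct C)"
    unfolding cellular_def
  proof (intro conjI allI ballI)
    show "leg C 0 \<in> Arr T" "cx_struct C \<in> Hom T (cx_body B) (Cod T (L (leg C 0)))"
      using lC sC(4) body by simp_all
    fix m t assume t: "t \<in> cells (strat B m)"
    note sm = stratum_composite_simps[OF As(2)[of m]]
    define f g D N where "f = leg (As (Suc m)) 0" and "g = leg C 0" and "D = As (Suc m)"
      and "N = M (leg (As (Suc m)) 0) (leg C 0) (id\<^sub>C (cx_boundary A)) (leg B (Suc m))"
    have D: "is_cell_complex U D" using sm(4) by (simp add: D_def)
    note sD = cx_struct_props[OF D, folded f_def[folded D_def]]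
    have sq: "square f g (id\<^sub>C (cx_boundary A)) (leg B (Suc m))"
      using sqk[of "Suc m"] by (simp add: f_def g_def)
    have N: "N \<in> Arr T" "Dom T N = Cod T (L f)" "Cod T N = Cod T (L g)"
      using M_simps[OF sq] by (simp_all add: N_def f_def g_def)
    have NsD: "N \<cdot> cx_struct D = cx_struct C \<cdot> leg B (Suc m)"
      using nat[of "Suc m"] by (simp add: N_def D_def)
    have "f = leg D 0" by (simp add: f_def D_def)
    note hom = N sD(4)[folded \<open>f = leg D 0\<close>] sC(4) leg_simps[OF B, of m] leg_simps[OF B, of "Suc m"]
      cx_hom(3,4)[OF B t] cx_hom(1)[OF B, of m] bh[of "Suc m", folded D_def] lC
      leg_simps[OF D, of 0, folded \<open>f = leg D 0\<close>] body
    have R: "R f \<cdot> cx_struct D \<cdot> chr B m t = chr B m t"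
    proof -
      have "R f \<cdot> cx_struct D \<cdot> chr B m t = id\<^sub>C (cx_body D) \<cdot> chr B m t"
        by (rule comp_cong1[OF sD(3)[folded \<open>f = leg D 0\<close>]]) (use hom in \<open>auto simp: Hom_iff\<close>)
      then show ?thesis using hom unit_hom(2)[of "chr B m t"] by (auto simp: Hom_iff)
    qed
    have R': "R (leg C 0) \<cdot> cx_struct C \<cdot> leg B (Suc m) \<cdot> chr B m t = leg B (Suc m) \<cdot> chr B m t"
    proof -
      have "R (leg C 0) \<cdot> cx_struct C \<cdot> leg B (Suc m) \<cdot> chr B m t = id\<^sub>C (cx_body C) \<cdot> leg B (Suc m) \<cdot> chr B m t"
        by (rule comp_cong1[OF sC(3)]) (use hom in \<open>auto simp: Hom_iff\<close>)
      then show ?thesis using hom unit_hom(2)[of "leg B (Suc m) \<cdot> chr B m t"] by (auto simp: Hom_iff)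
    qed
    have x: "cx_struct D \<cdot> incl B m \<cdot> att (strat B m) t \<in> Hom T (bd_sphere U (kind (strat B m) t)) (Cod T (L f))"
      using hom by (auto simp: Hom_iff)
    have sq2: "square (cell_incl U (kind (strat B m) t)) (R f) (cx_struct D \<cdot> incl B m \<cdot> att (strat B m) t)
      (chr B m t)"
    proof -
      have "R f \<cdot> cx_struct D \<cdot> incl B m \<cdot> att (strat B m) t =
          id\<^sub>C (cx_body D) \<cdot> incl B m \<cdot> att (strat B m) t"
        by (rule comp_cong1[OF sD(3)[folded \<open>f = leg D 0\<close>]]) (use hom in \<open>auto simp: Hom_iff\<close>)
      then show ?thesis using hom x chr_cell_incl[OF B t] by (auto simp: square_def Hom_iff)
    qed
    have "cx_struct C \<cdot> leg B (Suc m) \<cdot> chr B m t = N \<cdot> cx_struct D \<cdot> chr B m t"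
      by (rule comp_cong[OF NsD[symmetric]]) (use hom in \<open>auto simp: Hom_iff\<close>)
    also have "\<dots> = N \<cdot> cell_lift (kind (strat B m) t) f (cx_struct D \<cdot> incl B m \<cdot> att (strat B m) t) (chr B m t)"
      using cx_struct_stratum_composite[OF As(2) t] by (simp add: D_def f_def)
    also have "\<dots> = cell_lift (kind (strat B m) t) g (N \<cdot> cx_struct D \<cdot> incl B m \<cdot> att (strat B m) t)
        (leg B (Suc m) \<cdot> chr B m t)"
      using M_lift[OF \<phi> sq2 sq] by (simp add: N_def f_def g_def)
    also have "N \<cdot> cx_struct D \<cdot> incl B m \<cdot> att (strat B m) t =
        cx_struct C \<cdot> leg B (Suc m) \<cdot> incl B m \<cdot> att (strat B m) t"
      by (rule comp_cong[OF NsD]) (use hom in \<open>auto simp: Hom_iff\<close>)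
    also have "leg B (Suc m) \<cdot> incl B m \<cdot> att (strat B m) t = leg B m \<cdot> att (strat B m) t"
      by (rule comp_cong1[OF leg_incl[OF B]]) (use hom in \<open>auto simp: Hom_iff\<close>)
    finally show "cx_struct C \<cdot> leg B (Suc m) \<cdot> chr B m t = cell_lift (kind (strat B m) t) (leg C 0)
        (cx_struct C \<cdot> leg B m \<cdot> att (strat B m) t) (R (leg C 0) \<cdot> cx_struct C \<cdot> leg B (Suc m) \<cdot> chr B m t)"
      using R' by (simp add: g_def)
  qed
qed

text \<open>Both structures are cellular over \<open>B\<close>, the composite one because it is the image of the structure of
  \<open>B\<close> under an extension to a free algebra.\<close>

lemma cx_lmap_composite:
  assumes comp: "is_composite U B A C"
  shows "cx_lmap C = LMap_comp T W (cx_lmap A) (cx_lmap B)"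
proof -
  have A: "is_cell_complex U A" and B: "is_cell_complex U B" and AB: "cx_body A = cx_boundary B"
    using comp by (auto simp: is_composite_def)
  note c = composite_cellular[OF comp]
  define f g \<alpha> \<beta> where "f = leg A 0" and "g = leg B 0" and "\<alpha> = cx_struct A" and "\<beta> = cx_struct B"
  have lA: "left_map f \<alpha>" and lB: "left_map g \<beta>"
    using left_map_cx_struct A B by (simp_all add: f_def g_def \<alpha>_def \<beta>_def)
  have fg: "Dom T g = Cod T f" using leg_simps[OF A, of 0] leg_simps[OF B, of 0] AB
    by (simp add: f_def g_def cx_boundary_def)
  have C: "leg C 0 = g \<cdot> f" using c(1) by (simp add: f_def g_def)
  note sq = composite_square[OF lA left_map_simps(1)[OF lB] fg]
  have gf: "g \<cdot> f \<in> Arr T" using left_map_simps(1)[OF lA] left_map_simps(1)[OF lB] fg by simp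
  define h where "h = M f (g \<cdot> f) (id\<^sub>C (Dom T f)) g \<cdot> \<alpha>"
  have bd: "cx_boundary A = Dom T f" "Cod T g = cx_body C"
    using leg_simps[OF A, of 0] leg_simps[OF B, of 0] c(2) by (simp_all add: f_def g_def cx_boundary_def)
  have "cx_struct C = lift g \<beta> (g \<cdot> f) h (id\<^sub>C (Cod T g))"
  proof (rule cellular_eqI[OF B, of "g \<cdot> f"])
    note l = lift_simps[OF lB gf sq[folded h_def]]
    show "cellular B (g \<cdot> f) (cx_struct C)" using c(4) C by simp
    have "lift g \<beta> (g \<cdot> f) h (id\<^sub>C (Cod T g)) = (\<mu> (g \<cdot> f) \<cdot> M g (R (g \<cdot> f)) h (id\<^sub>C (Cod T g))) \<cdot> \<beta>"
      using M_simps[OF sq[folded h_def]] left_map_simps[OF lB] gf by (simp add: lift_def)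
    then show "cellular B (g \<cdot> f) (lift g \<beta> (g \<cdot> f) h (id\<^sub>C (Cod T g)))"
      using cellular_\<mu>_M[OF B, of g \<beta> "g \<cdot> f" h "id\<^sub>C (Cod T g)"] cx_struct_props(1)[OF B] gf sq
      by (simp add: g_def \<beta>_def h_def)
    show "cx_struct C \<cdot> leg B 0 = lift g \<beta> (g \<cdot> f) h (id\<^sub>C (Cod T g)) \<cdot> leg B 0"
      using l(4) c(5) C bd by (simp add: h_def g_def[symmetric] f_def[symmetric] \<alpha>_def[symmetric])
    show "R (g \<cdot> f) \<cdot> cx_struct C = R (g \<cdot> f) \<cdot> lift g \<beta> (g \<cdot> f) h (id\<^sub>C (Cod T g))"
      using l(5) cx_struct_props(3)[OF c(3)] C bd by simp
  qed
  then show ?thesis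
    using LMap_comp_eq[OF lA lB fg] C left_map_simps(1)[OF lA] left_map_simps(1)[OF lB] fg
    by (simp add: cx_lmap_def f_def g_def \<alpha>_def \<beta>_def h_def)
qed

section \<open>Uniqueness\<close>

context
  fixes H :: "('u cell_complex, 'u cx_arr, 'u top_arr lmap, 'u top_arr lmap_arr) cat_functor"
  assumes H: "is_functor_over (CellCx U) (CellCx_forget U) (LMap T W) (LMap_forget T W) H"
    and eta: "\<And>n. FObj H (eta_obj U n) = lmap_of (cell_incl U n) (\<phi> n)"
    and pres: "preserves_composition U W H"
begin

definition H_struct :: "'u cell_complex \<Rightarrow> 'u top_arr" where
  "H_struct A = SqCod (snd (FObj H A))"

lemma H_obj:
  assumes A: "is_cell_complex U A"
  shows "FObj H A = lmap_of (leg A 0) (H_struct A)" "left_map (leg A 0) (H_struct A)"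
proof -
  have o: "FObj H A \<in> Obj (LMap T W)"
    using H A by (auto simp: is_functor_over_def is_functor_def)
  have "FObj (comp_functor (CellCx U) (LMap_forget T W) H) A = leg A 0"
    using H A by (simp add: is_functor_over_def)
  then have "fst (FObj H A) = leg A 0"
    using A o by (simp add: comp_functor_def LMap_forget_def)
  moreover obtain f \<alpha> where f: "FObj H A = lmap_of f \<alpha>" "left_map f \<alpha>"
    using o unfolding Obj_LMap_iff by blast
  ultimately have "f = leg A 0" "H_struct A = \<alpha>" by (simp_all add: H_struct_def)
  then show "FObj H A = lmap_of (leg A 0) (H_struct A)" "left_map (leg A 0) (H_struct A)" using f by simp_all
qed

lemma H_arr:
  assumes p: "p \<in> Arr (CellCx U)"
  shows "FArr H p = (FObj H (CxSrc p), FObj H (CxTgt p), FArr (CellCx_forget U) p)"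
    "M (leg (CxSrc p) 0) (leg (CxTgt p) 0) (CxMap p 0) (cx_body_map U p) \<cdot> H_struct (CxSrc p) =
      H_struct (CxTgt p) \<cdot> cx_body_map U p"
proof -
  note s = CellCx_arr_simps(1,2)[OF p]
  have a: "FArr H p \<in> Arr (LMap T W)" "Dom (LMap T W) (FArr H p) = FObj H (CxSrc p)"
    "Cod (LMap T W) (FArr H p) = FObj H (CxTgt p)"
    using H p by (auto simp: is_functor_over_def is_functor_def)
  obtain P Q h where PQ: "FArr H p = (P, Q, h)" by (cases "FArr H p")
  have "FArr (comp_functor (CellCx U) (LMap_forget T W) H) p = FArr (CellCx_forget U) p"
    using H by (simp add: is_functor_over_def)
  then have "h = FArr (CellCx_forget U) p"
    using p a(1) PQ by (simp add: comp_functor_def LMap_forget_def)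
  then show e: "FArr H p = (FObj H (CxSrc p), FObj H (CxTgt p), FArr (CellCx_forget U) p)"
    using a(2,3) PQ by (simp add: LMap_simps)
  obtain a b where "FArr (CellCx_forget U) p = sq (leg (CxSrc p) 0) (leg (CxTgt p) 0) a b"
    "M (leg (CxSrc p) 0) (leg (CxTgt p) 0) a b \<cdot> H_struct (CxSrc p) = H_struct (CxTgt p) \<cdot> b"
    using a(1)[unfolded e] LMap_arr_iff[OF H_obj(2)[OF s(1)] H_obj(2)[OF s(2)] H_obj(1)[OF s(1)] H_obj(1)[OF s(2)]]
    by blast
  then show "M (leg (CxSrc p) 0) (leg (CxTgt p) 0) (CxMap p 0) (cx_body_map U p) \<cdot> H_struct (CxSrc p) =
      H_struct (CxTgt p) \<cdot> cx_body_map U p"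
    using p by simp
qed

text \<open>Naturality at the morphism that includes the cell as a copy of a complex \<open>\<eta> \<kappa>\<close>.\<close>

lemma H_struct_stratum:
  assumes P: "is_stratum U P" "is_body U P u c" and s: "s \<in> cells P"
  shows "square (cell_incl U (kind P s)) u (att P s) (c s)"
    "H_struct (stratum_cx P u c) \<cdot> c s = M (cell_incl U (kind P s)) u (att P s) (c s) \<cdot> \<phi> (kind P s)"
proof -
  note m = cell_map[OF P s]
  have sel: "CxSrc (cell_map P u c s) = eta_obj U (kind P s)" "CxTgt (cell_map P u c s) = stratum_cx P u c"
    "CxMap (cell_map P u c s) 0 = att P s"
    by (simp_all add: cell_map_def eta_obj_eq)
  have l: "leg (eta_obj U n) 0 = cell_incl U n" for n by (simp add: eta_obj_eq)
  have h: "H_struct (eta_obj U n) = \<phi> n" for n by (simp add: H_struct_def eta)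
  show "square (cell_incl U (kind P s)) u (att P s) (c s)"
    using cx_arr_square[OF m(1)] by (simp add: sel l m(2))
  show "H_struct (stratum_cx P u c) \<cdot> c s = M (cell_incl U (kind P s)) u (att P s) (c s) \<cdot> \<phi> (kind P s)"
    using H_arr(2)[OF m(1)] by (simp add: sel l h m(2))
qed

text \<open>The cells of stratum \<open>n\<close> are first seen in the truncation \<open>D\<close> of \<open>A\<close> to \<open>n + 1\<close> strata, which is the
  composite of a truncation \<open>E\<close> with the stratum \<open>B\<close>.  The formula for composite left maps, restricted to
  a cell, is a lift of that cell in \<open>D\<close>; naturality at the inclusion of \<open>D\<close> carries it to \<open>A\<close>.\<close>

lemma cellular_H_struct:
  assumes A: "is_cell_complex U A"
  shows "cellular A (leg A 0) (H_struct A)"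
proof -
  have Ah: "H_struct A \<in> Hom T (cx_body A) (Cod T (L (leg A 0)))"
    using left_map_simps[OF H_obj(2)[OF A]] leg_simps[OF A, of 0] by (simp add: Hom_iff)
  have "H_struct A \<cdot> leg A (Suc n) \<cdot> chr A n s =
       cell_lift (kind (strat A n) s) (leg A 0) (H_struct A \<cdot> leg A n \<cdot> att (strat A n) s)
         (R (leg A 0) \<cdot> H_struct A \<cdot> leg A (Suc n) \<cdot> chr A n s)" if s: "s \<in> cells (strat A n)" for n s
  proof -
    define D E B u k where "D = trunc (Suc n) A" and "E = trunc n A"
      and "B = stratum_cx (strat A n) (incl A n) (chr A n)" and "u = incl A n"
      and "k = kind (strat A n) s"
    define d where "d = leg D 0"
    have D: "is_cell_complex U D" "cx_body D = cx_space A (Suc n)" and E: "is_cell_complex U E"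
      using trunc[OF A] by (simp_all add: D_def E_def)
    have B: "is_cell_complex U B"
      unfolding B_def by (rule stratum_cx[OF cx_stratum[OF A] cx_is_body[OF A]])
    have uB: "leg B 0 = u" by (simp add: B_def u_def)
    have comp: "is_composite U B E D"
      using trunc_Suc_composite[OF A] by (simp add: B_def E_def D_def)
    have du: "d = u \<cdot> leg E 0" using composite_cellular(1)[OF comp] uB by (simp add: d_def)
    note lE = H_obj(2)[OF E] and lB = H_obj(2)[OF B, unfolded uB] and lD = H_obj(2)[OF D(1), folded d_def]
      and lA = H_obj(2)[OF A]
    have fg: "Dom T u = Cod T (leg E 0)"
      using comp leg_simps[OF E, of 0] leg_simps[OF B, of 0] uB
      by (simp add: is_composite_def cx_boundary_def)
    define x where "x = M (leg E 0) (u \<cdot> leg E 0) (id\<^sub>C (Dom T (leg E 0))) u \<cdot> H_struct E"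
    \<comment> \<open>The formula for composites presents the structure of \<open>D\<close> as a lift of the left map on \<open>B\<close>.\<close>
    have "FObj H D = LMap_comp T W (FObj H E) (FObj H B)"
      using pres comp by (simp add: preserves_composition_def)
    then have hD: "H_struct D = lift u (H_struct B) d x (id\<^sub>C (Cod T u))"
      using LMap_comp_eq[OF lE lB fg] H_obj(1)[OF E] H_obj(1)[OF B] du
      by (simp add: H_struct_def[of D] uB x_def)
    note sqx = composite_square[OF lE left_map_simps(1)[OF lB] fg, folded x_def du]
    note dArr = left_map_simps(1)[OF lD]
    have hDu: "H_struct D \<cdot> u = x" unfolding hD by (rule lift_simps(4)[OF lB dArr sqx])
    note cs = H_struct_stratum[OF cx_stratum[OF A] cx_is_body[OF A] s, folded u_def k_def B_def[folded u_def]]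
    note sqc = square_comp[OF cs(1) sqx]
    note t = left_map_simps[OF lB] M_simps[OF sqx] square_simps[OF sqx] left_map_simps[OF \<phi>[of k]]
      square_simps[OF cs(1)] M_simps[OF cs(1)] M_simps[OF sqc]
    have cod: "Cod T u = cx_body D" using D(2) cx_incl_Cod[OF A] by (simp add: u_def)
    have chr_id: "id\<^sub>C (Cod T u) \<cdot> chr A n s = chr A n s"
      using t by simp
    have "H_struct D \<cdot> chr A n s = \<mu> d \<cdot> M u (R d) x (id\<^sub>C (Cod T u)) \<cdot> H_struct B \<cdot> chr A n s"
      unfolding hD lift_def using t dArr by simp
    also have "\<dots> = \<mu> d \<cdot> M u (R d) x (id\<^sub>C (Cod T u)) \<cdot> M (cell_incl U k) u (att (strat A n) s) (chr A n s) \<cdot> \<phi> k"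
      using cs(2) by (simp add: B_def u_def)
    also have "\<dots> = \<mu> d \<cdot> M (cell_incl U k) (R d) (x \<cdot> att (strat A n) s) (chr A n s) \<cdot> \<phi> k"
      using comp_cong1[OF M_comp[OF cs(1) sqx], of "\<phi> k"] t chr_id by simp
    finally have hDc: "H_struct D \<cdot> chr A n s = cell_lift k d (x \<cdot> att (strat A n) s) (chr A n s)"
      by (simp add: lift_def)
    \<comment> \<open>It remains to carry the lift from \<open>D\<close> to \<open>A\<close>.\<close>
    have sqc': "square (cell_incl U k) (R d) (x \<cdot> att (strat A n) s) (chr A n s)"
      using sqc chr_id by simp
    note tm = trunc_map[OF A, of "Suc n"]
    have tms: "CxSrc (trunc_map (Suc n) A) = D" "CxTgt (trunc_map (Suc n) A) = A"
      by (simp_all add: trunc_map_def D_def)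
    define a where "a = CxMap (trunc_map (Suc n) A) 0"
    have sqA: "square d (leg A 0) a (leg A (Suc n))"
      using cx_arr_square[OF tm(1)] by (simp add: tms tm(2) d_def a_def)
    have nat: "M d (leg A 0) a (leg A (Suc n)) \<cdot> H_struct D = H_struct A \<cdot> leg A (Suc n)"
      using H_arr(2)[OF tm(1)] by (simp add: tms tm(2) d_def a_def)
    note hom = cx_hom(3,4)[OF A s] cx_hom(1)[OF A, of n] leg_simps[OF A] Ah
      left_map_simps[OF lD] left_map_simps[OF lA] M_simps[OF sqA] square_simps[OF sqA] cod
      leg_simps[OF D(1), of 0, folded d_def]
    have "H_struct A \<cdot> leg A (Suc n) \<cdot> chr A n s = M d (leg A 0) a (leg A (Suc n)) \<cdot> H_struct D \<cdot> chr A n s"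
      by (rule comp_cong[OF nat[symmetric]]) (use hom D(2) in \<open>auto simp: Hom_iff\<close>)
    also have "\<dots> = cell_lift k (leg A 0) (M d (leg A 0) a (leg A (Suc n)) \<cdot> x \<cdot> att (strat A n) s)
        (leg A (Suc n) \<cdot> chr A n s)"
      unfolding hDc by (rule M_lift[OF \<phi> sqc' sqA])
    also have "M d (leg A 0) a (leg A (Suc n)) \<cdot> x \<cdot> att (strat A n) s = H_struct A \<cdot> leg A n \<cdot> att (strat A n) s"
    proof -
      have "x \<cdot> att (strat A n) s = H_struct D \<cdot> u \<cdot> att (strat A n) s"
        unfolding hDu[symmetric] using hom D(2) by (simp add: Hom_iff u_def)
      moreover have "M d (leg A 0) a (leg A (Suc n)) \<cdot> H_struct D \<cdot> u \<cdot> att (strat A n) s =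
          H_struct A \<cdot> leg A (Suc n) \<cdot> u \<cdot> att (strat A n) s"
        by (rule comp_cong[OF nat]) (use hom D(2) in \<open>auto simp: Hom_iff u_def\<close>)
      moreover have "leg A (Suc n) \<cdot> u \<cdot> att (strat A n) s = leg A n \<cdot> att (strat A n) s"
        unfolding u_def by (rule comp_cong1[OF leg_incl[OF A]]) (use hom in \<open>auto simp: Hom_iff\<close>)
      ultimately show ?thesis by simp
    qed
    finally have main: "H_struct A \<cdot> leg A (Suc n) \<cdot> chr A n s =
        cell_lift k (leg A 0) (H_struct A \<cdot> leg A n \<cdot> att (strat A n) s) (leg A (Suc n) \<cdot> chr A n s)" .
    have lc: "leg A (Suc n) \<cdot> chr A n s \<in> Hom T (disc U k) (cx_body A)"
      using hom by (simp add: Hom_iff k_def)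
    have "R (leg A 0) \<cdot> H_struct A \<cdot> leg A (Suc n) \<cdot> chr A n s =
        id\<^sub>C (Cod T (leg A 0)) \<cdot> leg A (Suc n) \<cdot> chr A n s"
      by (rule comp_cong1[OF left_map_simps(6)[OF lA]]) (use hom in \<open>auto simp: Hom_iff\<close>)
    also have "\<dots> = leg A (Suc n) \<cdot> chr A n s"
      using unit_hom(2)[OF lc] leg_simps(3)[OF A, of 0] by simp
    finally show ?thesis using main by (simp add: k_def)
  qed
  then show ?thesis using Ah left_map_simps(1)[OF H_obj(2)[OF A]] by (auto simp: cellular_def)
qed

lemma H_unique: "H = cx_functor"
proof -
  have obj: "FObj H A = cx_lmap A" if A: "is_cell_complex U A" for A
  proof -
    have "cx_struct A = H_struct A"
      using left_map_simps[OF H_obj(2)[OF A]] leg_simps(3)[OF A, of 0]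
      by (intro cx_struct_eqI[OF A cellular_H_struct[OF A]]) simp_all
    then show ?thesis using H_obj(1)[OF A] by (simp add: cx_lmap_def)
  qed
  have ext: "FObj H \<in> extensional (Obj (CellCx U))" "FArr H \<in> extensional (Arr (CellCx U))"
    using H by (auto simp: is_functor_over_def is_functor_def PiE_def)
  have "FObj H = FObj cx_functor"
    by (rule extensionalityI[OF ext(1)]) (auto simp: cx_functor_def obj)
  moreover have "FArr H = FArr cx_functor"
    by (rule extensionalityI[OF ext(2)])
      (auto simp: cx_functor_def H_arr(1) obj CellCx_arr_simps(1,2))
  ultimately show ?thesis by (intro cat_functor.equality) simp_all
qed

end

end

theorem proposition8p4:
  fixes U :: "'u universe"
    and W :: "'u top_arr awfs"
    and F :: "(nat, nat, 'u top_arr lmap, 'u top_arr lmap_arr) cat_functor"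
  assumes "is_universe U"
    and "is_awfs (Top U) W"
    and "is_functor_over J_cat (J_incl U) (LMap (Top U) W) (LMap_forget (Top U) W) F"
  shows "\<exists>!F'. is_functor_over (CellCx U) (CellCx_forget U) (LMap (Top U) W) (LMap_forget (Top U) W) F' \<and>
               F = comp_functor J_cat F' (eta U) \<and>
               preserves_composition U W F'"
proof -
  interpret spaces U using assms(1) by unfold_locales
  interpret awfs_on "Top U" W using assms(2) by unfold_locales
  have J: "Obj J_cat = UNIV" "Arr J_cat = UNIV" "Id J_cat n = n" for n
    by (simp_all add: J_cat_def discrete_cat_def)
  have Ff: "is_functor J_cat (LMap T W) F" and Fo: "comp_functor J_cat (LMap_forget T W) F = J_incl U"
    using assms(3) by (simp_all add: is_functor_over_def)
  define \<phi> where "\<phi> n = SqCod (snd (FObj F n))" for n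
  have obj: "FObj F n = (cell_incl U n, sq (cell_incl U n) (L (cell_incl U n)) (id\<^sub>C (Dom T (cell_incl U n))) (\<phi> n))"
    "left_map (cell_incl U n) (\<phi> n)" for n
  proof -
    have o: "FObj F n \<in> Obj (LMap T W)" using Ff J by (auto simp: is_functor_def)
    then obtain f \<alpha> where f: "FObj F n = (f, sq f (L f) (id\<^sub>C (Dom T f)) \<alpha>)" "left_map f \<alpha>"
      unfolding Obj_LMap_iff by blast
    have "FObj (comp_functor J_cat (LMap_forget T W) F) n = cell_incl U n"
      unfolding Fo by (simp add: J_incl_def)
    then have "f = cell_incl U n"
      using o f(1) by (simp add: comp_functor_def LMap_forget_def J)
    moreover have "\<phi> n = \<alpha>" using f(1) by (simp add: \<phi>_def)
    ultimately show "FObj F n = (cell_incl U n, sq (cell_incl U n) (L (cell_incl U n))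
        (id\<^sub>C (Dom T (cell_incl U n))) (\<phi> n))" "left_map (cell_incl U n) (\<phi> n)"
      using f by simp_all
  qed
  interpret generating_left_maps U W \<phi> by unfold_locales (rule obj(2))
  have LMap: "is_category (LMap T W)" using Ff by (simp add: is_functor_def)
  have cx: "is_cell_complex U (eta_obj U n)" for n
    unfolding eta_obj_eq using stratum_cx[OF cell_stratum] .
  have F_id: "FArr F n = Id (LMap T W) (FObj F n)" for n
    using Ff J unfolding is_functor_def by (metis UNIV_I)
  show ?thesis
  proof (rule ex1I[of _ cx_functor], intro conjI)
    show over: "is_functor_over (CellCx U) (CellCx_forget U) (LMap T W) (LMap_forget T W) cx_functor"
      by (rule cx_functor_over[OF LMap])
    have "FObj F n = FObj cx_functor (eta_obj U n)" for n
      using cx[of n] cx_struct_cell[of n] obj(1)[of n] by (simp add: cx_functor_def cx_lmap_def eta_obj_eq)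
    moreover have "FArr F n = FArr cx_functor (Id (CellCx U) (eta_obj U n))" for n
      using over cx[of n] F_id[of n] calculation[of n]
      by (simp add: is_functor_over_def is_functor_def)
    ultimately show "F = comp_functor J_cat cx_functor (eta U)"
      by (intro cat_functor.equality) (auto simp: comp_functor_def eta_def J)
    show "preserves_composition U W cx_functor"
      unfolding preserves_composition_def
    proof (intro allI impI)
      fix A B C assume comp: "is_composite U B A C"
      then show "FObj cx_functor C = LMap_comp T W (FObj cx_functor A) (FObj cx_functor B)"
        using cx_lmap_composite[OF comp] composite_cellular(3)[OF comp]
        by (simp add: cx_functor_def is_composite_def)
    qed
  next
    fix H assume H: "is_functor_over (CellCx U) (CellCx_forget U) (LMap T W) (LMap_forget T W) H \<and>
      F = comp_functor J_cat H (eta U) \<and> preserves_composition U W H"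
    have "FObj H (eta_obj U n) = FObj F n" for n
      using H by (simp add: comp_functor_def eta_def J)
    then show "H = cx_functor"
      using H obj(1) by (intro H_unique) auto
  qed
qed

end
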